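(* Let $T$ be an ergodic automorphism of a standard probability space $(X,\mathcal B,\mu)$ which has the AOP property, let $G$ be a locally compact second countable Abelian group, and let $\varphi\colon X\to G$ be an ergodic cocycle. Assume that for every pair of distinct primes $r\neq s$ and every ergodic joining $\eta\in J^e(T^r,T^s)$: (E4) the transformation $(x,g,x')\mapsto (T^rx,\varphi^{(r)}(x)+g,T^sx')$ of $(X\times G\times X)$, considered with the measure obtained from $\eta\otimes\lambda_G$ (i.e. the group extension $(T_\varphi)^r\times T^s$ over $(T^r\times T^s,\eta)$), is ergodic; (E5) the Mackey action of the $G\times G$-valued cocycle $(x,x')\mapsto(\varphi^{(r)}(x),\varphi^{(s)}(x'))$ over the automorphism $(T^r\times T^s,\eta)$ is weakly mixing. Then for every ergodic measure-preserving $G$-action $\mathcal S=(S_g)_{g\in G}$ on a standard probability space $(Y,\mathcal C,\nu)$, the Rokhlin extension $T_{\varphi,\mathcal S}$ has the AOP property.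
   Context: For a cocycle $\varphi\colon X\to G$ over $T$, $\varphi^{(n)}(x)=\varphi(x)+\varphi(Tx)+\dots+\varphi(T^{n-1}x)$ for $n\ge1$, $\varphi^{(0)}=0$. The group extension $T_\varphi$ is $T_\varphi(x,g)=(Tx,\varphi(x)+g)$ on $(X\times G,\mu\otimes\lambda_G)$ ($\lambda_G$ Haar measure); $\varphi$ is ergodic if $T_\varphi$ is ergodic. The Mackey action of $\varphi$ is the non-singular $G$-action induced by the translations $\tau_g(x,g')=(x,g+g')$ on the space of ergodic components of $T_\varphi$ (with $\lambda_G$ replaced by an equivalent probability measure). A non-singular ergodic $G$-action $(W_g)$ on $(C,\kappa)$ is weakly mixing if the only character $\chi\in\widehat G$ admitting $0\ne f\in L^\infty(\kappa)$ with $f\circ W_g=\chi(g)f$ for all $g$ is the trivial one. $J^e(T^r,T^s)$ denotes the set of ergodic joinings of $T^r$ and $T^s$ (i.e. $T^r\times T^s$-invariant ergodic probability measures on $X\times X$ with both marginals $\mu$). An ergodic $T$ has the AOP property if for all $f,g\in L^2_0(X,\mu)$, $\limsup_{r\ne s,\ r,s \text{ prime},\ r,s\to\infty}\sup_{\kappa\in J^e(T^r,T^s)}\left|\int f\otimes g\,d\kappa\right|=0$. The Rokhlin extension is $T_{\varphi,\mathcal S}(x,y)=(Tx,S_{\varphi(x)}y)$ on $(X\times Y,\mu\otimes\nu)$. *)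

theory Defs
  imports "HOL-Probability.Probability" "HOL-Computational_Algebra.Primes"
begin

definition ergodic_map :: "'a measure \<Rightarrow> ('a \<Rightarrow> 'a) \<Rightarrow> bool" where
  "ergodic_map M f \<longleftrightarrow> f \<in> M \<rightarrow>\<^sub>M M \<and>
     (\<forall>A\<in>sets M. f -` A \<inter> space M = A \<longrightarrow>
        emeasure M A = 0 \<or> emeasure M (space M - A) = 0)"

definition mp_map :: "'a measure \<Rightarrow> ('a \<Rightarrow> 'a) \<Rightarrow> bool" where
  "mp_map M f \<longleftrightarrow> f \<in> M \<rightarrow>\<^sub>M M \<and> distr M M f = M"

definition mp_automorphism :: "'a measure \<Rightarrow> ('a \<Rightarrow> 'a) \<Rightarrow> bool" where
  "mp_automorphism M T \<longleftrightarrow> prob_space M \<and> space M = UNIV \<and> bij T \<and>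
     mp_map M T \<and> inv T \<in> M \<rightarrow>\<^sub>M M"

definition standard_prob_space :: "'a::polish_space measure \<Rightarrow> bool" where
  "standard_prob_space M \<longleftrightarrow> sets M = sets borel \<and> prob_space M"

definition haar_measure :: "'g::{topological_ab_group_add} measure \<Rightarrow> bool" where
  "haar_measure L \<longleftrightarrow> sets L = sets borel \<and>
     (\<forall>g. \<forall>A\<in>sets borel. emeasure L ((\<lambda>x. g + x) ` A) = emeasure L A) \<and>
     (\<forall>K. compact K \<longrightarrow> emeasure L K < \<infinity>) \<and>
     (\<forall>U. open U \<and> U \<noteq> {} \<longrightarrow> emeasure L U > 0)"

definition cocycle_sum :: "('a \<Rightarrow> 'a) \<Rightarrow> ('a \<Rightarrow> 'g::comm_monoid_add) \<Rightarrow> nat \<Rightarrow> 'a \<Rightarrow> 'g" where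
  "cocycle_sum T \<phi> n x = (\<Sum>i<n. \<phi> ((T ^^ i) x))"

definition group_ext :: "('a \<Rightarrow> 'a) \<Rightarrow> ('a \<Rightarrow> 'g::plus) \<Rightarrow> 'a \<times> 'g \<Rightarrow> 'a \<times> 'g" where
  "group_ext T \<phi> = (\<lambda>(x, g). (T x, \<phi> x + g))"

definition ergodic_cocycle :: "'a measure \<Rightarrow> ('a \<Rightarrow> 'a) \<Rightarrow> 'g::plus measure \<Rightarrow> ('a \<Rightarrow> 'g) \<Rightarrow> bool" where
  "ergodic_cocycle M T L \<phi> \<longleftrightarrow> ergodic_map (M \<Otimes>\<^sub>M L) (group_ext T \<phi>)"

definition cont_character :: "('h::{topological_space, ab_group_add} \<Rightarrow> complex) \<Rightarrow> bool" where
  "cont_character chr \<longleftrightarrow> continuous_on UNIV chr \<and> (\<forall>a b. chr (a + b) = chr a * chr b) \<and>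
     (\<forall>a. cmod (chr a) = 1)"

text \<open>Weak mixing of the Mackey action of the cocycle psi over (R, M), with Haar measure L on H.
  L-infinity functions on the space of ergodic components of R_psi are exactly the
  (classes of) essentially bounded R_psi-invariant functions on (space x H, M x L); the Mackey
  action is induced by the translations tau_h(w,k) = (w, k + h).\<close>
definition mackey_weakly_mixing ::
  "'a measure \<Rightarrow> ('a \<Rightarrow> 'a) \<Rightarrow> 'h::{topological_space, ab_group_add} measure \<Rightarrow> ('a \<Rightarrow> 'h) \<Rightarrow> bool" where
  "mackey_weakly_mixing M R L \<psi> \<longleftrightarrow>
     (\<forall>chr f. cont_character chr \<and> f \<in> borel_measurable (M \<Otimes>\<^sub>M L) \<and>
        (\<exists>B. AE z in M \<Otimes>\<^sub>M L. cmod (f z) \<le> B) \<and>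
        (AE z in M \<Otimes>\<^sub>M L. f (group_ext R \<psi> z) = f z) \<and>
        \<not> (AE z in M \<Otimes>\<^sub>M L. f z = 0) \<and>
        (\<forall>h. AE z in M \<Otimes>\<^sub>M L. f (fst z, snd z + h) = chr h * f z)
      \<longrightarrow> (\<forall>h. chr h = 1))"

definition ergodic_joinings :: "'a measure \<Rightarrow> ('a \<Rightarrow> 'a) \<Rightarrow> ('a \<Rightarrow> 'a) \<Rightarrow> ('a \<times> 'a) measure set" where
  "ergodic_joinings M A B = {\<eta>. sets \<eta> = sets (M \<Otimes>\<^sub>M M) \<and> prob_space \<eta> \<and>
      distr \<eta> M fst = M \<and> distr \<eta> M snd = M \<and>
      mp_map \<eta> (\<lambda>(x, y). (A x, B y)) \<and> ergodic_map \<eta> (\<lambda>(x, y). (A x, B y))}"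

definition AOP :: "'a measure \<Rightarrow> ('a \<Rightarrow> 'a) \<Rightarrow> bool" where
  "AOP M T \<longleftrightarrow> ergodic_map M T \<and>
     (\<forall>f g :: 'a \<Rightarrow> complex.
        f \<in> borel_measurable M \<and> integrable M (\<lambda>x. (cmod (f x))\<^sup>2) \<and> integral\<^sup>L M f = 0 \<and>
        g \<in> borel_measurable M \<and> integrable M (\<lambda>x. (cmod (g x))\<^sup>2) \<and> integral\<^sup>L M g = 0 \<longrightarrow>
        (\<forall>\<epsilon>>0. \<exists>N. \<forall>r s. prime r \<and> prime s \<and> r \<noteq> s \<and> N \<le> r \<and> N \<le> s \<longrightarrow>
           (\<forall>\<eta>\<in>ergodic_joinings M (T ^^ r) (T ^^ s).
              cmod (\<integral>z. f (fst z) * g (snd z) \<partial>\<eta>) \<le> \<epsilon>)))"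

definition mp_action :: "'y measure \<Rightarrow> ('g::{topological_space, monoid_add} \<Rightarrow> 'y \<Rightarrow> 'y) \<Rightarrow> bool" where
  "mp_action N S \<longleftrightarrow> (\<lambda>(g, y). S g y) \<in> (borel \<Otimes>\<^sub>M N) \<rightarrow>\<^sub>M N \<and>
     S 0 = id \<and> (\<forall>g h. S (g + h) = S g \<circ> S h) \<and> (\<forall>g. mp_map N (S g))"

definition ergodic_action :: "'y measure \<Rightarrow> ('g \<Rightarrow> 'y \<Rightarrow> 'y) \<Rightarrow> bool" where
  "ergodic_action N S \<longleftrightarrow> (\<forall>A\<in>sets N. (\<forall>g. S g -` A \<inter> space N = A) \<longrightarrow>
        emeasure N A = 0 \<or> emeasure N (space N - A) = 0)"

definition rokhlin_ext :: "('a \<Rightarrow> 'a) \<Rightarrow> ('a \<Rightarrow> 'g) \<Rightarrow> ('g \<Rightarrow> 'y \<Rightarrow> 'y) \<Rightarrow> 'a \<times> 'y \<Rightarrow> 'a \<times> 'y" where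
  "rokhlin_ext T \<phi> S = (\<lambda>(x, y). (T x, S (\<phi> x) y))"

end

theory Submission
  imports Defs
begin

text \<open>An ergodic joining \<open>\<kappa>\<close> of \<open>T\<^sub>\<phi>\<^sub>,\<^sub>S^r\<close> and \<open>T\<^sub>\<phi>\<^sub>,\<^sub>S^s\<close> projects to an ergodic joining \<open>\<eta>\<close> of
  \<open>T^r\<close> and \<open>T^s\<close>. A joining of a Rokhlin extension over an ergodic cocycle with prescribed base
  and fibre marginals is the product measure: twisting it by \<open>S (- g)\<close> gives, for each set in the
  fibre, a measure on \<open>base \<times> G\<close> that is invariant under the ergodic group extension and dominated by
  the product measure, hence a multiple of it. Adjoining the two fibres one at a time shows that
  \<open>\<kappa>\<close> is \<open>\<eta> \<otimes> \<nu> \<otimes> \<nu>\<close>, so that integrals over \<open>\<kappa>\<close> reduce to the base by taking fibre means. The first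
  fibre needs (E4). The second one needs ergodicity of the Rokhlin extension by \<open>\<phi>^(r)\<close> of the group
  extension by \<open>\<phi>^(s)\<close>. If this fails, an eigenfunction argument in the style of Keane produces a
  nontrivial character \<open>\<xi>\<close> and a bounded \<open>v \<noteq> 0\<close> with \<open>(v \<circ> group_ext R \<phi>^(s)) * \<xi> \<circ> \<phi>^(r) = v\<close>, and then
  \<open>\<xi> g\<^sub>1 * v (w, g\<^sub>2)\<close> is an eigenfunction of the Mackey action, contradicting (E5). The character is
  found without spectral theory, as an extreme point of a compact convex set of dominated
  functionals on \<open>G\<close>.\<close>

section \<open>Ergodic maps and invariant measures\<close>

text \<open>The Mackey action is only non-singular, so unitary spectra of two measure-preserving
  actions cannot be compared directly; what remains is that the fibre action preserves a probability
  measure. An invariant function of the Rokhlin extension assigns to points of the Mackey space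
  vectors in L2 of the fibre, equivariantly and, by ergodicity, with constant norm. Two families of
  numbers are kept: autocorrelations under the group, and integrals over windows paired with a
  difference of two window averages. The first behaves like a normalised positive definite function,
  the second like an L-infinity function on the Mackey space, and both transform alike when 1 + l
  U_h is applied to the vectors. At an extreme point the first becomes a character and the second an
  eigenfunction for it. Maximising an affine functional that compares two windows and vanishes on
  constants forces the character to be nontrivial. An eigenfunction in one group coordinate is not
  yet one for the product group: ergodicity of the other extension supplies the second translation
  eigenvalue.\<close>

text \<open>Preimages under \<open>e\<close> of strictly invariant sets are strictly invariant and
  have the same measure. Besides genuine factors this covers reorderings of coordinates, which is
  how ergodicity is moved between differently arranged products.\<close>

lemma ergodic_map_factor:
  assumes "ergodic_map M f" and sp: "space M = UNIV" "space M' = UNIV"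
    and e: "e \<in> M \<rightarrow>\<^sub>M M'" "distr M M' e = M'"
    and f': "f' \<in> M' \<rightarrow>\<^sub>M M'" and comm: "\<And>x. e (f x) = f' (e x)"
  shows "ergodic_map M' f'"
  unfolding ergodic_map_def
proof (intro conjI ballI impI f')
  fix A assume A: "A \<in> sets M'" "f' -` A \<inter> space M' = A"
  have meas: "emeasure M' B = emeasure M (e -` B)" if "B \<in> sets M'" for B
    using that emeasure_distr[OF e(1), of B] e(2) sp by simp
  have "e -` A \<in> sets M"
    using e(1) A(1) sp measurable_sets[OF e(1) A(1)] by simp
  moreover have "f -` (e -` A) \<inter> space M = e -` A"
    using A(2) sp by (auto simp: comm)
  ultimately have "emeasure M (e -` A) = 0 \<or> emeasure M (space M - e -` A) = 0"
    using assms(1) unfolding ergodic_map_def by blast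
  moreover have "space M - e -` A = e -` (space M' - A)" using sp by auto
  ultimately show "emeasure M' A = 0 \<or> emeasure M' (space M' - A) = 0"
    using A(1) meas by auto
qed

text \<open>The set of points visiting \<open>A\<close> infinitely often is strictly invariant and, when \<open>A\<close> is invariant
  up to null sets, it differs from \<open>A\<close> by a null set.\<close>
lemma ergodic_map_AE_invariant_set:
  assumes erg: "ergodic_map M f" and dis: "distr M M f = M"
    and P: "Measurable.pred M P" and inv: "AE x in M. P (f x) = P x"
  shows "(AE x in M. P x) \<or> (AE x in M. \<not> P x)"
proof -
  have f[measurable]: "f \<in> M \<rightarrow>\<^sub>M M" using erg by (simp add: ergodic_map_def)
  note P[measurable]
  have fn[measurable]: "(f ^^ n) \<in> M \<rightarrow>\<^sub>M M" for n
    by (induction n) (auto simp: o_def)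
  have AEn: "AE x in M. P ((f ^^ n) x) = P x" for n
  proof (induction n)
    case (Suc n)
    have "AE x in distr M M f. P ((f ^^ n) x) = P x" unfolding dis by (rule Suc)
    then have "AE x in M. P ((f ^^ n) (f x)) = P (f x)"
      by (subst (asm) AE_distr_iff) auto
    with inv show ?case by eventually_elim (simp add: funpow_swap1)
  qed simp
  define A where "A = {x\<in>space M. \<forall>n. \<exists>m\<ge>n. P ((f ^^ m) x)}"
  have A: "A \<in> sets M" unfolding A_def by measurable
  have eq: "(\<forall>n. \<exists>m\<ge>n. P ((f ^^ m) (f x))) \<longleftrightarrow> (\<forall>n. \<exists>m\<ge>n. P ((f ^^ m) x))" for x
  proof safe
    fix n assume "\<forall>n. \<exists>m\<ge>n. P ((f ^^ m) (f x))"
    then obtain m where "m \<ge> n" "P ((f ^^ m) (f x))" by blast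
    then show "\<exists>m\<ge>n. P ((f ^^ m) x)"
      by (intro exI[of _ "Suc m"]) (simp add: funpow_swap1)
  next
    fix n assume "\<forall>n. \<exists>m\<ge>n. P ((f ^^ m) x)"
    \<comment> \<open>Asking for \<open>Suc n\<close> instead of \<open>n\<close> makes
      \<open>m\<close> positive and keeps \<open>m - 1\<close> at least \<open>n\<close>.\<close>
    then obtain m where "m \<ge> Suc n" "P ((f ^^ m) x)" by blast
    then show "\<exists>m\<ge>n. P ((f ^^ m) (f x))"
      by (intro exI[of _ "m - 1"]) (cases m, auto simp: funpow_swap1)
  qed
  have "f -` A \<inter> space M = A"
    using eq measurable_space[OF f] by (auto simp: A_def)
  then have inv0: "emeasure M A = 0 \<or> emeasure M (space M - A) = 0"
    using erg A unfolding ergodic_map_def by blast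
  have AEA: "AE x in M. P x = (x \<in> A)"
  proof -
    have "AE x in M. \<forall>n. P ((f ^^ n) x) = P x" using AEn by (simp add: AE_all_countable)
    then show ?thesis using AE_space by eventually_elim (auto simp: A_def)
  qed
  from inv0 show ?thesis
  proof
    assume "emeasure M A = 0"
    then have "AE x in M. x \<notin> A" using A by (intro AE_not_in) (auto simp: null_sets_def)
    with AEA have "AE x in M. \<not> P x" by eventually_elim simp
    then show ?thesis ..
  next
    assume "emeasure M (space M - A) = 0"
    then have "AE x in M. x \<in> A" using A by (intro AE_I[of _ _ "space M - A"]) auto
    with AEA have "AE x in M. P x" by eventually_elim simp
    then show ?thesis ..
  qed
qed

text \<open>For each basic open set, \<open>u\<close> is almost surely inside or almost surely
  outside; countably many such answers hold simultaneously and determine the value, because the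
  basis separates points.\<close>

lemma ergodic_map_AE_invariant_const:
  fixes u :: "'a \<Rightarrow> 'b::{second_countable_topology, t2_space}"
  assumes erg: "ergodic_map M f" and dis: "distr M M f = M"
    and u[measurable]: "u \<in> borel_measurable M" and inv: "AE x in M. u (f x) = u x"
  shows "\<exists>c. AE x in M. u x = c"
proof -
  obtain B :: "'b set set" where B: "countable B" "topological_basis B"
    using ex_countable_basis by auto
  have opn: "open b" if "b \<in> B" for b using B(2) that by (rule topological_basis_open)
  have "\<exists>t. AE x in M. (u x \<in> b) = t" if b: "b \<in> B" for b
  proof -
    have "(AE x in M. u x \<in> b) \<or> (AE x in M. u x \<notin> b)"
    proof (rule ergodic_map_AE_invariant_set[OF erg dis])
      have [measurable]: "b \<in> sets borel" using opn[OF b] by auto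
      show "Measurable.pred M (\<lambda>x. u x \<in> b)" by measurable
      show "AE x in M. (u (f x) \<in> b) = (u x \<in> b)" using inv by eventually_elim simp
    qed
    then show ?thesis
    proof
      assume "AE x in M. u x \<in> b" then show ?thesis by (intro exI[of _ True]) simp
    next
      assume "AE x in M. u x \<notin> b" then show ?thesis by (intro exI[of _ False]) simp
    qed
  qed
  then have "\<forall>b\<in>B. \<exists>t. AE x in M. (u x \<in> b) = t" by blast
  from bchoice[OF this] obtain t where "\<forall>b\<in>B. AE x in M. (u x \<in> b) = t b" by blast
  then have AEb: "AE x in M. \<forall>b\<in>B. (u x \<in> b) = t b"
    using B(1) by (subst AE_ball_countable) auto
  show ?thesis
  proof (cases "\<exists>x. \<forall>b\<in>B. (u x \<in> b) = t b")
    case True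
    then obtain z where z: "\<forall>b\<in>B. (u z \<in> b) = t b" by blast
    have "u x = u z" if "\<forall>b\<in>B. (u x \<in> b) = t b" for x
    proof (rule ccontr)
      assume "u x \<noteq> u z"
      then obtain U where "open U" "u x \<in> U" "u z \<notin> U" using t1_space by blast
      then obtain b where "b \<in> B" "u x \<in> b" "b \<subseteq> U" using B(2) topological_basisE by metis
      then show False using that z \<open>u z \<notin> U\<close> by blast
    qed
    with AEb show ?thesis by (intro exI[of _ "u z"]) auto
  next
    case False
    \<comment> \<open>No point realises the answers \<open>t\<close> at all, so the measure is zero
      and any constant will do.\<close>
    with AEb have "AE x in M. False" by (auto elim!: eventually_mono)
    then show ?thesis by auto
  qed
qed

text \<open>Unlike \<open>mp_automorphism\<close> this allows infinite measures, as needed for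
  extensions by Haar measure. Invertibility holds at every point, so each measurable set is exactly
  a preimage of a measurable set.\<close>

definition mp_iso :: "'a measure \<Rightarrow> ('a \<Rightarrow> 'a) \<Rightarrow> bool" where
  "mp_iso M f \<longleftrightarrow> space M = UNIV \<and> f \<in> M \<rightarrow>\<^sub>M M \<and> distr M M f = M \<and>
     (\<exists>f'\<in>M \<rightarrow>\<^sub>M M. (\<forall>x. f' (f x) = x) \<and> (\<forall>x. f (f' x) = x))"

lemma mp_isoD:
  assumes "mp_iso M f"
  shows "space M = UNIV" "f \<in> M \<rightarrow>\<^sub>M M" "distr M M f = M"
  using assms by (auto simp: mp_iso_def)

lemma mp_iso_AE:
  assumes "mp_iso M f" and AE: "AE x in M. P x"
  shows "AE x in M. P (f x)"
proof -
  obtain A where A: "{x\<in>space M. \<not> P x} \<subseteq> A" "emeasure M A = 0" "A \<in> sets M"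
    using AE by (rule AE_E)
  have "emeasure M (f -` A \<inter> space M) = 0"
    using A mp_isoD[OF assms(1)] emeasure_distr[of f M M A] by simp
  moreover have "f -` A \<inter> space M \<in> sets M" using A mp_isoD(2)[OF assms(1)] by (simp add: measurable_sets)
  ultimately show ?thesis
    using A mp_isoD(1)[OF assms(1)] by (intro AE_I[of _ _ "f -` A \<inter> space M"]) auto
qed

text \<open>A density of \<open>N\<close> with respect to \<open>M\<close> is invariant, hence constant.\<close>
lemma invariant_measure_le_ergodic:
  assumes "sigma_finite_measure M" and iso: "mp_iso M f" and erg: "ergodic_map M f"
    and sets: "sets N = sets M" and dis: "distr N N f = N"
    and le: "\<And>A. A \<in> sets M \<Longrightarrow> emeasure N A \<le> emeasure M A"
  shows "\<exists>c::ennreal. \<forall>A\<in>sets M. emeasure N A = c * emeasure M A"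
proof -
  interpret sigma_finite_measure M by fact
  obtain f' where f': "f' \<in> M \<rightarrow>\<^sub>M M" "\<And>x. f' (f x) = x" "\<And>x. f (f' x) = x"
    using iso by (auto simp: mp_iso_def)
  note fM = mp_isoD[OF iso]
  note [measurable] = f'(1) fM(2)
  have fN: "f \<in> N \<rightarrow>\<^sub>M N" using fM sets by (simp cong: measurable_cong_sets)
  have "absolutely_continuous M N"
    using le sets 
    by (auto simp: absolutely_continuous_def null_sets_def simp flip: le_zero_eq) fastforce
  then obtain \<rho> where \<rho>[measurable]: "\<rho> \<in> borel_measurable M" and N: "density M \<rho> = N"
    using Radon_Nikodym sets by metis
  have eqN: "emeasure N A = (\<integral>\<^sup>+x. \<rho> x * indicator A x \<partial>M)" if "A \<in> sets M" for A
    using that by (simp add: N[symmetric] emeasure_density)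
  \<comment> \<open>Both functions are integrated over an arbitrary \<open>A\<close>. Writing
    \<open>A\<close> as the \<open>f\<close>-preimage of its image turns the left integrand into a
    composition with \<open>f\<close>, after which invariance of \<open>M\<close> and then of
    \<open>N\<close> applies.\<close>
  have "AE x in M. \<rho> (f x) = \<rho> x"
  proof (rule density_unique2)
    fix A assume A[measurable]: "A \<in> sets M"
    have "f' -` A \<inter> space M \<in> sets M" by measurable
    then have [measurable]: "f' -` A \<in> sets M" using fM by simp
    have "(\<integral>\<^sup>+x\<in>A. \<rho> (f x) \<partial>M) = (\<integral>\<^sup>+x. \<rho> (f x) * indicator (f' -` A) (f x) \<partial>M)"
      by (intro nn_integral_cong) (auto simp: f' indicator_def)
    also have "\<dots> = (\<integral>\<^sup>+x. \<rho> x * indicator (f' -` A) x \<partial>distr M M f)"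
      by (subst nn_integral_distr) auto
    also have "\<dots> = emeasure N (f' -` A)" by (simp add: fM eqN)
    also have "\<dots> = emeasure (distr N N f) (f' -` A)" by (simp add: dis)
    also have "\<dots> = emeasure N (f -` (f' -` A) \<inter> space N)"
      using fN sets by (subst emeasure_distr) auto
    also have "f -` (f' -` A) \<inter> space N = A" using sets_eq_imp_space_eq[OF sets] fM by (auto simp: f')
    finally show "(\<integral>\<^sup>+x\<in>A. \<rho> (f x) \<partial>M) = (\<integral>\<^sup>+x\<in>A. \<rho> x \<partial>M)" using eqN[OF A] by simp
  qed auto
  then obtain c where c: "AE x in M. \<rho> x = c"
    using ergodic_map_AE_invariant_const[OF erg fM(3) \<rho>] by auto
  have "emeasure N A = c * emeasure M A" if "A \<in> sets M" for A
  proof -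
    have "emeasure N A = (\<integral>\<^sup>+x. c * indicator A x \<partial>M)"
      unfolding eqN[OF that] 
      by (rule nn_integral_cong_AE) (use c in \<open>auto elim!: eventually_mono\<close>)
    then show ?thesis using that by (simp add: nn_integral_cmult)
  qed
  then show ?thesis by blast
qed

section \<open>Locally compact groups and Haar measure\<close>

locale haar_group =
  fixes L :: "'g::{topological_ab_group_add, second_countable_topology, t2_space} measure"
  assumes lc: "locally_compact_space (euclidean :: 'g topology)" and haar: "haar_measure L"
begin

lemma sets_L[simp, measurable_cong]: "sets L = sets borel"
  using haar by (simp add: haar_measure_def)

lemma space_L[simp]: "space L = UNIV"
  using sets_eq_imp_space_eq[OF sets_L] by simp

lemma emeasure_L_compact: "compact K \<Longrightarrow> emeasure L K < \<infinity>"
  and emeasure_L_open: "open U \<Longrightarrow> U \<noteq> {} \<Longrightarrow> emeasure L U > 0"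
  and emeasure_L_image: "A \<in> sets borel \<Longrightarrow> emeasure L ((\<lambda>x. g + x) ` A) = emeasure L A"
  using haar by (auto simp: haar_measure_def)

lemma distr_L_translation: "distr L L (\<lambda>x. g + x) = L"
proof (rule measure_eqI)
  fix A assume "A \<in> sets (distr L L (\<lambda>x. g + x))"
  then have A: "A \<in> sets borel" by simp
  have "(\<lambda>x. g + x) -` A = (\<lambda>x. - g + x) ` A"
  proof (intro equalityI subsetI)
    fix x assume "x \<in> (\<lambda>x. g + x) -` A"
    then show "x \<in> (\<lambda>x. - g + x) ` A" by (intro image_eqI[of _ _ "g + x"]) auto
  qed auto
  then show "emeasure (distr L L (\<lambda>x. g + x)) A = emeasure L A"
    using A emeasure_L_image[OF A, of "- g"] by (subst emeasure_distr) auto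
qed simp

lemma compact_neighbourhood: "\<exists>U K. open U \<and> compact K \<and> x \<in> U \<and> U \<subseteq> (K::'g set)"
  using lc by (auto simp: locally_compact_space_def)

text \<open>Lindelof's theorem selects countably many of the open sets with compact hull given by
  local compactness.\<close>

lemma sigma_compact: "\<exists>K :: nat \<Rightarrow> 'g set. (\<forall>n. compact (K n)) \<and> (\<Union>n. K n) = UNIV"
proof -
  let ?F = "{U :: 'g set. open U \<and> (\<exists>K. compact K \<and> U \<subseteq> K)}"
  obtain F' where F': "F' \<subseteq> ?F" "countable F'" "\<Union>F' = \<Union>?F"
    using Lindelof[of ?F] by auto
  have un: "\<Union>?F = UNIV" using compact_neighbourhood by blast
  then have "F' \<noteq> {}" using F' by auto
  then have U: "range (from_nat_into F') = F'" (is "range ?U = _") using F'(2) by (rule range_from_nat_into)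
  have "\<exists>K. compact K \<and> ?U n \<subseteq> K" for n using U F'(1) by blast
  then obtain K where K: "\<And>n. compact (K n)" "\<And>n. ?U n \<subseteq> K n" by metis
  have "(\<Union>n. ?U n) = UNIV" using U F'(3) un by simp
  moreover have "(\<Union>n. ?U n) \<subseteq> (\<Union>n. K n)" using K(2) by (intro UN_mono) auto
  ultimately have "(\<Union>n. K n) = UNIV" by (simp add: top.extremum_unique)
  with K(1) show ?thesis by blast
qed

lemma sigma_finite_L: "sigma_finite_measure L"
proof -
  obtain K :: "nat \<Rightarrow> 'g set" where K: "\<And>n. compact (K n)" "(\<Union>n. K n) = UNIV"
    using sigma_compact by auto
  have "emeasure L a \<noteq> \<infinity>" if a: "a \<in> range K" for a
  proof -
    obtain n where "a = K n" using a by blast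
    then show ?thesis using emeasure_L_compact[OF K(1)[of n]] by simp
  qed
  moreover have "range K \<subseteq> sets L" using K(1) borel_compact by auto
  ultimately show ?thesis
    using K(2) by (intro sigma_finite_measure.intro exI[of _ "range K"]) simp
qed

text \<open>By sigma-compactness every closed set is a countable union of compact sets. Compact sets
  thus form an intersection-stable generator on which Haar measure is finite, suited for uniqueness
  of measures.\<close>

lemma borel_eq_compact: "sets (borel :: 'g measure) = sigma_sets UNIV {K. compact K}"
proof
  obtain K :: "nat \<Rightarrow> 'g set" where K: "\<And>n. compact (K n)" "(\<Union>n. K n) = UNIV"
    using sigma_compact by auto
  interpret S: sigma_algebra UNIV "sigma_sets UNIV {K :: 'g set. compact K}"
    by (rule sigma_algebra_sigma_sets) auto
  have "S \<in> sigma_sets UNIV {K :: 'g set. compact K}" if "closed S" for S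
  proof -
    have "S = (\<Union>n. K n \<inter> S)" using K(2) by auto
    moreover have "compact (K n \<inter> S)" for n using K that by (intro compact_Int_closed) auto
    then have "(\<Union>n. K n \<inter> S) \<in> sigma_sets UNIV {K :: 'g set. compact K}"
      by (intro S.countable_UN) auto
    ultimately show ?thesis by simp
  qed
  then have "sigma_sets UNIV {S :: 'g set. closed S} \<subseteq> sigma_sets UNIV {K :: 'g set. compact K}"
    by (intro S.sigma_sets_subset) auto
  then show "sets (borel :: 'g measure) \<subseteq> sigma_sets UNIV {K. compact K}"
    by (simp add: borel_eq_closed)
  show "sigma_sets UNIV {K. compact K} \<subseteq> sets (borel :: 'g measure)"
    by (rule sets.sigma_sets_subset[of _ "borel::'g measure", simplified]) (auto intro: borel_compact)
qed

lemma Int_stable_compact: "Int_stable {K :: 'g set. compact K}"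
  by (auto simp: Int_stable_def intro: compact_Int)

lemma emeasure_finite_subset_compact:
  assumes "A \<subseteq> K" "compact K"
  shows "emeasure L A < \<infinity>"
proof -
  have "emeasure L A \<le> emeasure L K" using assms borel_compact by (intro emeasure_mono) auto
  also have "\<dots> < \<infinity>" using assms by (intro emeasure_L_compact)
  finally show ?thesis .
qed

section \<open>Outer regularity on compact sets and continuity of translation\<close>

text \<open>Regularity is derived from second countability: finite unions of basic sets covering
  \<open>K\<close>, cut down to an open \<open>W\<close> of finite measure, form a countable family
  with intersection \<open>K\<close>, since the Hausdorff property and compactness separate
  \<open>K\<close> from each outside point. Continuity from above does the rest.\<close>

lemma compact_outer_regular:
  assumes K: "compact (K :: 'g set)" and e: "e > (0::real)"
  shows "\<exists>U. open U \<and> K \<subseteq> U \<and> emeasure L U < \<infinity> \<and> measure L (U - K) < e"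
proof -
  obtain B :: "'g set set" where B: "countable B" "topological_basis B"
    using ex_countable_basis by auto
  have opn: "open b" if "b \<in> B" for b using B(2) that by (rule topological_basis_open)
  obtain W where W: "open W" "K \<subseteq> W" "emeasure L W < \<infinity>"
  proof -
    have "\<forall>x. \<exists>U. open U \<and> x \<in> U \<and> emeasure L U < \<infinity>"
    proof
      fix x :: 'g
      obtain U K where "open U" "compact K" "x \<in> U" "U \<subseteq> K" using compact_neighbourhood[of x] by blast
      then show "\<exists>U. open U \<and> x \<in> U \<and> emeasure L U < \<infinity>"
        by (intro exI[of _ U]) (auto simp: emeasure_finite_subset_compact[OF \<open>U \<subseteq> K\<close> \<open>compact K\<close>, unfolded infinity_ennreal_def])
    qed
    from choice[OF this] obtain U where U: "\<And>x. open (U x)" "\<And>x. x \<in> U x" "\<And>x. emeasure L (U x) < \<infinity>"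
      by blast
    obtain D where D: "D \<subseteq> K" "finite D" "K \<subseteq> (\<Union>x\<in>D. U x)"
    proof (rule compactE_image[OF K, of K U])
      show "K \<subseteq> (\<Union>x\<in>K. U x)" using U(2) by auto
    qed (use U(1) in auto)
    have "emeasure L (\<Union>x\<in>D. U x) \<le> (\<Sum>x\<in>D. emeasure L (U x))"
      using U D by (intro emeasure_subadditive_finite) auto
    also have "\<dots> < \<infinity>" using U(3) D(2) by (simp add: less_top[symmetric])
    finally show ?thesis using U D by (intro that[of "\<Union>x\<in>D. U x"]) auto
  qed
  let ?\<U> = "{W \<inter> \<Union>C | C. C \<subseteq> B \<and> finite C \<and> K \<subseteq> \<Union>C}"
  have cnt: "countable ?\<U>"
  proof -
    have "countable {C. finite C \<and> C \<subseteq> B}" using B(1) by (rule countable_Collect_finite_subset)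
    then have "countable ((\<lambda>C. W \<inter> \<Union>C) ` {C. finite C \<and> C \<subseteq> B})" by (rule countable_image)
    then show ?thesis by (rule countable_subset[rotated]) auto
  qed
  have sep: "\<exists>V\<in>?\<U>. x \<notin> V" if xK: "x \<notin> K" for x
  proof -
    have "\<forall>k\<in>K. \<exists>b. b \<in> B \<and> k \<in> b \<and> (\<exists>N. open N \<and> x \<in> N \<and> N \<inter> b = {})"
    proof
      fix k assume "k \<in> K"
      then have "k \<noteq> x" using xK by blast
      then obtain U N where UN: "open U" "open N" "k \<in> U" "x \<in> N" "U \<inter> N = {}"
        using hausdorff[of k x] by blast
      then obtain b where "b \<in> B" "k \<in> b" "b \<subseteq> U" using B(2) topological_basisE by metis
      then show "\<exists>b. b \<in> B \<and> k \<in> b \<and> (\<exists>N. open N \<and> x \<in> N \<and> N \<inter> b = {})" using UN by blast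
    qed
    then obtain b where b: "\<And>k. k \<in> K \<Longrightarrow> b k \<in> B \<and> k \<in> b k \<and> x \<notin> b k"
      by (metis disjoint_iff)
    obtain D where D: "D \<subseteq> K" "finite D" "K \<subseteq> (\<Union>k\<in>D. b k)"
      using compactE_image[OF K, of K b] b opn by blast
    have "b ` D \<subseteq> B" "x \<notin> \<Union>(b ` D)" using b D(1) by fast+
    note bD = this
    have "W \<inter> \<Union>(b ` D) \<in> ?\<U>"
      using D(2,3) bD(1) by (intro CollectI exI[of _ "b ` D"] conjI refl finite_imageI)
    moreover have "x \<notin> W \<inter> \<Union>(b ` D)" using bD(2) by (simp only: Int_iff not_False_eq_True de_Morgan_conj simp_thms)
    ultimately show ?thesis by (rule bexI[rotated])
  qed
  have ne: "?\<U> \<noteq> {}"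
  proof -
    obtain D where D: "D \<subseteq> B" "finite D" "K \<subseteq> \<Union>D"
    proof (rule compactE[OF K, of B])
      show "K \<subseteq> \<Union>B" using topological_basisE[OF B(2), of UNIV] by blast
    qed (use opn in auto)
    then have "W \<inter> \<Union>D \<in> ?\<U>" by (intro CollectI exI[of _ D] conjI refl)
    then show ?thesis by (rule ex_in_conv[THEN iffD1, OF exI])
  qed
  define V where "V = from_nat_into ?\<U>"
  have V: "range V = ?\<U>" unfolding V_def using ne cnt by (rule range_from_nat_into)
  have Vo: "open (V n)" "K \<subseteq> V n" "V n \<subseteq> W" for n
  proof -
    have "V n \<in> ?\<U>" unfolding V[symmetric] by (rule rangeI)
    then obtain C where C: "V n = W \<inter> \<Union>C" "C \<subseteq> B" "K \<subseteq> \<Union>C" by (elim CollectE exE conjE) rule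
    show "open (V n)" unfolding C(1) using opn W(1) C(2) by (intro open_Int open_Union) auto
    show "K \<subseteq> V n" "V n \<subseteq> W" using C W(2) by auto
  qed
  have VK: "(\<Inter>n. V n) = K"
  proof (rule antisym; rule subsetI)
    fix x assume x: "x \<in> (\<Inter>n. V n)"
    show "x \<in> K"
    proof (rule ccontr)
      assume "x \<notin> K"
      from sep[OF this] obtain U where "U \<in> range V" "x \<notin> U" unfolding V[symmetric] by (rule bexE)
      then show False using x by blast
    qed
  qed (use Vo in blast)
  \<comment> \<open>Finite intersections make the enumerated neighbourhoods decreasing, while
    \<open>W\<close> keeps their measure finite.\<close>
  define U where "U n = (\<Inter>i\<le>n. V i)" for n
  have U: "open (U n)" "K \<subseteq> U n" "U n \<subseteq> W" for n
  proof -
    show "open (U n)" unfolding U_def using Vo(1) by (intro open_INT) auto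
    show "K \<subseteq> U n" using Vo(2) by (auto simp: U_def)
    have "U n \<subseteq> V n" by (auto simp: U_def)
    then show "U n \<subseteq> W" using Vo(3)[of n] by (rule order_trans)
  qed
  have KW: "emeasure L (A - K) < \<infinity>" if "A \<subseteq> W" "A \<in> sets borel" for A
    using emeasure_mono[of "A - K" W L] W that by (auto intro: le_less_trans)
  have [measurable]: "K \<in> sets borel" using K borel_compact by blast
  have "(\<lambda>n. measure L (U n - K)) \<longlonglongrightarrow> measure L (\<Inter>n. U n - K)"
  proof (rule Lim_measure_decseq)
    show "decseq (\<lambda>n. U n - K)" by (auto simp: decseq_def U_def)
    show "range (\<lambda>n. U n - K) \<subseteq> sets L" using U by auto
    show "emeasure L (U n - K) \<noteq> \<infinity>" for n using KW[of "U n"] U by (auto simp: less_top)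
  qed
  moreover have "(\<Inter>n. U n - K) = {}" using VK by (auto simp: U_def)
  ultimately have "(\<lambda>n. measure L (U n - K)) \<longlonglongrightarrow> 0" by (simp only: measure_empty)
  then have "eventually (\<lambda>n. measure L (U n - K) < e) sequentially" using e by (rule order_tendstoD(2))
  then obtain n where n: "measure L (U n - K) < e" by (auto simp: eventually_sequentially)
  have "emeasure L (U n) < \<infinity>"
    using emeasure_mono[of "U n" W L] U W by (auto intro: le_less_trans)
  then show ?thesis using U n by blast
qed

lemma compact_translate: "compact (K :: 'g set) \<Longrightarrow> compact ((\<lambda>x. h + x) ` K)"
  by (intro compact_continuous_image continuous_intros)

text \<open>The tube lemma for the open set of pairs with \<open>h + x \<in> U\<close> around
  \<open>{0} \<times> K\<close>: small translates of \<open>K\<close> stay in a neighbourhood whose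
  excess over \<open>K\<close> is small. This is the source of continuity of the characters found
  later.\<close>

lemma measure_translate_diff_small:
  assumes K: "compact (K :: 'g set)" and e: "e > (0::real)"
  shows "\<exists>V. open V \<and> 0 \<in> V \<and> (\<forall>h\<in>V. measure L ((\<lambda>x. h + x) ` K - K) < e)"
proof -
  obtain U where U: "open U" "K \<subseteq> U" "emeasure L U < \<infinity>" "measure L (U - K) < e"
    using compact_outer_regular[OF K e] by auto
  have op: "open {(h, x). h + x \<in> U}"
  proof -
    have "open ((\<lambda>p. fst p + snd p) -` U)"
      using U(1) by (rule open_vimage) (intro continuous_intros)
    moreover have "(\<lambda>p. fst p + snd p) -` U = {(h, x). h + x \<in> U}" by auto
    ultimately show ?thesis by simp
  qed
  have "\<exists>A. 0 \<in> A \<and> open A \<and> A \<times> K \<subseteq> {(h, x). h + x \<in> U}"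
  proof -
    have "\<exists>p. open (fst p) \<and> open (snd p) \<and> 0 \<in> fst p \<and> k \<in> snd p \<and> fst p \<times> snd p \<subseteq> {(h, x). h + x \<in> U}"
      if k: "k \<in> K" for k
    proof -
      have "(0, k) \<in> {(h, x). h + x \<in> U}" using k U(2) by auto
      from open_prod_elim[OF op this] obtain A B where "open A" "open B" "(0, k) \<in> A \<times> B"
        "A \<times> B \<subseteq> {(h, x). h + x \<in> U}" by blast
      then show ?thesis by (intro exI[of _ "(A, B)"]) auto
    qed
    then obtain p where p: "\<And>k. k \<in> K \<Longrightarrow> open (fst (p k)) \<and> open (snd (p k)) \<and> 0 \<in> fst (p k) \<and>
        k \<in> snd (p k) \<and> fst (p k) \<times> snd (p k) \<subseteq> {(h, x). h + x \<in> U}"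
      using bchoice[of K "\<lambda>k p. open (fst p) \<and> open (snd p) \<and> 0 \<in> fst p \<and> k \<in> snd p \<and>
        fst p \<times> snd p \<subseteq> {(h, x). h + x \<in> U}"] by blast
    define A where "A k = fst (p k)" for k
    define B where "B k = snd (p k)" for k
    have AB: "open (A k)" "open (B k)" "0 \<in> A k" "k \<in> B k" "A k \<times> B k \<subseteq> {(h, x). h + x \<in> U}" if "k \<in> K" for k
      using p[OF that] by (auto simp: A_def B_def)
    obtain D where D: "D \<subseteq> K" "finite D" "K \<subseteq> (\<Union>k\<in>D. B k)"
    proof (rule compactE_image[OF K, of K B])
      show "K \<subseteq> (\<Union>k\<in>K. B k)" using AB(4) by auto
    qed (use AB(2) in auto)
    have "h + x \<in> U" if hx: "h \<in> (\<Inter>k\<in>D. A k)" "x \<in> K" for h x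
    proof -
      obtain k where k: "k \<in> D" "x \<in> B k" using D(3) hx(2) by auto
      then have "(h, x) \<in> A k \<times> B k" using hx(1) by auto
      then show ?thesis using AB(5)[of k] D(1) k(1) by auto
    qed
    then have "(\<Inter>k\<in>D. A k) \<times> K \<subseteq> {(h, x). h + x \<in> U}" by auto
    moreover have "open (\<Inter>k\<in>D. A k)" using D AB(1) by (intro open_INT) auto
    moreover have "0 \<in> (\<Inter>k\<in>D. A k)" using D(1) AB(3) by auto
    ultimately show ?thesis by (intro exI[of _ "\<Inter>k\<in>D. A k"] conjI)
  qed
  then obtain A where A: "0 \<in> A" "open A" "A \<times> K \<subseteq> {(h, x). h + x \<in> U}" by (elim exE conjE)
  have "measure L ((\<lambda>x. h + x) ` K - K) < e" if "h \<in> A" for h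
  proof -
    have "(\<lambda>x. h + x) ` K - K \<subseteq> U - K" using that A(3) by auto
    moreover have "U - K \<in> fmeasurable L"
    proof (rule fmeasurableI)
      show "U - K \<in> sets L" using U(1) borel_compact[OF K] by auto
      show "emeasure L (U - K) < \<infinity>"
        using emeasure_mono[of "U - K" U L] U(1,3) by (auto intro: le_less_trans)
    qed
    moreover have "(\<lambda>x. h + x) ` K - K \<in> sets L"
      using borel_compact[OF K] borel_compact[OF compact_translate[OF K]] by auto
    ultimately have "measure L ((\<lambda>x. h + x) ` K - K) \<le> measure L (U - K)" by (intro measure_mono_fmeasurable)
    then show ?thesis using U(4) by linarith
  qed
  then show ?thesis using A(1,2) by (intro exI[of _ A] conjI ballI)
qed

end

section \<open>Eigenfunctions from extreme points\<close>

text \<open>Tychonoff's theorem for a product of closed discs; the function type carries the product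
  topology.\<close>

lemma compact_bounded_functions:
  fixes N :: "'j \<Rightarrow> real"
  shows "compact {F :: 'j \<Rightarrow> complex. \<forall>j. cmod (F j) \<le> N j}"
proof -
  have "compactin (product_topology (\<lambda>_::'j. euclidean :: complex topology) UNIV) (\<Pi>\<^sub>E j\<in>UNIV. cball 0 (N j))"
    by (simp add: compactin_PiE)
  moreover have "(\<Pi>\<^sub>E j\<in>UNIV. cball 0 (N j)) = {F :: 'j \<Rightarrow> complex. \<forall>j. cmod (F j) \<le> N j}"
    by (auto simp: PiE_def Pi_def)
  ultimately show ?thesis by (simp add: euclidean_product_topology)
qed

text \<open>An extremal subset in the sense of Krein and Milman, with convex combinations spelled
  out coordinatewise.\<close>

definition face_of_functions :: "('j \<Rightarrow> complex) set \<Rightarrow> ('j \<Rightarrow> complex) set \<Rightarrow> bool" where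
  "face_of_functions P F \<longleftrightarrow> F \<subseteq> P \<and> (\<forall>a\<in>P. \<forall>b\<in>P. \<forall>t::real. 0 < t \<longrightarrow> t < 1 \<longrightarrow>
      (\<lambda>j. of_real t * a j + of_real (1 - t) * b j) \<in> F \<longrightarrow> a \<in> F \<and> b \<in> F)"

text \<open>A weighted mean of two values can reach the maximum only if both values do, so the
  maximisers of an affine functional on a face form a face again; compactness makes them
  exist.\<close>

lemma face_of_functions_argmax:
  fixes P F :: "('j \<Rightarrow> complex) set" and \<Lambda> :: "('j \<Rightarrow> complex) \<Rightarrow> real"
  assumes P: "compact P" and F: "closed F" "F \<noteq> {}" "face_of_functions P F"
    and cont: "continuous_on UNIV \<Lambda>"
    and aff: "\<And>a b t. 0 < t \<Longrightarrow> t < 1 \<Longrightarrow>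
      \<Lambda> (\<lambda>j. of_real t * a j + of_real (1 - t) * b j) = t * \<Lambda> a + (1 - t) * \<Lambda> b"
  defines "F' \<equiv> {x\<in>F. \<forall>y\<in>F. \<Lambda> y \<le> \<Lambda> x}"
  shows "closed F'" "F' \<noteq> {}" "face_of_functions P F'"
proof -
  have "P \<inter> F = F" using F(3) by (auto simp: face_of_functions_def)
  then have "compact F" using compact_Int_closed[OF P F(1)] by simp
  then obtain x where x: "x \<in> F" "\<forall>y\<in>F. \<Lambda> y \<le> \<Lambda> x"
    using continuous_attains_sup[of F \<Lambda>] F(2) cont continuous_on_subset by blast
  then show "F' \<noteq> {}" by (auto simp: F'_def)
  have eq: "F' = F \<inter> {y. \<Lambda> x \<le> \<Lambda> y}" using x by (auto simp: F'_def intro: order_trans)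
  show "closed F'" unfolding eq
    using F(1) cont by (intro closed_Int closed_Collect_le continuous_intros) auto
  show "face_of_functions P F'"
    unfolding face_of_functions_def
  proof (intro conjI ballI allI impI)
    show "F' \<subseteq> P" using F(3) by (auto simp: F'_def face_of_functions_def)
    fix a b :: "'j \<Rightarrow> complex" and t :: real
    assume ab: "a \<in> P" "b \<in> P" and t: "0 < t" "t < 1"
      and m: "(\<lambda>j. of_real t * a j + of_real (1 - t) * b j) \<in> F'"
    have abF: "a \<in> F" "b \<in> F"
      using m ab t F(3) unfolding face_of_functions_def F'_def by blast+
    have le: "\<Lambda> a \<le> \<Lambda> x" "\<Lambda> b \<le> \<Lambda> x" using abF x by auto
    have "\<Lambda> x \<le> t * \<Lambda> a + (1 - t) * \<Lambda> b" using m eq aff[OF t, of a b] by auto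
    moreover have "t * \<Lambda> a \<le> t * \<Lambda> x" "(1 - t) * \<Lambda> b \<le> (1 - t) * \<Lambda> x"
      using le t by (auto intro: mult_left_mono)
    moreover have "t * \<Lambda> x + (1 - t) * \<Lambda> x = \<Lambda> x" by (simp add: algebra_simps)
    ultimately have "t * \<Lambda> x \<le> t * \<Lambda> a" "(1 - t) * \<Lambda> x \<le> (1 - t) * \<Lambda> b" by linarith+
    then have "\<Lambda> x \<le> \<Lambda> a" "\<Lambda> x \<le> \<Lambda> b" using t by auto
    then show "a \<in> F'" "b \<in> F'" using abF eq by auto
  qed
qed

text \<open>Zorn's lemma for reverse inclusion. The intersection of a chain of closed faces is
  nonempty by the finite intersection property in \<open>P\<close>, because a finite subset of a
  chain has a least member.\<close>

lemma minimal_face_exists: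
  fixes P F1 :: "('j \<Rightarrow> complex) set"
  assumes P: "compact P" and F1: "closed F1" "F1 \<noteq> {}" "face_of_functions P F1"
  shows "\<exists>F. closed F \<and> F \<noteq> {} \<and> face_of_functions P F \<and> F \<subseteq> F1 \<and>
    (\<forall>F'. closed F' \<longrightarrow> F' \<noteq> {} \<longrightarrow> face_of_functions P F' \<longrightarrow> F' \<subseteq> F \<longrightarrow> F' = F)"
proof -
  let ?A = "{F. closed F \<and> F \<noteq> {} \<and> face_of_functions P F \<and> F \<subseteq> F1}"
  have "\<exists>m\<in>?A. \<forall>a\<in>?A. m \<supseteq> a \<longrightarrow> a = m"
  proof (rule predicate_Zorn)
    show "partial_order_on ?A (relation_of (\<supseteq>) ?A)"
      by (auto simp: partial_order_on_def preorder_on_def refl_on_def trans_def antisym_def relation_of_def)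
    fix C assume C: "C \<in> Chains (relation_of (\<supseteq>) ?A)"
    have CA: "C \<subseteq> ?A" using C by (auto simp: Chains_def relation_of_def)
    have lin: "a \<subseteq> b \<or> b \<subseteq> a" if "a \<in> C" "b \<in> C" for a b
      using C that by (auto simp: Chains_def relation_of_def)
    show "\<exists>u\<in>?A. \<forall>a\<in>C. a \<supseteq> u"
    proof (cases "C = {}")
      case True then show ?thesis using F1 by auto
    next
      case False
      have fin: "\<exists>c\<in>D. \<forall>d\<in>D. c \<subseteq> d" if "finite D" "D \<noteq> {}" "D \<subseteq> C" for D
        using that
      proof (induction D rule: finite_ne_induct)
        case (insert x D)
        then obtain c where c: "c \<in> D" "\<forall>d\<in>D. c \<subseteq> d" by auto
        have "c \<subseteq> x \<or> x \<subseteq> c" using lin[of c x] c insert.prems by auto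
        then show ?case using c by (metis insert_iff order_trans order_refl)
      qed simp
      have sub: "\<Inter>C \<subseteq> F1" using False CA by blast
      have subP: "F1 \<subseteq> P" using F1 by (simp add: face_of_functions_def)
      have "P \<inter> \<Inter>C \<noteq> {}"
      proof (rule compact_imp_fip[OF P])
        fix T assume "T \<in> C" then show "closed T" using CA by auto
      next
        fix D assume D: "finite D" "D \<subseteq> C"
        show "P \<inter> \<Inter>D \<noteq> {}"
        proof (cases "D = {}")
          case True then show ?thesis using F1 subP by auto
        next
          case ne: False
          then obtain c where c: "c \<in> D" "\<forall>d\<in>D. c \<subseteq> d" using fin[OF D(1) ne D(2)] by auto
          then have "c \<in> C" using D(2) by auto
          then have "c \<noteq> {}" "c \<subseteq> F1" using CA by auto
          moreover have "c \<subseteq> P \<inter> \<Inter>D" using c \<open>c \<subseteq> F1\<close> subP by auto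
          ultimately show ?thesis by (metis subset_empty)
        qed
      qed
      then have ne: "\<Inter>C \<noteq> {}" by auto
      have cl: "closed (\<Inter>C)" using CA by (intro closed_Inter) auto
      have "face_of_functions P (\<Inter>C)"
        unfolding face_of_functions_def
      proof (intro conjI ballI allI impI)
        show "\<Inter>C \<subseteq> P" using sub subP by auto
        fix a b :: "'j \<Rightarrow> complex" and t :: real
        assume "a \<in> P" "b \<in> P" "0 < t" "t < 1"
          and m: "(\<lambda>j. of_real t * a j + of_real (1 - t) * b j) \<in> \<Inter>C"
        then have "a \<in> c \<and> b \<in> c" if "c \<in> C" for c
        proof -
          have "face_of_functions P c" using CA that by auto
          moreover have "(\<lambda>j. of_real t * a j + of_real (1 - t) * b j) \<in> c" using m that by (rule InterD)
          ultimately show ?thesis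
            using \<open>a \<in> P\<close> \<open>b \<in> P\<close> \<open>0 < t\<close> \<open>t < 1\<close> unfolding face_of_functions_def by blast
        qed
        then show "a \<in> \<Inter>C" "b \<in> \<Inter>C" by auto
      qed
      then have "\<Inter>C \<in> ?A" using ne cl sub by simp
      then show ?thesis by (intro bexI[of _ "\<Inter>C"]) auto
    qed
  qed
  then obtain F where F: "F \<in> ?A" "\<forall>a\<in>?A. F \<supseteq> a \<longrightarrow> a = F" by (rule bexE)
  show ?thesis
  proof (intro exI[of _ F] conjI allI impI)
    fix F' assume "closed F'" "F' \<noteq> {}" "face_of_functions P F'" "F' \<subseteq> F"
    then show "F' = F" using F by auto
  qed (use F in auto)
qed

text \<open>A minimal face inside the set of maximisers is a single point: real and imaginary parts
  of every coordinate are continuous and affine, and the maximisers of such a functional on the face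
  would otherwise form a smaller one.\<close>

lemma extreme_point_maximizer:
  fixes P :: "('j \<Rightarrow> complex) set" and \<Lambda> :: "('j \<Rightarrow> complex) \<Rightarrow> real"
  assumes P: "compact P" "closed P" "P \<noteq> {}" and cont: "continuous_on UNIV \<Lambda>"
    and aff: "\<And>a b t. 0 < t \<Longrightarrow> t < 1 \<Longrightarrow>
      \<Lambda> (\<lambda>j. of_real t * a j + of_real (1 - t) * b j) = t * \<Lambda> a + (1 - t) * \<Lambda> b"
  shows "\<exists>x\<in>P. (\<forall>y\<in>P. \<Lambda> y \<le> \<Lambda> x) \<and> (\<forall>a\<in>P. \<forall>b\<in>P. \<forall>t::real. 0 < t \<longrightarrow> t < 1 \<longrightarrow>
    x = (\<lambda>j. of_real t * a j + of_real (1 - t) * b j) \<longrightarrow> a = x \<and> b = x)"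
proof -
  have fP: "face_of_functions P P" by (auto simp: face_of_functions_def)
  let ?F1 = "{x\<in>P. \<forall>y\<in>P. \<Lambda> y \<le> \<Lambda> x}"
  have F1: "closed ?F1" "?F1 \<noteq> {}" "face_of_functions P ?F1"
    by (rule face_of_functions_argmax[OF P(1) P(2,3) fP cont], rule aff, assumption+)+
  obtain F where F: "closed F" "F \<noteq> {}" "face_of_functions P F" "F \<subseteq> ?F1"
    and min0: "\<forall>F'. closed F' \<longrightarrow> F' \<noteq> {} \<longrightarrow> face_of_functions P F' \<longrightarrow> F' \<subseteq> F \<longrightarrow> F' = F"
    using minimal_face_exists[OF P(1) F1] by (elim exE conjE) rule
  have min: "F' = F" if "closed F'" "F' \<noteq> {}" "face_of_functions P F'" "F' \<subseteq> F" for F'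
    using min0 that by simp
  have const: "\<Lambda>' x = \<Lambda>' y" if "x \<in> F" "y \<in> F" "continuous_on UNIV \<Lambda>'"
    and "\<And>a b t. 0 < t \<Longrightarrow> t < 1 \<Longrightarrow>
      \<Lambda>' (\<lambda>j. of_real t * a j + of_real (1 - t) * b j) = t * \<Lambda>' a + (1 - t) * \<Lambda>' b"
    for \<Lambda>' :: "('j \<Rightarrow> complex) \<Rightarrow> real" and x y
  proof -
    let ?F' = "{x\<in>F. \<forall>y\<in>F. \<Lambda>' y \<le> \<Lambda>' x}"
    have F': "closed ?F'" "?F' \<noteq> {}" "face_of_functions P ?F'"
      by (rule face_of_functions_argmax[OF P(1) F(1-3) that(3)], rule that(4), assumption+)+
    have "?F' = F" by (rule min[OF F']) auto
    then have "\<forall>x\<in>F. \<forall>y\<in>F. \<Lambda>' y \<le> \<Lambda>' x" by blast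
    then show ?thesis using that(1,2) by (meson order_antisym)
  qed
  have single: "x = y" if "x \<in> F" "y \<in> F" for x y
  proof
    fix j
    have cj: "continuous_on UNIV (\<lambda>x :: 'j \<Rightarrow> complex. x j)" by (rule continuous_on_product_coordinates)
    have "Re (x j) = Re (y j)"
      by (rule const[OF that]) (auto intro!: continuous_on_Re cj)
    moreover have "Im (x j) = Im (y j)"
      by (rule const[OF that]) (auto intro!: continuous_on_Im cj)
    ultimately show "x j = y j" by (rule complex_eqI)
  qed
  obtain x where x: "x \<in> F" using F(2) by auto
  show ?thesis
  proof (intro bexI[of _ x] conjI ballI allI impI)
    show "x \<in> P" using x F(4) by auto
    fix y assume "y \<in> P" then show "\<Lambda> y \<le> \<Lambda> x" using x F(4) by auto
  next
    fix a b :: "'j \<Rightarrow> complex" and t :: real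
    assume ab: "a \<in> P" "b \<in> P" and t: "0 < t" "t < 1"
      and eq: "x = (\<lambda>j. of_real t * a j + of_real (1 - t) * b j)"
    then have "a \<in> F \<and> b \<in> F" using F(3) x unfolding face_of_functions_def eq by blast
    then show "a = x" "b = x" using single x by auto
  qed
qed

section \<open>Twists, dominated functionals and their extreme points\<close>

text \<open>If \<open>F\<close> lists the numbers <U_h x, x> for a unitary action U, this is the
  list for the vector x + l U_h x in place of x, where \<open>q = (l, h)\<close> and l has modulus
  one. The map \<open>t\<close> is the action of the group on indices.\<close>

definition twist :: "('g::ab_group_add \<Rightarrow> 'j \<Rightarrow> 'j) \<Rightarrow> complex \<times> 'g \<Rightarrow> ('j \<Rightarrow> complex) \<Rightarrow> 'j \<Rightarrow> complex" where
  "twist t q F = (\<lambda>j. 2 * F j + fst q * F (t (snd q) j) + cnj (fst q) * F (t (- snd q) j))"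

text \<open>A substitute for positive definiteness. Quantifying over all finite sequences of twists
  makes the property hereditary by construction. The coordinate \<open>j0\<close> plays the role of
  the squared norm, and \<open>N j\<close> is the constant in a Cauchy-Schwarz bound for coordinate
  \<open>j\<close>.\<close>

definition dominated :: "('g::ab_group_add \<Rightarrow> 'j \<Rightarrow> 'j) \<Rightarrow> ('j \<Rightarrow> real) \<Rightarrow> 'j \<Rightarrow> ('j \<Rightarrow> complex) \<Rightarrow> bool" where
  "dominated t N j0 F \<longleftrightarrow> (\<forall>qs. (\<forall>q\<in>set qs. cmod (fst q) = 1) \<longrightarrow>
     (\<forall>j. cmod (fold (twist t) qs F j) \<le> N j * Re (fold (twist t) qs F j0)))"

lemma fold_twist_scale:
  "fold (twist t) qs (\<lambda>j. c * F j) = (\<lambda>j. c * fold (twist t) qs F j)"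
proof (induction qs arbitrary: F)
  case (Cons q qs)
  have "twist t q (\<lambda>j. c * F j) = (\<lambda>j. c * twist t q F j)"
    by (auto simp: twist_def algebra_simps)
  then show ?case by (simp add: Cons)
qed simp

lemma dominated_twist:
  assumes "dominated t N j0 F" "cmod (fst q) = 1"
  shows "dominated t N j0 (twist t q F)"
  unfolding dominated_def
proof (intro allI impI)
  fix qs :: "(complex \<times> 'a) list" and j assume "\<forall>q\<in>set qs. cmod (fst q) = 1"
  then show "cmod (fold (twist t) qs (twist t q F) j) \<le> N j * Re (fold (twist t) qs (twist t q F) j0)"
    using assms(1)[unfolded dominated_def, rule_format, of "q # qs" j] assms(2) by auto
qed

lemma dominated_scale:
  assumes "dominated t N j0 F" "c \<ge> (0::real)"
  shows "dominated t N j0 (\<lambda>j. of_real c * F j)"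
  unfolding dominated_def fold_twist_scale
proof (intro allI impI)
  fix qs :: "(complex \<times> 'a) list" and j assume "\<forall>q\<in>set qs. cmod (fst q) = 1"
  then have "cmod (fold (twist t) qs F j) \<le> N j * Re (fold (twist t) qs F j0)"
    using assms(1) unfolding dominated_def by blast
  then have "c * cmod (fold (twist t) qs F j) \<le> c * (N j * Re (fold (twist t) qs F j0))"
    using assms(2) by (rule mult_left_mono)
  then show "cmod (of_real c * fold (twist t) qs F j) \<le> N j * Re (of_real c * fold (twist t) qs F j0)"
    using assms(2) by (simp add: norm_mult algebra_simps)
qed

lemma continuous_fold_twist: "continuous_on UNIV (\<lambda>F. fold (twist t) qs F j)"
proof -
  have tw: "continuous_on UNIV (twist t q)" for q
    unfolding twist_def
    by (intro continuous_on_coordinatewise_then_product continuous_intros continuous_on_product_coordinates)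
  have "continuous_on UNIV (fold (twist t) qs)"
  proof (induction qs)
    case (Cons q qs)
    have "continuous_on UNIV (fold (twist t) qs \<circ> twist t q)"
      by (rule continuous_on_compose[OF tw]) (rule continuous_on_subset[OF Cons], simp)
    then show ?case by (simp add: o_def)
  qed (simp add: id_def)
  then show ?thesis by (rule continuous_on_product_then_coordinatewise)
qed

lemma closed_dominated: "closed {F. dominated t N j0 F}"
  unfolding dominated_def
  by (intro closed_Collect_all closed_Collect_imp open_Collect_const closed_Collect_le continuous_intros
        continuous_fold_twist)

text \<open>At an extreme point \<open>F\<close>, the splitting
  \<open>4 F = (2 F + \<lambda> F(t h) + cnj \<lambda> F(t (- h))) + (2 F - \<lambda> F(t h) - cnj \<lambda> F(t (- h)))\<close>
  into dominated functions is trivial; taking \<open>\<lambda> = 1\<close> and \<open>\<lambda> = \<i>\<close> shows that \<open>F\<close> is an eigenfunction.\<close>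
lemma dominated_eigenfunction_exists:
  fixes t :: "'g::ab_group_add \<Rightarrow> 'j \<Rightarrow> 'j" and \<Lambda> :: "('j \<Rightarrow> complex) \<Rightarrow> real"
  assumes t0: "\<And>j. t 0 j = j" and tadd: "\<And>g h j. t (g + h) j = t g (t h j)"
    and N: "\<And>h. N (t h j0) = 1"
    and cl: "closed C" and tw: "\<And>F q. F \<in> C \<Longrightarrow> cmod (fst q) = 1 \<Longrightarrow> twist t q F \<in> C"
    and sc: "\<And>F c. F \<in> C \<Longrightarrow> (\<lambda>j. of_real c * F j) \<in> C"
    and F0: "F0 \<in> C" "dominated t N j0 F0" "F0 j0 = 1"
    and cont: "continuous_on UNIV \<Lambda>"
    and aff: "\<And>a b t. 0 < t \<Longrightarrow> t < 1 \<Longrightarrow>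
      \<Lambda> (\<lambda>j. of_real t * a j + of_real (1 - t) * b j) = t * \<Lambda> a + (1 - t) * \<Lambda> b"
  shows "\<exists>F ch. F \<in> C \<and> (\<forall>j. cmod (F j) \<le> N j) \<and> \<Lambda> F0 \<le> \<Lambda> F \<and> (\<forall>h j. F (t h j) = ch h * F j) \<and>
     (\<forall>g h. ch (g + h) = ch g * ch h) \<and> (\<forall>h. cmod (ch h) = 1)"
proof -
  \<comment> \<open>Normalising \<open>F j0 = 1\<close> turns domination into the bounds
    \<open>cmod (F j) \<le> N j\<close>, which place \<open>P\<close> in a product of discs.\<close>
  define P where "P = C \<inter> {F. dominated t N j0 F} \<inter> {F. F j0 = 1}"
  have dom0: "cmod (F j) \<le> N j * Re (F j0)" if "dominated t N j0 F" for F j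
    using that[unfolded dominated_def, rule_format, of "[]" j] by simp
  have bnd: "cmod (F j) \<le> N j" if "F \<in> P" for F j
    using dom0[of F j] that by (auto simp: P_def)
  have clP: "closed P"
    unfolding P_def
    by (intro closed_Int cl closed_dominated closed_Collect_eq continuous_on_product_coordinates continuous_intros)
  have "{F. \<forall>j. cmod (F j) \<le> N j} \<inter> P = P" using bnd by auto
  then have cP: "compact P" using compact_Int_closed[OF compact_bounded_functions[of N] clP] by simp
  have F0P: "F0 \<in> P" using F0 by (auto simp: P_def)
  obtain F where F: "F \<in> P" and max: "\<forall>y\<in>P. \<Lambda> y \<le> \<Lambda> F"
    and ext: "\<forall>a\<in>P. \<forall>b\<in>P. \<forall>s::real. 0 < s \<longrightarrow> s < 1 \<longrightarrow>
      F = (\<lambda>j. of_real s * a j + of_real (1 - s) * b j) \<longrightarrow> a = F \<and> b = F"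
  proof -
    have "P \<noteq> {}" using F0P by auto
    then have "\<exists>x\<in>P. (\<forall>y\<in>P. \<Lambda> y \<le> \<Lambda> x) \<and> (\<forall>a\<in>P. \<forall>b\<in>P. \<forall>t::real. 0 < t \<longrightarrow> t < 1 \<longrightarrow>
      x = (\<lambda>j. of_real t * a j + of_real (1 - t) * b j) \<longrightarrow> a = x \<and> b = x)"
      by (rule extreme_point_maximizer[OF cP clP _ cont aff])
    then show thesis using that by (elim bexE conjE) rule
  qed
  have FC: "F \<in> C" "dominated t N j0 F" "F j0 = 1" using F by (auto simp: P_def)
  have nz: "F' = (\<lambda>j. 0)" if "dominated t N j0 F'" "F' j0 = 0" for F'
    using dom0[OF that(1)] that(2) by auto
  \<comment> \<open>Domination at \<open>j0\<close>, where \<open>N\<close> equals 1, says that the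
    modulus is at most the real part, so the value is a nonnegative real.\<close>
  have real: "F' j0 = of_real (Re (F' j0))" "Re (F' j0) \<ge> 0" if "dominated t N j0 F'" for F'
  proof -
    have "cmod (F' j0) \<le> Re (F' j0)" using dom0[OF that, of j0] N[of 0] t0[of j0] by simp
    moreover have "Re (F' j0) \<le> cmod (F' j0)" by (rule complex_Re_le_cmod)
    ultimately have *: "cmod (F' j0) = Re (F' j0)" by simp
    then show "Re (F' j0) \<ge> 0" using norm_ge_zero[of "F' j0"] by linarith
    have "(Im (F' j0))\<^sup>2 = 0" using * cmod_power2[of "F' j0"] by simp
    then show "F' j0 = of_real (Re (F' j0))" by (simp add: complex_eq_iff)
  qed
  have key: "\<exists>c. \<forall>j. l * F (t h j) + cnj l * F (t (- h) j) = c * F j" if l: "cmod l = 1" for l h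
  proof -
    \<comment> \<open>The factor 1/4 makes \<open>A + B = F\<close>: the terms with \<open>l\<close>
      and \<open>- l\<close> cancel and 2 \<open>F\<close> is counted twice.\<close>
    define A where "A = (\<lambda>j. of_real (1/4) * twist t (l, h) F j)"
    define B where "B = (\<lambda>j. of_real (1/4) * twist t (- l, h) F j)"
    have AB: "F j = A j + B j" for j by (simp add: A_def B_def twist_def algebra_simps)
    have AC: "A \<in> C" "B \<in> C" "dominated t N j0 A" "dominated t N j0 B"
    proof -
      have l': "cmod (fst (l, h)) = 1" "cmod (fst (- l, h)) = 1" using l by simp_all
      show "A \<in> C" "B \<in> C" unfolding A_def B_def by (intro sc tw FC(1) l')+
      show "dominated t N j0 A" "dominated t N j0 B"
        unfolding A_def B_def by (intro dominated_scale dominated_twist FC(2) l', simp)+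
    qed
    define s where "s = Re (A j0)"
    have As: "A j0 = of_real s" "s \<ge> 0" using real[OF AC(3)] by (auto simp: s_def)
    have Bs: "B j0 = of_real (1 - s)" "1 - s \<ge> 0"
    proof -
      have "B j0 = 1 - A j0" using AB[of j0] FC(3) by (simp add: algebra_simps)
      then show 1: "B j0 = of_real (1 - s)" using As by simp
      then show "1 - s \<ge> 0" using real(2)[OF AC(4)] by simp
    qed
    \<comment> \<open>The weights are the values at \<open>j0\<close>. If one weight vanishes,
      domination kills the corresponding part altogether; otherwise both parts, rescaled to value 1
      at \<open>j0\<close>, lie in \<open>P\<close> and extremality applies.\<close>
    have "\<exists>c. \<forall>j. A j = c * F j"
    proof (cases "s = 0 \<or> s = 1")
      case True
      then show ?thesis
      proof
        assume "s = 0"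
        then show ?thesis using nz[OF AC(3)] As by auto
      next
        assume "s = 1"
        then have "B = (\<lambda>j. 0)" using nz[OF AC(4)] Bs by auto
        then show ?thesis using AB by (intro exI[of _ 1]) auto
      qed
    next
      case False
      then have s: "0 < s" "s < 1" using As Bs by auto
      define a where "a = (\<lambda>j. of_real (1/s) * A j)"
      define b where "b = (\<lambda>j. of_real (1/(1-s)) * B j)"
      have "a \<in> C" "b \<in> C" unfolding a_def b_def by (intro sc AC)+
      moreover have "dominated t N j0 a" "dominated t N j0 b"
        unfolding a_def b_def using s by (intro dominated_scale AC; simp)+
      moreover have "a j0 = 1" "b j0 = 1"
        using s As Bs by (auto simp: a_def b_def simp flip: of_real_mult of_real_diff)
      ultimately have "a \<in> P" "b \<in> P" by (auto simp: P_def)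
      moreover have "F = (\<lambda>j. of_real s * a j + of_real (1 - s) * b j)"
        using s AB by (auto simp: a_def b_def field_simps simp flip: of_real_mult of_real_diff)
      ultimately have "a = F" using ext s by blast
      then have "A j = of_real s * F j" for j using s by (auto simp: a_def)
      then show ?thesis by blast
    qed
    then obtain c where "\<And>j. A j = c * F j" by auto
    then have "l * F (t h j) + cnj l * F (t (- h) j) = (4 * c - 2) * F j" for j
      by (auto simp: A_def twist_def field_simps)
    then show ?thesis by blast
  qed
  \<comment> \<open>At \<open>j0\<close> the function \<open>F\<close> is 1, so the eigenvalue for
    \<open>h\<close> can be read off there.\<close>
  define ch where "ch h = F (t h j0)" for h
  have eig: "F (t h j) = ch h * F j" for h j
  proof -
    obtain c where c: "\<And>j. F (t h j) + F (t (- h) j) = c * F j" using key[of 1 h] by auto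
    obtain d where d: "\<And>j. \<i> * F (t h j) - \<i> * F (t (- h) j) = d * F j" using key[of \<i> h] by auto
    have "F (t h j) - F (t (- h) j) = - \<i> * d * F j" for j
      using arg_cong[OF d[of j], of "\<lambda>z. - \<i> * z"] by (simp add: algebra_simps)
    then have "2 * F (t h j) = (c - \<i> * d) * F j" for j
      using c[of j] by (simp add: algebra_simps) (metis add_diff_cancel_left' add.assoc diff_add_cancel mult_2)
    then have e: "F (t h j) = (c - \<i> * d) / 2 * F j" for j
      by (simp add: field_simps)
    have "F (t h j0) = (c - \<i> * d) / 2" using e[of j0] by (simp only: FC(3) mult_1_right)
    then show ?thesis by (simp only: ch_def e[of j])
  qed
  have hom: "ch (g + h) = ch g * ch h" for g h
    using eig[of g "t h j0"] by (simp add: ch_def tadd)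
  have le: "cmod (ch h) \<le> 1" for h using bnd[OF F, of "t h j0"] N by (simp add: ch_def)
  have "cmod (ch h) = 1" for h
  proof -
    have "ch h * ch (- h) = 1" using hom[of h "- h"] t0 FC(3) by (simp add: ch_def)
    then have "cmod (ch h) * cmod (ch (- h)) = 1" by (metis norm_mult norm_one)
    moreover have "cmod (ch h) * cmod (ch (- h)) \<le> cmod (ch h) * 1"
      using le[of "- h"] by (intro mult_left_mono) auto
    ultimately show ?thesis using le[of h] by linarith
  qed
  then show ?thesis using FC bnd[OF F] max F0P eig hom
    by (intro exI[of _ F] exI[of _ ch]) auto
qed

section \<open>Densities of additive set functions\<close>

lemma norm_integral_le_AE:
  fixes f :: "'a \<Rightarrow> 'b::{banach, second_countable_topology}"
  assumes "integrable M f" "integrable M g" "AE x in M. norm (f x) \<le> g x"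
  shows "norm (\<integral>x. f x \<partial>M) \<le> (\<integral>x. g x \<partial>M)"
proof -
  have "norm (\<integral>x. f x \<partial>M) \<le> (\<integral>x. norm (f x) \<partial>M)" by (rule integral_norm_bound)
  also have "\<dots> \<le> (\<integral>x. g x \<partial>M)" using assms by (intro integral_mono_AE) auto
  finally show ?thesis .
qed

text \<open>Domination by a multiple of the measure sends the value of the tails to zero, which
  upgrades finite additivity to countable additivity on sets of finite measure.\<close>

lemma additive_bounded_sums:
  fixes v :: "'a set \<Rightarrow> real"
  assumes add: "\<And>A B. A \<in> fmeasurable M \<Longrightarrow> B \<in> fmeasurable M \<Longrightarrow> A \<inter> B = {} \<Longrightarrow> v (A \<union> B) = v A + v B"
    and nn: "\<And>A. A \<in> fmeasurable M \<Longrightarrow> 0 \<le> v A"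
    and le: "\<And>A. A \<in> fmeasurable M \<Longrightarrow> v A \<le> C * measure M A"
    and A: "range A \<subseteq> sets M" "disjoint_family A" "(\<Union>i. A i) \<in> fmeasurable M"
  shows "(\<lambda>i. v (A i)) sums v (\<Union>i. A i)"
proof -
  let ?U = "\<Union>i. A i"
  have Af: "A i \<in> fmeasurable M" for i
    by (rule fmeasurableI2[OF A(3)]) (use A(1) in auto)
  have Uf: "(\<Union>i<n. A i) \<in> fmeasurable M" for n
    by (rule fmeasurableI2[OF A(3)]) (use A(1) in auto)
  have v0: "v {} = 0" using add[of "{}" "{}"] by simp
  have part: "v (\<Union>i<n. A i) = (\<Sum>i<n. v (A i))" for n
  proof (induction n)
    case (Suc n)
    have "(\<Union>i<Suc n. A i) = (\<Union>i<n. A i) \<union> A n" by (auto simp: lessThan_Suc)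
    moreover have "A i \<inter> A n = {}" if "i < n" for i
      using that by (intro disjoint_family_onD[OF A(2)]) auto
    then have "(\<Union>i<n. A i) \<inter> A n = {}" by blast
    ultimately show ?case using add[OF Uf[of n] Af[of n]] Suc by simp
  qed (simp add: v0)
  have rest: "?U - (\<Union>i<n. A i) \<in> fmeasurable M" for n
    by (rule fmeasurableI2[OF A(3)]) (use A(1) in auto)
  have split: "v ?U = (\<Sum>i<n. v (A i)) + v (?U - (\<Union>i<n. A i))" for n
  proof -
    have "?U = (\<Union>i<n. A i) \<union> (?U - (\<Union>i<n. A i))" by auto
    then show ?thesis using add[OF Uf[of n] rest[of n]] part[of n] by (metis Diff_disjoint)
  qed
  have meas_rest: "measure M (?U - (\<Union>i<n. A i)) = measure M ?U - (\<Sum>i<n. measure M (A i))" for n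
  proof -
    have "measure M (\<Union>i<n. A i) = (\<Sum>i<n. measure M (A i))"
      using A Af by (intro measure_UNION') (auto simp: pairwise_def disjnt_def disjoint_family_on_def)
    moreover have "measure M (?U - (\<Union>i<n. A i)) = measure M ?U - measure M (\<Union>i<n. A i)"
      using A(3) Uf[of n] by (intro measurable_measure_Diff) auto
    ultimately show ?thesis by simp
  qed
  have "emeasure M ?U \<noteq> \<infinity>" using A(3) by (auto simp: fmeasurable_def)
  then have ms: "(\<lambda>i. measure M (A i)) sums measure M ?U"
    using A by (intro measure_UNION) auto
  have "(\<lambda>n. C * (measure M ?U - (\<Sum>i<n. measure M (A i)))) \<longlonglongrightarrow> C * (measure M ?U - measure M ?U)"
    using ms unfolding sums_def by (intro tendsto_intros)
  then have lim: "(\<lambda>n. C * (measure M ?U - (\<Sum>i<n. measure M (A i)))) \<longlonglongrightarrow> 0" by simp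
  have "(\<lambda>n. v (?U - (\<Union>i<n. A i))) \<longlonglongrightarrow> 0"
    by (rule tendsto_sandwich[OF _ _ tendsto_const lim])
       (use nn[OF rest] le[OF rest] meas_rest in auto)
  then have "(\<lambda>n. v ?U - v (?U - (\<Union>i<n. A i))) \<longlonglongrightarrow> v ?U - 0"
    by (intro tendsto_intros)
  moreover have "v ?U - v (?U - (\<Union>i<n. A i)) = (\<Sum>i<n. v (A i))" for n using split[of n] by linarith
  ultimately show ?thesis unfolding sums_def by simp
qed

text \<open>Since \<open>v\<close> is meaningful only on sets of finite measure, it is cut along a
  partition into such sets; each restriction is a measure with a Radon-Nikodym density, and the
  densities are summed.\<close>

lemma (in sigma_finite_measure) additive_bounded_density_nonneg:
  fixes v :: "'a set \<Rightarrow> real"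
  assumes add: "\<And>A B. A \<in> fmeasurable M \<Longrightarrow> B \<in> fmeasurable M \<Longrightarrow> A \<inter> B = {} \<Longrightarrow> v (A \<union> B) = v A + v B"
    and nn: "\<And>A. A \<in> fmeasurable M \<Longrightarrow> 0 \<le> v A"
    and le: "\<And>A. A \<in> fmeasurable M \<Longrightarrow> v A \<le> C * measure M A"
    and C: "0 \<le> C"
  shows "\<exists>f\<in>borel_measurable M. (\<forall>x. 0 \<le> f x \<and> f x \<le> C) \<and>
    (\<forall>A\<in>fmeasurable M. (\<integral>x. indicator A x * f x \<partial>M) = v A)"
proof -
  note sums = additive_bounded_sums[of M v C, OF add nn le]
  have v0: "v {} = 0" using add[of "{}" "{}"] by simp
  obtain D :: "nat \<Rightarrow> 'a set" where D: "range D \<subseteq> sets M" "\<Union> (range D) = space M"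
    "\<And>i. emeasure M (D i) \<noteq> \<infinity>" "disjoint_family D"
    using sigma_finite_disjoint by metis
  have Df: "D n \<in> fmeasurable M" for n using D(1,3) by (auto simp: fmeasurable_def less_top)
  have ADf: "A \<inter> D n \<in> fmeasurable M" if "A \<in> sets M" for A n
    using fmeasurableI2[OF Df[of n], of "A \<inter> D n"] that D(1) by auto
  define V where "V n = measure_of (space M) (sets M) (\<lambda>A. ennreal (v (A \<inter> D n)))" for n
  have setsV[measurable_cong]: "sets (V n) = sets M" for n
    by (simp add: V_def)
  have V: "emeasure (V n) A = ennreal (v (A \<inter> D n))" if "A \<in> sets M" for A n
    unfolding V_def
  proof (rule emeasure_measure_of_sigma[OF _ _ _ that])
    show "sigma_algebra (space M) (sets M)" by (rule sets.sigma_algebra_axioms)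
    show "positive (sets M) (\<lambda>A. ennreal (v (A \<inter> D n)))" by (simp add: positive_def v0)
    show "countably_additive (sets M) (\<lambda>A. ennreal (v (A \<inter> D n)))"
    proof (rule countably_additiveI)
      fix A :: "nat \<Rightarrow> 'a set" assume A: "range A \<subseteq> sets M" "disjoint_family A" "\<Union>(range A) \<in> sets M"
      have eq: "(\<Union>i. A i \<inter> D n) = \<Union>(range A) \<inter> D n" by auto
      have "(\<lambda>i. v (A i \<inter> D n)) sums v (\<Union>i. A i \<inter> D n)"
      proof (rule sums)
        show "range (\<lambda>i. A i \<inter> D n) \<subseteq> sets M" using A(1) D(1) by auto
        show "disjoint_family (\<lambda>i. A i \<inter> D n)" using A(2) by (auto simp: disjoint_family_on_def)
        show "(\<Union>i. A i \<inter> D n) \<in> fmeasurable M" unfolding eq using A(3) by (rule ADf)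
      qed
      then show "(\<Sum>i. ennreal (v (A i \<inter> D n))) = ennreal (v (\<Union> (range A) \<inter> D n))"
        unfolding eq using A(1) by (intro suminf_ennreal_eq nn ADf) auto
    qed
  qed
  have "absolutely_continuous M (V n)" for n
    unfolding absolutely_continuous_def
  proof
    fix A assume A: "A \<in> null_sets M"
    then have As: "A \<in> sets M" by auto
    have "emeasure M (A \<inter> D n) \<le> emeasure M A" using A by (intro emeasure_mono) auto
    then have "measure M (A \<inter> D n) = 0" using A by (auto simp: measure_def null_sets_def)
    then have "v (A \<inter> D n) \<le> 0" using le[OF ADf[OF As], of n] by simp
    then show "A \<in> null_sets (V n)" using V[OF As] As setsV by (auto simp: null_sets_def ennreal_neg)
  qed
  then have "\<exists>f\<in>borel_measurable M. density M f = V n" for n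
    using Radon_Nikodym[of "V n"] setsV by metis
  then obtain f where f[measurable]: "\<And>n. f n \<in> borel_measurable M" and fV: "\<And>n. density M (f n) = V n"
    by metis
  define F where "F x = (\<Sum>n. f n x)" for x
  have [measurable]: "F \<in> borel_measurable M" unfolding F_def by measurable
  have F: "(\<integral>\<^sup>+x. F x * indicator A x \<partial>M) = ennreal (v A)" if A: "A \<in> fmeasurable M" for A
  proof -
    have As[measurable]: "A \<in> sets M" using A by auto
    have eq: "(\<Union>n. A \<inter> D n) = A" using D(2) sets.sets_into_space[OF As] by auto
    have "(\<integral>\<^sup>+x. F x * indicator A x \<partial>M) = (\<integral>\<^sup>+x. (\<Sum>n. f n x * indicator A x) \<partial>M)"
      by (simp add: F_def)
    also have "\<dots> = (\<Sum>n. \<integral>\<^sup>+x. f n x * indicator A x \<partial>M)"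
      by (rule nn_integral_suminf) auto
    also have "\<dots> = (\<Sum>n. emeasure (V n) A)"
      by (simp add: fV[symmetric] emeasure_density As)
    also have "\<dots> = (\<Sum>n. ennreal (v (A \<inter> D n)))" by (simp add: V[OF As])
    also have "\<dots> = ennreal (v (\<Union>n. A \<inter> D n))"
    proof (intro suminf_ennreal_eq nn ADf As sums)
      show "range (\<lambda>i. A \<inter> D i) \<subseteq> sets M" using As D(1) by auto
      show "disjoint_family (\<lambda>i. A \<inter> D i)" using D(4) by (auto simp: disjoint_family_on_def)
      show "(\<Union>i. A \<inter> D i) \<in> fmeasurable M" using A eq by simp
    qed
    finally show ?thesis by (simp only: eq)
  qed
  have "AE x in M. x \<in> D n \<longrightarrow> F x \<le> ennreal C" for n
  proof -
    \<comment> \<open>Over the set where \<open>F\<close> exceeds \<open>C\<close> inside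
      \<open>D n\<close> the integral of \<open>F\<close> is at most that of \<open>C\<close>, so
      the excess integrates to zero and the set is null.\<close>
    define B where "B = {x\<in>D n. F x > ennreal C}"
    have [measurable]: "D n \<in> sets M" using Df by auto
    have "B = {x\<in>space M. x \<in> D n \<and> F x > ennreal C}"
      using sets.sets_into_space[of "D n" M] by (auto simp: B_def)
    then have Bs[measurable]: "B \<in> sets M" by simp
    then have Bf: "B \<in> fmeasurable M" by (intro fmeasurableI2[OF Df[of n]]) (auto simp: B_def)
    have emB: "emeasure M B = ennreal (measure M B)"
      using Bf by (intro emeasure_eq_ennreal_measure) (auto simp: fmeasurable_def)
    have int: "(\<integral>\<^sup>+x. ennreal C * indicator B x \<partial>M) = ennreal (C * measure M B)"
      using C by (simp add: nn_integral_cmult emB ennreal_mult')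
    have "(\<integral>\<^sup>+x. F x * indicator B x - ennreal C * indicator B x \<partial>M) =
        (\<integral>\<^sup>+x. F x * indicator B x \<partial>M) - (\<integral>\<^sup>+x. ennreal C * indicator B x \<partial>M)"
    proof (rule nn_integral_diff)
      show "(\<integral>\<^sup>+x. ennreal C * indicator B x \<partial>M) \<noteq> \<infinity>" unfolding int by simp
    qed (auto simp: B_def indicator_def)
    also have "\<dots> = 0"
      unfolding int F[OF Bf] using le[OF Bf] by (simp add: ennreal_leI diff_eq_0_iff_ennreal)
    finally have "AE x in M. F x * indicator B x - ennreal C * indicator B x = 0"
      by (subst (asm) nn_integral_0_iff_AE) auto
    then have "AE x in M. x \<notin> B"
    proof (eventually_elim, intro notI)
      fix x assume *: "F x * indicator B x - ennreal C * indicator B x = 0" "x \<in> B"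
      then have "F x \<le> ennreal C"
        by (auto simp: diff_eq_0_iff_ennreal)
      then show False using *(2) by (auto simp: B_def)
    qed
    then show ?thesis by eventually_elim (auto simp: B_def not_less)
  qed
  then have "AE x in M. \<forall>n. x \<in> D n \<longrightarrow> F x \<le> ennreal C" unfolding AE_all_countable by blast
  then have FC: "AE x in M. F x \<le> ennreal C"
    using AE_space by eventually_elim (use D(2) in auto)
  \<comment> \<open>Truncation gives a real function bounded at every point and changes
    \<open>F\<close> only on a null set.\<close>
  define g where "g x = enn2real (min (F x) (ennreal C))" for x
  have [measurable]: "g \<in> borel_measurable M" unfolding g_def by measurable
  have ge: "ennreal (g x) = min (F x) (ennreal C)" for x
    unfolding g_def by (rule ennreal_enn2real) (simp add: min_less_iff_disj)
  have "0 \<le> g x \<and> g x \<le> C" for x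
  proof
    show "0 \<le> g x" by (simp add: g_def)
    show "g x \<le> C" using ge[of x] C by (metis ennreal_le_iff min.cobounded2)
  qed
  moreover have "(\<integral>x. indicator A x * g x \<partial>M) = v A" if A: "A \<in> fmeasurable M" for A
  proof -
    have [measurable]: "A \<in> sets M" using A by auto
    have "(\<integral>x. indicator A x * g x \<partial>M) = enn2real (\<integral>\<^sup>+x. ennreal (indicator A x * g x) \<partial>M)"
      by (rule integral_eq_nn_integral) (auto simp: g_def)
    also have "(\<integral>\<^sup>+x. ennreal (indicator A x * g x) \<partial>M) = (\<integral>\<^sup>+x. F x * indicator A x \<partial>M)"
    proof (rule nn_integral_cong_AE)
      show "AE x in M. ennreal (indicator A x * g x) = F x * indicator A x"
        using FC by eventually_elim (auto simp: indicator_def ge min_def)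
    qed
    finally show ?thesis using F[OF A] nn[OF A] by simp
  qed
  ultimately show ?thesis by (intro bexI[of _ g]) auto
qed

text \<open>Adding \<open>C\<close> times the measure makes the real and the imaginary part
  nonnegative, and \<open>C\<close> is subtracted again from the density. Each part is then bounded
  by \<open>C\<close>, whence \<open>2 * C\<close> for their sum.\<close>

lemma (in sigma_finite_measure) additive_bounded_density:
  fixes u :: "'a set \<Rightarrow> complex"
  assumes add: "\<And>A B. A \<in> fmeasurable M \<Longrightarrow> B \<in> fmeasurable M \<Longrightarrow> A \<inter> B = {} \<Longrightarrow> u (A \<union> B) = u A + u B"
    and le: "\<And>A. A \<in> fmeasurable M \<Longrightarrow> cmod (u A) \<le> C * measure M A"
    and C: "0 \<le> C"
  shows "\<exists>f\<in>borel_measurable M. (\<forall>x. cmod (f x) \<le> 2 * C) \<and>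
    (\<forall>A\<in>fmeasurable M. (\<integral>x. indicator A x * f x \<partial>M) = u A)"
proof -
  have part: "\<exists>f\<in>borel_measurable M. (\<forall>x. \<bar>f x\<bar> \<le> C) \<and> (\<forall>A\<in>fmeasurable M. (\<integral>x. indicator A x * f x \<partial>M) = w A)"
    if add: "\<And>A B. A \<in> fmeasurable M \<Longrightarrow> B \<in> fmeasurable M \<Longrightarrow> A \<inter> B = {} \<Longrightarrow> w (A \<union> B) = w A + w B"
    and le: "\<And>A. A \<in> fmeasurable M \<Longrightarrow> \<bar>w A\<bar> \<le> C * measure M A" for w :: "'a set \<Rightarrow> real"
  proof -
    have "\<exists>f\<in>borel_measurable M. (\<forall>x. 0 \<le> f x \<and> f x \<le> 2 * C) \<and>
      (\<forall>A\<in>fmeasurable M. (\<integral>x. indicator A x * f x \<partial>M) = C * measure M A + w A)"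
    proof (rule additive_bounded_density_nonneg)
      fix A B assume "A \<in> fmeasurable M" "B \<in> fmeasurable M" "A \<inter> B = {}"
      then show "C * measure M (A \<union> B) + w (A \<union> B) = C * measure M A + w A + (C * measure M B + w B)"
        using add[of A B] by (simp add: measure_Un3 algebra_simps)
    next
      fix A assume "A \<in> fmeasurable M"
      from le[OF this] show "0 \<le> C * measure M A + w A" "C * measure M A + w A \<le> 2 * C * measure M A"
        by linarith+
    qed (use C in simp)
    then obtain f where f[measurable]: "f \<in> borel_measurable M" and fb: "\<And>x. 0 \<le> f x" "\<And>x. f x \<le> 2 * C"
      and fA: "\<And>A. A \<in> fmeasurable M \<Longrightarrow> (\<integral>x. indicator A x * f x \<partial>M) = C * measure M A + w A"
      by blast
    have "(\<integral>x. indicator A x * (f x - C) \<partial>M) = w A" if A: "A \<in> fmeasurable M" for A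
    proof -
      have iA: "integrable M (indicator A :: 'a \<Rightarrow> real)" using A by (auto simp: fmeasurable_def)
      have [measurable]: "A \<in> sets M" using A by auto
      have "integrable M (\<lambda>x. (2 * C) * indicator A x)" using iA by (rule integrable_mult_right)
      then have i1: "integrable M (\<lambda>x. indicator A x * f x)"
        by (rule Bochner_Integration.integrable_bound) (use fb C in \<open>auto simp: indicator_def\<close>)
      have "(\<integral>x. indicator A x * (f x - C) \<partial>M) = (\<integral>x. indicator A x * f x - C * indicator A x \<partial>M)"
        by (simp add: algebra_simps)
      also have "\<dots> = (\<integral>x. indicator A x * f x \<partial>M) - C * measure M A"
        using i1 iA A by (simp add: Bochner_Integration.integral_diff)
      finally show ?thesis using fA[OF A] by simp
    qed
    moreover have "\<bar>f x - C\<bar> \<le> C" for x using fb[of x] by (auto simp: abs_le_iff)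
    ultimately show ?thesis by (intro bexI[of _ "\<lambda>x. f x - C"]) auto
  qed
  have "\<exists>f\<in>borel_measurable M. (\<forall>x. \<bar>f x\<bar> \<le> C) \<and> (\<forall>A\<in>fmeasurable M. (\<integral>x. indicator A x * f x \<partial>M) = Re (u A))"
  proof (rule part)
    show "Re (u (A \<union> B)) = Re (u A) + Re (u B)" if "A \<in> fmeasurable M" "B \<in> fmeasurable M" "A \<inter> B = {}" for A B
      using add[OF that] by simp
    show "\<bar>Re (u A)\<bar> \<le> C * measure M A" if "A \<in> fmeasurable M" for A
      using le[OF that] abs_Re_le_cmod[of "u A"] by linarith
  qed
  then obtain f where f[measurable]: "f \<in> borel_measurable M" and fb: "\<And>x. \<bar>f x\<bar> \<le> C"
    and fA: "\<And>A. A \<in> fmeasurable M \<Longrightarrow> (\<integral>x. indicator A x * f x \<partial>M) = Re (u A)" by blast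
  have "\<exists>f\<in>borel_measurable M. (\<forall>x. \<bar>f x\<bar> \<le> C) \<and> (\<forall>A\<in>fmeasurable M. (\<integral>x. indicator A x * f x \<partial>M) = Im (u A))"
  proof (rule part)
    show "Im (u (A \<union> B)) = Im (u A) + Im (u B)" if "A \<in> fmeasurable M" "B \<in> fmeasurable M" "A \<inter> B = {}" for A B
      using add[OF that] by simp
    show "\<bar>Im (u A)\<bar> \<le> C * measure M A" if "A \<in> fmeasurable M" for A
      using le[OF that] abs_Im_le_cmod[of "u A"] by linarith
  qed
  then obtain g where g[measurable]: "g \<in> borel_measurable M" and gb: "\<And>x. \<bar>g x\<bar> \<le> C"
    and gA: "\<And>A. A \<in> fmeasurable M \<Longrightarrow> (\<integral>x. indicator A x * g x \<partial>M) = Im (u A)" by blast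
  let ?h = "\<lambda>x. of_real (f x) + \<i> * of_real (g x) :: complex"
  have "cmod (?h x) \<le> 2 * C" for x
  proof -
    have "cmod (?h x) \<le> cmod (of_real (f x)) + cmod (\<i> * of_real (g x))" by (rule norm_triangle_ineq)
    also have "\<dots> = \<bar>f x\<bar> + \<bar>g x\<bar>" by (simp add: norm_mult)
    finally show ?thesis using fb[of x] gb[of x] by linarith
  qed
  moreover have "(\<integral>x. indicator A x * ?h x \<partial>M) = u A" if A: "A \<in> fmeasurable M" for A
  proof -
    have iA: "integrable M (\<lambda>x. C * indicator A x)" using A by (auto simp: fmeasurable_def)
    have [measurable]: "A \<in> sets M" using A by auto
    have i1: "integrable M (\<lambda>x. indicator A x * f x)" "integrable M (\<lambda>x. indicator A x * g x)"
      using iA by (rule Bochner_Integration.integrable_bound, use fb gb C in \<open>auto simp: indicator_def\<close>)+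
    have "(\<integral>x. indicator A x * ?h x \<partial>M) =
       (\<integral>x. of_real (indicator A x * f x) + \<i> * of_real (indicator A x * g x) \<partial>M)"
      by (intro Bochner_Integration.integral_cong) (auto simp: indicator_def)
    also have "\<dots> = (\<integral>x. of_real (indicator A x * f x) \<partial>M) + \<i> * (\<integral>x. of_real (indicator A x * g x) \<partial>M)"
    proof -
      have "integrable M (\<lambda>x. complex_of_real (indicator A x * f x))"
        "integrable M (\<lambda>x. complex_of_real (indicator A x * g x))"
        by (rule integrable_of_real[OF i1(1)], rule integrable_of_real[OF i1(2)])
      then show ?thesis
        by (subst Bochner_Integration.integral_add) (auto simp only: integral_mult_right_zero intro: integrable_mult_right)
    qed
    also have "\<dots> = of_real (Re (u A)) + \<i> * of_real (Im (u A))"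
      by (simp only: integral_complex_of_real fA[OF A] gA[OF A])
    also have "\<dots> = u A" by (rule complex_eq[symmetric])
    finally show ?thesis .
  qed
  ultimately show ?thesis by (intro bexI[of _ ?h]) auto
qed

lemma (in sigma_finite_measure) AE_eq_if_integrals_eq:
  fixes f g :: "'a \<Rightarrow> complex"
  assumes [measurable]: "f \<in> borel_measurable M" "g \<in> borel_measurable M"
    and bd: "\<And>x. cmod (f x) \<le> C" "\<And>x. cmod (g x) \<le> C"
    and eq: "\<And>A. A \<in> fmeasurable M \<Longrightarrow> (\<integral>x. indicator A x * f x \<partial>M) = (\<integral>x. indicator A x * g x \<partial>M)"
  shows "AE x in M. f x = g x"
proof -
  obtain D :: "nat \<Rightarrow> 'a set" where D: "range D \<subseteq> sets M" "\<Union> (range D) = space M"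
    "\<And>i. emeasure M (D i) \<noteq> \<infinity>"
    using sigma_finite by metis
  have "AE x in M. indicator (D n) x * f x = indicator (D n) x * g x" for n
  proof (rule density_unique_banach)
    have [measurable]: "D n \<in> sets M" using D by auto
    have i: "integrable M (\<lambda>x. C * indicator (D n) x)" using D by (auto simp: less_top)
    show "integrable M (\<lambda>x. indicator (D n) x * f x)" "integrable M (\<lambda>x. indicator (D n) x * g x)"
      using i by (rule Bochner_Integration.integrable_bound,
        use bd in \<open>auto simp: indicator_def intro: order_trans[OF _ abs_ge_self]\<close>)+
    fix A assume [measurable]: "A \<in> sets M"
    have "A \<inter> D n \<in> fmeasurable M"
      by (rule fmeasurableI2[of "D n"]) (use D in \<open>auto simp: fmeasurable_def less_top\<close>)
    from eq[OF this] show "set_lebesgue_integral M A (\<lambda>x. indicator (D n) x * f x) = set_lebesgue_integral M A (\<lambda>x. indicator (D n) x * g x)"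
      unfolding set_lebesgue_integral_def indicator_inter_arith
      by (simp add: scaleR_conv_of_real mult.assoc of_real_indicator)
  qed
  then have "AE x in M. \<forall>n. indicator (D n) x * f x = indicator (D n) x * g x" unfolding AE_all_countable by blast
  then show ?thesis using AE_space
  proof eventually_elim
    case (elim x)
    then obtain n where "x \<in> D n" using D(2) by auto
    then show ?case using elim(1) by (auto simp: indicator_def dest: spec[of _ n])
  qed
qed

text \<open>The densities \<open>C + f\<close> and \<open>C\<close> are nonnegative and define
  measures that agree on an intersection-stable generator of finite rectangles. The generator
  \<open>\<K>\<close> is left open because it is applied both to compact subsets of the group and to
  all measurable sets of a probability space.\<close>

lemma AE_zero_if_rectangle_integrals_zero:
  fixes f :: "'a \<times> 'b \<Rightarrow> real"
  assumes "sigma_finite_measure M" "sigma_finite_measure N"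
    and \<K>: "Int_stable \<K>" "\<K> \<subseteq> fmeasurable N" "sets N = sigma_sets (space N) \<K>"
    and K: "range K \<subseteq> \<K>" "(\<Union>n::nat. K n) = space N" "incseq K"
    and [measurable]: "f \<in> borel_measurable (M \<Otimes>\<^sub>M N)"
    and bd: "\<And>p. \<bar>f p\<bar> \<le> C"
    and zero: "\<And>E B. E \<in> fmeasurable M \<Longrightarrow> B \<in> \<K> \<Longrightarrow> (\<integral>p. indicator (E \<times> B) p * f p \<partial>(M \<Otimes>\<^sub>M N)) = 0"
  shows "AE p in M \<Otimes>\<^sub>M N. f p = 0"
proof -
  interpret M: sigma_finite_measure M by fact
  interpret N: sigma_finite_measure N by fact
  interpret MN: pair_sigma_finite M N ..
  have C: "0 \<le> C" using bd[of undefined] by linarith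
  have fp: "0 \<le> C + f p" for p using bd[of p] by linarith
  define m1 where "m1 = density (M \<Otimes>\<^sub>M N) (\<lambda>p. ennreal (C + f p))"
  define m2 where "m2 = density (M \<Otimes>\<^sub>M N) (\<lambda>p. ennreal C)"
  have rect: "E \<times> B \<in> fmeasurable (M \<Otimes>\<^sub>M N)" if "E \<in> fmeasurable M" "B \<in> \<K>" for E B
  proof -
    have B: "B \<in> fmeasurable N" using that(2) \<K>(2) by auto
    have "emeasure (M \<Otimes>\<^sub>M N) (E \<times> B) = emeasure M E * emeasure N B"
      using that(1) B by (intro N.emeasure_pair_measure_Times) auto
    also have "\<dots> < \<infinity>"
      using that(1) B by (auto simp: fmeasurable_def ennreal_mult_less_top)
    finally show ?thesis using that(1) B by (intro fmeasurableI pair_measureI) auto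
  qed
  have eqr: "emeasure m1 (E \<times> B) = emeasure m2 (E \<times> B)" "emeasure m2 (E \<times> B) < \<infinity>"
    if EB: "E \<in> fmeasurable M" "B \<in> \<K>" for E B
  proof -
    let ?A = "E \<times> B"
    have A: "?A \<in> fmeasurable (M \<Otimes>\<^sub>M N)" using EB by (rule rect)
    then have [measurable]: "?A \<in> sets (M \<Otimes>\<^sub>M N)" by auto
    have iA: "integrable (M \<Otimes>\<^sub>M N) (\<lambda>p. C * indicator ?A p)" using A by (auto simp: fmeasurable_def)
    have i1: "integrable (M \<Otimes>\<^sub>M N) (\<lambda>p. indicator ?A p * f p)"
      using iA by (rule Bochner_Integration.integrable_bound) (use bd C in \<open>auto simp: indicator_def\<close>)
    have "emeasure m1 ?A = (\<integral>\<^sup>+p. ennreal (C + f p) * indicator ?A p \<partial>(M \<Otimes>\<^sub>M N))"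
      by (simp add: m1_def emeasure_density)
    also have "\<dots> = (\<integral>\<^sup>+p. ennreal (C * indicator ?A p + indicator ?A p * f p) \<partial>(M \<Otimes>\<^sub>M N))"
      by (intro nn_integral_cong) (simp add: indicator_def)
    also have "\<dots> = ennreal (\<integral>p. C * indicator ?A p + indicator ?A p * f p \<partial>(M \<Otimes>\<^sub>M N))"
      using iA i1 fp by (intro nn_integral_eq_integral) (auto simp: indicator_def)
    also have "(\<integral>p. C * indicator ?A p + indicator ?A p * f p \<partial>(M \<Otimes>\<^sub>M N)) = (\<integral>p. C * indicator ?A p \<partial>(M \<Otimes>\<^sub>M N))"
      using zero[OF EB] by (subst Bochner_Integration.integral_add[OF iA i1]) simp
    also have "ennreal \<dots> = (\<integral>\<^sup>+p. ennreal (C * indicator ?A p) \<partial>(M \<Otimes>\<^sub>M N))"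
      using iA C by (intro nn_integral_eq_integral[symmetric]) auto
    also have "\<dots> = (\<integral>\<^sup>+p. ennreal C * indicator ?A p \<partial>(M \<Otimes>\<^sub>M N))"
      by (intro nn_integral_cong) (simp add: indicator_def)
    also have "\<dots> = emeasure m2 ?A"
      by (simp add: m2_def emeasure_density)
    finally show "emeasure m1 ?A = emeasure m2 ?A" .
    have "emeasure m2 ?A = ennreal C * emeasure (M \<Otimes>\<^sub>M N) ?A"
      by (simp add: m2_def emeasure_density nn_integral_cmult)
    also have "\<dots> < \<infinity>" using A by (auto simp: fmeasurable_def ennreal_mult_less_top)
    finally show "emeasure m2 ?A < \<infinity>" .
  qed
  obtain D :: "nat \<Rightarrow> 'a set" where D: "range D \<subseteq> sets M" "\<Union> (range D) = space M"
    "\<And>i. emeasure M (D i) \<noteq> \<infinity>" "incseq D"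
    by (rule M.sigma_finite_incseq) (rule that)
  have Df: "D n \<in> fmeasurable M" for n using D by (auto simp: fmeasurable_def less_top)
  have Kn: "K n \<in> \<K>" for n using K(1) by auto
  have fmsp: "fmeasurable M \<subseteq> Pow (space M)" using sets.sets_into_space by (auto simp: fmeasurable_def)
  have \<K>sp: "\<K> \<subseteq> Pow (space N)"
  proof
    fix B assume "B \<in> \<K>"
    then have "B \<in> sets N" using \<K>(2) by auto
    then show "B \<in> Pow (space N)" using sets.sets_into_space by auto
  qed
  let ?G = "{E \<times> B | E B. E \<in> fmeasurable M \<and> B \<in> \<K>}"
  have Gsp: "?G \<subseteq> Pow (space M \<times> space N)" using fmsp \<K>sp by fast
  have setsM: "sets M = sigma_sets (space M) (fmeasurable M)"
  proof
    show "sigma_sets (space M) (fmeasurable M) \<subseteq> sets M"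
      by (rule sets.sigma_sets_subset) auto
    show "sets M \<subseteq> sigma_sets (space M) (fmeasurable M)"
    proof
      fix A assume A: "A \<in> sets M"
      interpret S: sigma_algebra "space M" "sigma_sets (space M) (fmeasurable M)"
        using fmsp by (rule sigma_algebra_sigma_sets)
      have "A \<inter> D n \<in> fmeasurable M" for n
        by (rule fmeasurableI2[OF Df[of n]]) (use A D(1) in auto)
      then have "(\<Union>n. A \<inter> D n) \<in> sigma_sets (space M) (fmeasurable M)"
        by (intro S.countable_UN) auto
      moreover have "(\<Union>n. A \<inter> D n) = A \<inter> \<Union> (range D)" by (rule Int_UN_distrib[symmetric])
      ultimately show "A \<in> sigma_sets (space M) (fmeasurable M)"
        using D(2) sets.sets_into_space[OF A] by (simp add: Int_absorb2)
    qed
  qed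
  have gen: "sets (M \<Otimes>\<^sub>M N) = sigma_sets (space M \<times> space N) ?G"
  proof -
    have "sets (M \<Otimes>\<^sub>M N) = sets (sigma (space M \<times> space N) ?G)"
    proof (rule sets_pair_eq)
      show "fmeasurable M \<subseteq> Pow (space M)" by (rule fmsp)
      show "\<K> \<subseteq> Pow (space N)" by (rule \<K>sp)
      show "sets M = sigma_sets (space M) (fmeasurable M)" by (rule setsM)
      show "sets N = sigma_sets (space N) \<K>" by (rule \<K>(3))
      show "range D \<subseteq> fmeasurable M" using Df by auto
      show "range K \<subseteq> \<K>" by (rule K(1))
    qed (use D(2) K(2) in auto)
    then show ?thesis using Gsp by simp
  qed
  have "m1 = m2"
  proof (rule measure_eqI_generator_eq)
    show "Int_stable ?G"
    proof (rule Int_stableI)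
      fix a b assume "a \<in> ?G" "b \<in> ?G"
      then obtain E E' B B' where ab: "a = E \<times> B" "b = E' \<times> B'" "E \<in> fmeasurable M" "E' \<in> fmeasurable M"
        "B \<in> \<K>" "B' \<in> \<K>" by auto
      have "a \<inter> b = (E \<inter> E') \<times> (B \<inter> B')" using ab(1,2) by auto
      moreover have "E \<inter> E' \<in> fmeasurable M" using ab(3,4) by (intro fmeasurable.Int)
      moreover have "B \<inter> B' \<in> \<K>" using ab(5,6) \<K>(1) by (simp add: Int_stableD)
      ultimately show "a \<inter> b \<in> ?G" by (intro CollectI exI[of _ "E \<inter> E'"] exI[of _ "B \<inter> B'"] conjI)
    qed
    show "?G \<subseteq> Pow (space M \<times> space N)" by (rule Gsp)
    show "sets m1 = sigma_sets (space M \<times> space N) ?G" "sets m2 = sigma_sets (space M \<times> space N) ?G"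
      using gen by (simp_all add: m1_def m2_def)
    show "range (\<lambda>n. D n \<times> K n) \<subseteq> ?G"
    proof
      fix x assume "x \<in> range (\<lambda>n. D n \<times> K n)"
      then obtain n where "x = D n \<times> K n" by auto
      then show "x \<in> ?G" using Df Kn by (intro CollectI exI[of _ "D n"] exI[of _ "K n"] conjI)
    qed
    show "(\<Union>n. D n \<times> K n) = space M \<times> space N"
    proof
      show "(\<Union>n. D n \<times> K n) \<subseteq> space M \<times> space N" using D(2) K(2) by fast
      show "space M \<times> space N \<subseteq> (\<Union>n. D n \<times> K n)"
      proof
        fix p assume p: "p \<in> space M \<times> space N"
        obtain i where i: "fst p \<in> D i" using p D(2) by fastforce
        obtain j where j: "snd p \<in> K j" using p K(2) by fastforce
        have "fst p \<in> D (max i j)" using i incseqD[OF D(4), of i "max i j"] by auto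
        moreover have "snd p \<in> K (max i j)" using j incseqD[OF K(3), of j "max i j"] by auto
        ultimately show "p \<in> (\<Union>n. D n \<times> K n)" by (intro UN_I[of "max i j"]) (auto simp: mem_Times_iff)
      qed
    qed
    fix X assume "X \<in> ?G"
    then obtain E B where "X = E \<times> B" "E \<in> fmeasurable M" "B \<in> \<K>" by auto
    then show "emeasure m1 X = emeasure m2 X" using eqr(1) by simp
  next
    fix n :: nat show "emeasure m1 (D n \<times> K n) \<noteq> \<infinity>" using eqr[OF Df Kn, of n n] by auto
  qed
  then have "AE p in M \<Otimes>\<^sub>M N. ennreal (C + f p) = ennreal C"
    unfolding m1_def m2_def by (subst (asm) MN.density_unique_iff) auto
  then show ?thesis
    by eventually_elim (use C fp in \<open>simp add: ennreal_inj\<close>)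
qed

section \<open>Rokhlin extensions\<close>

lemma borel_measurable_uminus_group[measurable (raw)]:
  fixes f :: "'a \<Rightarrow> 'g::{topological_group_add, second_countable_topology}"
  assumes "f \<in> borel_measurable M"
  shows "(\<lambda>x. - f x) \<in> borel_measurable M"
  by (rule borel_measurable_continuous_on[OF _ assms]) (intro continuous_intros)

text \<open>Fubini: the fibre maps preserve \<open>N\<close> one by one and \<open>R\<close>
  preserves \<open>M\<close>. Group extensions and Rokhlin extensions are both instances.\<close>

lemma mp_iso_skew_product:
  assumes "sigma_finite_measure M" "sigma_finite_measure N" and R: "mp_iso M R"
    and spN: "space N = UNIV"
    and s[measurable]: "(\<lambda>p. s (fst p) (snd p)) \<in> M \<Otimes>\<^sub>M N \<rightarrow>\<^sub>M N"
    and s'[measurable]: "(\<lambda>p. s' (fst p) (snd p)) \<in> M \<Otimes>\<^sub>M N \<rightarrow>\<^sub>M N"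
    and inv: "\<And>x y. s' x (s x y) = y" "\<And>x y. s x (s' x y) = y"
    and dis: "\<And>x. distr N N (s x) = N"
  shows "mp_iso (M \<Otimes>\<^sub>M N) (\<lambda>p. (R (fst p), s (fst p) (snd p)))"
proof -
  interpret M: sigma_finite_measure M by fact
  interpret N: sigma_finite_measure N by fact
  obtain R' where R'[measurable]: "R' \<in> M \<rightarrow>\<^sub>M M" and RR: "\<And>x. R' (R x) = x" "\<And>x. R (R' x) = x"
    using R by (auto simp: mp_iso_def)
  note RM = mp_isoD[OF R]
  note [measurable] = RM(2)
  have sp: "space (M \<Otimes>\<^sub>M N) = UNIV" by (simp add: space_pair_measure RM spN)
  have sx[measurable]: "s x \<in> N \<rightarrow>\<^sub>M N" for x
  proof -
    have "x \<in> space M" using RM(1) by simp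
    from measurable_compose[OF measurable_Pair1'[OF this] s] show ?thesis by (simp only: fst_conv snd_conv)
  qed
  let ?f = "\<lambda>p. (R (fst p), s (fst p) (snd p))"
  have f[measurable]: "?f \<in> M \<Otimes>\<^sub>M N \<rightarrow>\<^sub>M M \<Otimes>\<^sub>M N" by measurable
  have "distr (M \<Otimes>\<^sub>M N) (M \<Otimes>\<^sub>M N) ?f = M \<Otimes>\<^sub>M N"
  proof (rule measure_eqI)
    fix A assume "A \<in> sets (distr (M \<Otimes>\<^sub>M N) (M \<Otimes>\<^sub>M N) ?f)"
    then have A[measurable]: "A \<in> sets (M \<Otimes>\<^sub>M N)" by simp
    have Ax[measurable]: "(\<lambda>y. indicator A (x, y) :: ennreal) \<in> borel_measurable N" for x
    proof -
      have "x \<in> space M" using RM(1) by simp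
      from measurable_compose[OF measurable_Pair1'[OF this] borel_measurable_indicator[OF A]] show ?thesis .
    qed
    have "emeasure (distr (M \<Otimes>\<^sub>M N) (M \<Otimes>\<^sub>M N) ?f) A = emeasure (M \<Otimes>\<^sub>M N) (?f -` A)"
      by (simp add: emeasure_distr sp)
    also have "\<dots> = (\<integral>\<^sup>+x. \<integral>\<^sup>+y. indicator A (R x, s x y) \<partial>N \<partial>M)"
      using measurable_sets[OF f A] sp
      by (subst N.emeasure_pair_measure) (auto intro!: nn_integral_cong simp: indicator_def)
    also have "\<dots> = (\<integral>\<^sup>+x. \<integral>\<^sup>+y. indicator A (R x, y) \<partial>N \<partial>M)"
    proof (rule nn_integral_cong)
      fix x
      have "(\<integral>\<^sup>+y. indicator A (R x, s x y) \<partial>N) = (\<integral>\<^sup>+y. indicator A (R x, y) \<partial>distr N N (s x))"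
        by (rule nn_integral_distr[symmetric]) measurable
      then show "(\<integral>\<^sup>+y. indicator A (R x, s x y) \<partial>N) = (\<integral>\<^sup>+y. indicator A (R x, y) \<partial>N)"
        by (simp add: dis)
    qed
    also have "\<dots> = (\<integral>\<^sup>+x. \<integral>\<^sup>+y. indicator A (x, y) \<partial>N \<partial>distr M M R)"
      by (rule nn_integral_distr[symmetric]) measurable
    also have "\<dots> = emeasure (M \<Otimes>\<^sub>M N) A"
      unfolding RM(3) using A by (rule N.emeasure_pair_measure[symmetric])
    finally show "emeasure (distr (M \<Otimes>\<^sub>M N) (M \<Otimes>\<^sub>M N) ?f) A = emeasure (M \<Otimes>\<^sub>M N) A" .
  qed simp
  \<comment> \<open>The inverse has to undo the fibre map over the preimage point, so
    \<open>s'\<close> is read at \<open>R' x\<close> and not at \<open>x\<close>.\<close>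
  moreover have "(\<lambda>p. (R' (fst p), s' (R' (fst p)) (snd p))) \<in> M \<Otimes>\<^sub>M N \<rightarrow>\<^sub>M M \<Otimes>\<^sub>M N"
  proof -
    have "(\<lambda>p. (R' (fst p), snd p)) \<in> M \<Otimes>\<^sub>M N \<rightarrow>\<^sub>M M \<Otimes>\<^sub>M N" by measurable
    from measurable_compose[OF this s'] have "(\<lambda>p. s' (R' (fst p)) (snd p)) \<in> M \<Otimes>\<^sub>M N \<rightarrow>\<^sub>M N"
      by (simp only: fst_conv snd_conv)
    then show ?thesis by (intro measurable_Pair) measurable
  qed
  ultimately show ?thesis
    unfolding mp_iso_def using sp inv RR
    by (auto intro!: bexI[of _ "\<lambda>p. (R' (fst p), s' (R' (fst p)) (snd p))"])
qed

lemma mp_actionD: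
  assumes "mp_action N S"
  shows "(\<lambda>p. S (fst p) (snd p)) \<in> borel \<Otimes>\<^sub>M N \<rightarrow>\<^sub>M N" "S 0 = id" "\<And>g h y. S (g + h) y = S g (S h y)"
    "\<And>g. S g \<in> N \<rightarrow>\<^sub>M N" "\<And>g. distr N N (S g) = N"
  using assms by (auto simp: mp_action_def mp_map_def o_def split_beta')

lemma mp_action_uminus:
  fixes S :: "'g::{topological_space, group_add} \<Rightarrow> 'y \<Rightarrow> 'y"
  assumes "mp_action N S"
  shows "S (- g) (S g y) = y" "S g (S (- g) y) = y"
  using mp_actionD(2)[OF assms] mp_actionD(3)[OF assms, of "-g" g y] mp_actionD(3)[OF assms, of g "-g" y] by auto

lemma mp_action_measurable:
  assumes "mp_action N S" and [measurable]: "f \<in> borel_measurable M" "k \<in> M \<rightarrow>\<^sub>M N"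
  shows "(\<lambda>x. S (f x) (k x)) \<in> M \<rightarrow>\<^sub>M N"
proof -
  have "(\<lambda>x. (f x, k x)) \<in> M \<rightarrow>\<^sub>M borel \<Otimes>\<^sub>M N" by measurable
  from measurable_compose[OF this mp_actionD(1)[OF assms(1)]] show ?thesis by simp
qed

lemma mp_iso_rokhlin_ext:
  fixes S :: "'g::{topological_ab_group_add, second_countable_topology} \<Rightarrow> 'y \<Rightarrow> 'y"
  assumes "sigma_finite_measure M" "sigma_finite_measure N" "mp_iso M R"
    and [measurable]: "\<psi> \<in> borel_measurable M"
    and "space N = UNIV" and S: "mp_action N S"
  shows "mp_iso (M \<Otimes>\<^sub>M N) (rokhlin_ext R \<psi> S)"
proof -
  have "mp_iso (M \<Otimes>\<^sub>M N) (\<lambda>p. (R (fst p), S (\<psi> (fst p)) (snd p)))"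
    using assms(1-3,5)
  proof (rule mp_iso_skew_product[where s' = "\<lambda>x. S (- \<psi> x)"])
    show "(\<lambda>p. S (\<psi> (fst p)) (snd p)) \<in> M \<Otimes>\<^sub>M N \<rightarrow>\<^sub>M N"
      "(\<lambda>p. S (- \<psi> (fst p)) (snd p)) \<in> M \<Otimes>\<^sub>M N \<rightarrow>\<^sub>M N"
      by (rule mp_action_measurable[OF S], measurable)+
  qed (use S mp_actionD[OF S] mp_action_uminus[OF S] in auto)
  then show ?thesis by (simp add: rokhlin_ext_def split_beta')
qed

text \<open>An almost-everywhere statement says that a section has measure zero, and the measure of
  a section depends measurably on the point.\<close>

lemma (in sigma_finite_measure) pred_AE:
  assumes "Measurable.pred (N \<Otimes>\<^sub>M M) (\<lambda>p. P (fst p) (snd p))"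
  shows "Measurable.pred N (\<lambda>x. AE y in M. P x y)"
proof -
  let ?E = "{q\<in>space (N \<Otimes>\<^sub>M M). \<not> P (fst q) (snd q)}"
  have E: "?E \<in> sets (N \<Otimes>\<^sub>M M)" using assms by measurable
  have "(AE y in M. P x y) \<longleftrightarrow> emeasure M (Pair x -` ?E) = 0" if "x \<in> space N" for x
    using sets_Pair1[OF E, of x] that
    by (intro AE_iff_measurable) (auto simp: space_pair_measure)
  moreover have "Measurable.pred N (\<lambda>x. emeasure M (Pair x -` ?E) = 0)"
    using measurable_emeasure_Pair[OF E] by measurable
  ultimately show ?thesis by (simp cong: measurable_cong)
qed

section \<open>Group extensions and ergodicity of Rokhlin extensions\<close>

context haar_group
begin

lemma finite_positive_set_exists: "\<exists>B\<in>sets borel. 0 < emeasure L B \<and> emeasure L B < \<infinity>"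
proof -
  obtain U K :: "'g set" where "open U" "compact K" "0 \<in> U" "U \<subseteq> K" using compact_neighbourhood[of 0] by blast
  then show ?thesis
    using emeasure_L_open[of U] emeasure_finite_subset_compact[of U K] by (intro bexI[of _ U]) auto
qed

lemma emeasure_L_UNIV_pos: "emeasure L UNIV > 0"
  by (rule emeasure_L_open) auto

lemma AE_L_const: "(AE g in L. P) \<Longrightarrow> P"
  using emeasure_L_UNIV_pos ae_filter_eq_bot_iff[of L] eventually_const[of "ae_filter L" P]
  by auto

lemma AE_L_ex:
  assumes "AE g in L. P g"
  shows "\<exists>g. P g"
proof (rule ccontr)
  assume "\<not> ?thesis"
  then have "AE g in L. False" using assms by simp
  then show False by (rule AE_L_const)
qed

lemma mp_iso_group_ext:
  assumes "sigma_finite_measure M" "mp_iso M R" and [measurable]: "\<psi> \<in> borel_measurable M"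
  shows "mp_iso (M \<Otimes>\<^sub>M L) (group_ext R \<psi>)"
proof -
  have "mp_iso (M \<Otimes>\<^sub>M L) (\<lambda>p. (R (fst p), \<psi> (fst p) + snd p))"
    using assms(1) sigma_finite_L assms(2) space_L
  proof (rule mp_iso_skew_product[where s' = "\<lambda>x g. - \<psi> x + g"])
    show "(\<lambda>p. \<psi> (fst p) + snd p) \<in> M \<Otimes>\<^sub>M L \<rightarrow>\<^sub>M L" "(\<lambda>p. - \<psi> (fst p) + snd p) \<in> M \<Otimes>\<^sub>M L \<rightarrow>\<^sub>M L"
      by measurable
    show "- \<psi> x + (\<psi> x + g) = g" "\<psi> x + (- \<psi> x + g) = g" for x g by simp_all
    show "distr L L ((+) (\<psi> x)) = L" for x by (rule distr_L_translation)
  qed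
  then show ?thesis by (simp add: group_ext_def split_beta')
qed

lemma mp_iso_id: "space M = UNIV \<Longrightarrow> mp_iso M (\<lambda>x. x)"
  by (auto simp: mp_iso_def intro!: bexI[of _ "\<lambda>x. x"])

lemma mp_iso_translation:
  assumes "sigma_finite_measure M" "space M = UNIV"
  shows "mp_iso (M \<Otimes>\<^sub>M L) (\<lambda>p. (fst p, h + snd p))"
  using mp_iso_group_ext[OF assms(1) mp_iso_id[OF assms(2)], of "\<lambda>_. h"]
  by (simp add: group_ext_def split_beta')

text \<open>The set of \<open>y\<close> whose orbit lies a.e. in the sections of \<open>D\<close> is strictly \<open>S\<close>-invariant by
  translation invariance of \<open>L\<close>, hence trivial; and \<open>(z, g, y) \<mapsto> (z, g, S g y)\<close> preserves the measure.\<close>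
lemma orbitwise_trivial_imp_trivial:
  assumes "sigma_finite_measure M" and spM: "space M = UNIV"
    and "sigma_finite_measure N" and spN: "space N = UNIV"
    and S: "mp_action N S" and erg: "ergodic_action N S"
    and D[measurable]: "Measurable.pred (M \<Otimes>\<^sub>M N) D"
    and triv: "AE y in N. (AE p in M \<Otimes>\<^sub>M L. D (fst p, S (snd p) y)) \<or>
      (AE p in M \<Otimes>\<^sub>M L. \<not> D (fst p, S (snd p) y))"
  shows "(AE p in M \<Otimes>\<^sub>M N. D p) \<or> (AE p in M \<Otimes>\<^sub>M N. \<not> D p)"
proof -
  interpret M: sigma_finite_measure M by fact
  interpret N: sigma_finite_measure N by fact
  interpret L: sigma_finite_measure L by (rule sigma_finite_L)
  interpret PL: pair_sigma_finite M L ..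
  interpret PLN: pair_sigma_finite "M \<Otimes>\<^sub>M L" N ..
  interpret MN: pair_sigma_finite M N ..
  have sp: "space (M \<Otimes>\<^sub>M L) = UNIV" "space (M \<Otimes>\<^sub>M N) = UNIV" "space ((M \<Otimes>\<^sub>M L) \<Otimes>\<^sub>M N) = UNIV"
    by (simp_all add: space_pair_measure spM spN)
  have act: "(\<lambda>q. (fst (fst q), S (snd (fst q)) (snd q))) \<in> (M \<Otimes>\<^sub>M L) \<Otimes>\<^sub>M N \<rightarrow>\<^sub>M M \<Otimes>\<^sub>M N"
    by (intro measurable_Pair mp_action_measurable[OF S]) measurable
  have full: "AE p in M \<Otimes>\<^sub>M N. P p"
    if [measurable]: "Measurable.pred (M \<Otimes>\<^sub>M N) P"
      and ae: "AE y in N. AE p in M \<Otimes>\<^sub>M L. P (fst p, S (snd p) y)" for P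
  proof -
    have Pm: "Measurable.pred ((M \<Otimes>\<^sub>M L) \<Otimes>\<^sub>M N) (\<lambda>q. P (fst (fst q), S (snd (fst q)) (snd q)))"
      using act by measurable
    have "{q\<in>space ((M \<Otimes>\<^sub>M L) \<Otimes>\<^sub>M N). P (fst (fst q), S (snd (fst q)) (snd q))} \<in> sets ((M \<Otimes>\<^sub>M L) \<Otimes>\<^sub>M N)"
      using Pm by (simp add: pred_def)
    then have "AE q in (M \<Otimes>\<^sub>M L) \<Otimes>\<^sub>M N. P (fst (fst q), S (snd (fst q)) (snd q))"
      using ae PLN.AE_commute[of "\<lambda>p y. P (fst p, S (snd p) y)"]
        PLN.AE_pair_iff[of "\<lambda>p y. P (fst p, S (snd p) y)"] by simp
    note AEP = this
    have iso: "mp_iso ((M \<Otimes>\<^sub>M L) \<Otimes>\<^sub>M N) (rokhlin_ext (\<lambda>p. p) (\<lambda>p. - snd p) S)"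
      by (rule mp_iso_rokhlin_ext) (use sp spN S in \<open>auto intro: mp_iso_id PL.sigma_finite_measure_axioms N.sigma_finite_measure_axioms\<close>)
    have "AE q in (M \<Otimes>\<^sub>M L) \<Otimes>\<^sub>M N. P (fst (fst q), snd q)"
      using mp_iso_AE[OF iso AEP] by (simp add: rokhlin_ext_def split_beta mp_action_uminus[OF S])
    then have "AE p in M \<Otimes>\<^sub>M L. AE y in N. P (fst p, y)"
      using PLN.AE_pair[of "\<lambda>q. P (fst (fst q), snd q)"] by simp
    then have "AE z in M. AE g in L. AE y in N. P (z, y)"
      using PL.AE_pair[of "\<lambda>p. AE y in N. P (fst p, y)"] by simp
    then have "AE z in M. AE y in N. P (z, y)"
      by eventually_elim (rule AE_L_const)
    then show ?thesis by (intro MN.AE_pair_measure) (auto simp: pred_def[symmetric])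
  qed
  define C where "C = {y. AE p in M \<Otimes>\<^sub>M L. D (fst p, S (snd p) y)}"
  have "C \<in> sets N"
  proof -
    have "(\<lambda>q. (fst (snd q), S (snd (snd q)) (fst q))) \<in> N \<Otimes>\<^sub>M (M \<Otimes>\<^sub>M L) \<rightarrow>\<^sub>M M \<Otimes>\<^sub>M N"
      by (intro measurable_Pair mp_action_measurable[OF S]) measurable
    then have "Measurable.pred (N \<Otimes>\<^sub>M (M \<Otimes>\<^sub>M L)) (\<lambda>q. D (fst (snd q), S (snd (snd q)) (fst q)))"
      using D by (rule measurable_compose)
    then have "Measurable.pred N (\<lambda>y. AE p in M \<Otimes>\<^sub>M L. D (fst p, S (snd p) y))"
      by (intro PL.pred_AE) simp
    then show ?thesis by (simp add: pred_def C_def spN)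
  qed
  moreover have "S h -` C \<inter> space N = C" for h
  proof -
    have "(AE p in M \<Otimes>\<^sub>M L. D (fst p, S (snd p) (S h y))) \<longleftrightarrow> (AE p in M \<Otimes>\<^sub>M L. D (fst p, S (snd p) y))" for y
    proof
      assume "AE p in M \<Otimes>\<^sub>M L. D (fst p, S (snd p) y)"
      from mp_iso_AE[OF mp_iso_translation[OF M.sigma_finite_measure_axioms spM, of h] this]
      show "AE p in M \<Otimes>\<^sub>M L. D (fst p, S (snd p) (S h y))"
        by (simp add: mp_actionD(3)[OF S, symmetric] add.commute)
    next
      assume "AE p in M \<Otimes>\<^sub>M L. D (fst p, S (snd p) (S h y))"
      from mp_iso_AE[OF mp_iso_translation[OF M.sigma_finite_measure_axioms spM, of "- h"] this]
      show "AE p in M \<Otimes>\<^sub>M L. D (fst p, S (snd p) y)"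
        by (simp add: mp_actionD(3)[OF S, symmetric] add.commute)
    qed
    then show ?thesis by (auto simp: C_def spN)
  qed
  ultimately have "emeasure N C = 0 \<or> emeasure N (space N - C) = 0"
    using erg unfolding ergodic_action_def by blast
  then show ?thesis
  proof
    assume "emeasure N C = 0"
    then have "AE y in N. y \<notin> C" using \<open>C \<in> sets N\<close> by (intro AE_not_in) (auto simp: null_sets_def)
    with triv have "AE y in N. AE p in M \<Otimes>\<^sub>M L. \<not> D (fst p, S (snd p) y)"
      by eventually_elim (auto simp: C_def)
    then have "AE p in M \<Otimes>\<^sub>M N. \<not> D p" by (intro full[of "\<lambda>p. \<not> D p"]) auto
    then show ?thesis ..
  next
    assume "emeasure N (space N - C) = 0"
    then have "AE y in N. y \<in> C" using \<open>C \<in> sets N\<close> by (intro AE_I[of _ _ "space N - C"]) auto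
    then have "AE y in N. AE p in M \<Otimes>\<^sub>M L. D (fst p, S (snd p) y)"
      by eventually_elim (auto simp: C_def)
    then have "AE p in M \<Otimes>\<^sub>M N. D p" by (intro full) auto
    then show ?thesis ..
  qed
qed

lemma ergodic_map_AE:
  assumes "ergodic_map M f" "A \<in> sets M" "f -` A \<inter> space M = A"
  shows "(AE x in M. x \<in> A) \<or> (AE x in M. x \<notin> A)"
proof -
  have "emeasure M A = 0 \<or> emeasure M (space M - A) = 0"
    using assms unfolding ergodic_map_def by blast
  then show ?thesis
  proof
    assume "emeasure M A = 0"
    then show ?thesis using assms by (intro disjI2 AE_not_in) (auto simp: null_sets_def)
  next
    assume "emeasure M (space M - A) = 0"
    then show ?thesis using assms by (intro disjI1 AE_I[of _ _ "space M - A"]) auto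
  qed
qed

lemma ergodic_mapI:
  assumes "f \<in> M \<rightarrow>\<^sub>M M"
    and "\<And>A. A \<in> sets M \<Longrightarrow> f -` A \<inter> space M = A \<Longrightarrow> (AE x in M. x \<in> A) \<or> (AE x in M. x \<notin> A)"
  shows "ergodic_map M f"
  unfolding ergodic_map_def
proof (intro conjI ballI impI assms(1))
  fix A assume A: "A \<in> sets M" "f -` A \<inter> space M = A"
  from assms(2)[OF A] show "emeasure M A = 0 \<or> emeasure M (space M - A) = 0"
  proof
    assume "AE x in M. x \<in> A"
    then have "emeasure M (space M - A) = 0"
      using A by (subst (asm) AE_iff_measurable[OF _ refl]) (auto simp: set_diff_eq)
    then show ?thesis ..
  next
    assume "AE x in M. x \<notin> A"
    moreover have "{x\<in>space M. \<not> x \<notin> A} = A" using A sets.sets_into_space by auto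
    ultimately have "emeasure M A = 0"
      using A by (subst (asm) AE_iff_measurable[of A]) auto
    then show ?thesis ..
  qed
qed

text \<open>For fixed \<open>y\<close> the map sending \<open>(x, g)\<close> to
  \<open>(x, S g y)\<close> intertwines the group extension with the Rokhlin extension, so an
  invariant set pulls back to a trivial one, and every orbit of \<open>S\<close> sees it
  trivially.\<close>

lemma ergodic_rokhlin_ext:
  assumes "sigma_finite_measure M" and spM: "space M = UNIV"
    and "sigma_finite_measure N" and spN: "space N = UNIV"
    and S: "mp_action N S" and erg: "ergodic_action N S"
    and [measurable]: "T \<in> M \<rightarrow>\<^sub>M M" "\<phi> \<in> borel_measurable M"
    and ergT: "ergodic_map (M \<Otimes>\<^sub>M L) (group_ext T \<phi>)"
  shows "ergodic_map (M \<Otimes>\<^sub>M N) (rokhlin_ext T \<phi> S)"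
proof (rule ergodic_mapI)
  show "rokhlin_ext T \<phi> S \<in> M \<Otimes>\<^sub>M N \<rightarrow>\<^sub>M M \<Otimes>\<^sub>M N"
    unfolding rokhlin_ext_def split_beta' by (intro measurable_Pair mp_action_measurable[OF S]) measurable
  fix D assume D: "D \<in> sets (M \<Otimes>\<^sub>M N)" "rokhlin_ext T \<phi> S -` D \<inter> space (M \<Otimes>\<^sub>M N) = D"
  note [measurable] = D(1)
  have sp: "space (M \<Otimes>\<^sub>M L) = UNIV" "space (M \<Otimes>\<^sub>M N) = UNIV" by (simp_all add: space_pair_measure spM spN)
  have Dinv: "(T x, S (\<phi> x) y) \<in> D \<longleftrightarrow> (x, y) \<in> D" for x y
    using D(2) sp by (auto simp: rokhlin_ext_def vimage_def set_eq_iff)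
  have "(AE p in M \<Otimes>\<^sub>M L. (fst p, S (snd p) y) \<in> D) \<or> (AE p in M \<Otimes>\<^sub>M L. (fst p, S (snd p) y) \<notin> D)" for y
  proof -
    let ?A = "{p. (fst p, S (snd p) y) \<in> D}"
    have "y \<in> space N" by (simp add: spN)
    then have "(\<lambda>p. (fst p, S (snd p) y)) \<in> M \<Otimes>\<^sub>M L \<rightarrow>\<^sub>M M \<Otimes>\<^sub>M N"
      by (intro measurable_Pair mp_action_measurable[OF S]) measurable
    from measurable_sets[OF this D(1)] have "?A \<in> sets (M \<Otimes>\<^sub>M L)" by (simp add: sp vimage_def)
    moreover have "group_ext T \<phi> -` ?A \<inter> space (M \<Otimes>\<^sub>M L) = ?A"
      by (auto simp: sp group_ext_def mp_actionD(3)[OF S] Dinv)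
    ultimately show ?thesis using ergodic_map_AE[OF ergT, of ?A] by simp
  qed
  then show "(AE x in M \<Otimes>\<^sub>M N. x \<in> D) \<or> (AE x in M \<Otimes>\<^sub>M N. x \<notin> D)"
    using orbitwise_trivial_imp_trivial[OF assms(1) spM assms(3) spN S erg, of "\<lambda>p. p \<in> D"] by simp
qed

end

section \<open>Uniqueness of joinings\<close>

text \<open>Countability permits exchanging "for each set, for almost every g" with "for some g, for
  each set"; stability under intersections then determines a measure from these sets.\<close>

lemma countable_Int_stable_generator:
  "\<exists>G :: 'y::second_countable_topology set set. countable G \<and> Int_stable G \<and> UNIV \<in> G \<and>
     G \<subseteq> sets borel \<and> sets borel = sigma_sets UNIV G"
proof -
  obtain B :: "'y set set" where B: "countable B" "topological_basis B"
    using ex_countable_basis by auto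
  have opn: "open b" if "b \<in> B" for b using B(2) that by (rule topological_basis_open)
  let ?G = "Inter ` {F. finite F \<and> F \<subseteq> B}"
  have "countable ?G" using B(1) by (intro countable_image countable_Collect_finite_subset)
  moreover have "Int_stable ?G"
  proof (rule Int_stableI)
    fix a b assume "a \<in> ?G" "b \<in> ?G"
    then obtain F F' where "a = \<Inter>F" "b = \<Inter>F'" "finite F" "finite F'" "F \<subseteq> B" "F' \<subseteq> B" by auto
    then show "a \<inter> b \<in> ?G" by (intro image_eqI[of _ _ "F \<union> F'"]) auto
  qed
  moreover have "UNIV \<in> ?G" by (intro image_eqI[of _ _ "{}"]) auto
  moreover have G: "?G \<subseteq> sets borel"
    using opn by (auto intro!: borel_open open_Inter)
  moreover have "sets borel = sigma_sets UNIV ?G"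
  proof
    have "b \<in> ?G" if "b \<in> B" for b using that by (intro image_eqI[of _ _ "{b}"]) auto
    then have "sigma_sets UNIV B \<subseteq> sigma_sets UNIV ?G" by (intro sigma_sets_mono') auto
    then show "sets borel \<subseteq> sigma_sets UNIV ?G"
      unfolding borel_eq_countable_basis[OF B] by (simp add: sets_measure_of)
    show "sigma_sets UNIV ?G \<subseteq> sets borel"
      using sets.sigma_sets_subset[OF G] by simp
  qed
  ultimately show ?thesis by blast
qed

context haar_group
begin

text \<open>For \<open>C\<close> in \<open>N\<close>, the measure
  \<open>E \<mapsto> \<integral> indicator E (x, g) * indicator C (S (- g) y) d(\<kappa> \<otimes> L)\<close>
  is dominated by \<open>M \<otimes> L\<close> and invariant under the group extension, hence a multiple of \<open>M \<otimes> L\<close>.\<close>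
lemma rokhlin_joining_twisted_disintegration:
  fixes M :: "'a measure" and N :: "'b measure"
  assumes prM: "prob_space M" and R: "mp_iso M R" and \<psi>[measurable]: "\<psi> \<in> borel_measurable M"
    and erg: "ergodic_map (M \<Otimes>\<^sub>M L) (group_ext R \<psi>)"
    and prN: "prob_space N" and spN: "space N = UNIV" and S: "mp_action N S"
    and sets\<kappa>: "sets \<kappa> = sets (M \<Otimes>\<^sub>M N)" and fst\<kappa>: "distr \<kappa> M fst = M" and snd\<kappa>: "distr \<kappa> N snd = N"
    and inv\<kappa>: "distr \<kappa> \<kappa> (rokhlin_ext R \<psi> S) = \<kappa>"
    and A[measurable]: "A \<in> sets M" and C[measurable]: "C \<in> sets N"
  shows "AE g in L. emeasure \<kappa> {q. fst q \<in> A \<and> S (- g) (snd q) \<in> C} = emeasure M A * emeasure N C"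
proof -
  interpret M: prob_space M by fact
  interpret N: prob_space N by fact
  interpret L: sigma_finite_measure L by (rule sigma_finite_L)
  interpret PL: pair_sigma_finite M L ..
  note RM = mp_isoD[OF R]
  note [measurable_cong] = sets\<kappa>
  have sp: "space (M \<Otimes>\<^sub>M L) = UNIV" "space (M \<Otimes>\<^sub>M N) = UNIV" by (simp_all add: space_pair_measure spN RM)
  have sp\<kappa>: "space \<kappa> = UNIV" using sets_eq_imp_space_eq[OF sets\<kappa>] sp by simp
  have fstm: "fst \<in> \<kappa> \<rightarrow>\<^sub>M M" by measurable
  have "emeasure \<kappa> (space \<kappa>) = emeasure (distr \<kappa> M fst) (space M)"
    using emeasure_distr[OF fstm sets.top] sp\<kappa> RM(1) by simp
  then have "emeasure \<kappa> (space \<kappa>) = 1" by (simp only: fst\<kappa> M.emeasure_space_1)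
  then interpret \<kappa>: prob_space \<kappa> by (rule prob_spaceI)
  interpret \<kappa>L: pair_sigma_finite \<kappa> L ..
  have sp\<kappa>L: "space (\<kappa> \<Otimes>\<^sub>M L) = UNIV" by (simp add: space_pair_measure sp\<kappa>)
  have R\<kappa>: "mp_iso \<kappa> (rokhlin_ext R \<psi> S)"
  proof -
    have "mp_iso (M \<Otimes>\<^sub>M N) (rokhlin_ext R \<psi> S)"
      by (rule mp_iso_rokhlin_ext[OF _ _ R \<psi> spN S]) unfold_locales
    then show ?thesis
      using inv\<kappa> sp\<kappa> unfolding mp_iso_def measurable_cong_sets[OF sets\<kappa> sets\<kappa>] by blast
  qed
  have [measurable]: "(\<lambda>p. \<psi> (fst p)) \<in> borel_measurable \<kappa>" by measurable
  \<comment> \<open>\<open>\<Psi>\<close> moves the fibre and the group coordinate by the same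
    amount \<open>\<psi>\<close>, so the twisted fibre point \<open>S (- g) y\<close> does not
    change. This makes the weight \<open>w\<close> invariant.\<close>
  define \<Psi> where "\<Psi> = group_ext (rokhlin_ext R \<psi> S) (\<lambda>p. \<psi> (fst p))"
  have \<Psi>: "mp_iso (\<kappa> \<Otimes>\<^sub>M L) \<Psi>"
    unfolding \<Psi>_def by (rule mp_iso_group_ext[OF _ R\<kappa>]) (unfold_locales, measurable)
  note [measurable] = mp_isoD(2)[OF \<Psi>]
  have Smeas[measurable]: "(\<lambda>p. S (- snd p) (snd (fst p))) \<in> \<kappa> \<Otimes>\<^sub>M L \<rightarrow>\<^sub>M N"
    by (rule mp_action_measurable[OF S]) measurable
  define w where "w p = (indicator C (S (- snd p) (snd (fst p))) :: ennreal)" for p :: "('a \<times> 'b) \<times> 'g"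
  have w[measurable]: "w \<in> borel_measurable (\<kappa> \<Otimes>\<^sub>M L)" unfolding w_def by measurable
  have w\<Psi>: "w (\<Psi> p) = w p" for p
  proof -
    have "S (- (\<psi> (fst (fst p)) + snd p)) (S (\<psi> (fst (fst p))) (snd (fst p))) = S (- snd p) (snd (fst p))"
      by (simp add: mp_actionD(3)[OF S, symmetric])
    then show ?thesis by (simp add: w_def \<Psi>_def group_ext_def rokhlin_ext_def split_beta)
  qed
  define \<pi> where "\<pi> p = (fst (fst p), snd p)" for p :: "('a \<times> 'b) \<times> 'g"
  have \<pi>[measurable]: "\<pi> \<in> \<kappa> \<Otimes>\<^sub>M L \<rightarrow>\<^sub>M M \<Otimes>\<^sub>M L" unfolding \<pi>_def by measurable
  have \<pi>\<Psi>: "\<pi> (\<Psi> p) = group_ext R \<psi> (\<pi> p)" for p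
    by (simp add: \<pi>_def \<Psi>_def group_ext_def rokhlin_ext_def split_beta)
  have distr\<pi>: "distr (\<kappa> \<Otimes>\<^sub>M L) (M \<Otimes>\<^sub>M L) \<pi> = M \<Otimes>\<^sub>M L"
  proof -
    have "distr \<kappa> M fst \<Otimes>\<^sub>M distr L L (\<lambda>x. x) = distr (\<kappa> \<Otimes>\<^sub>M L) (M \<Otimes>\<^sub>M L) (\<lambda>(x, y). (fst x, y))"
      by (rule pair_measure_distr) (auto simp: L.sigma_finite_measure_axioms)
    then show ?thesis by (simp add: fst\<kappa> \<pi>_def[abs_def] split_beta')
  qed
  define lam where "lam = distr (density (\<kappa> \<Otimes>\<^sub>M L) w) (M \<Otimes>\<^sub>M L) \<pi>"
  have lam: "emeasure lam E = (\<integral>\<^sup>+p. w p * indicator E (\<pi> p) \<partial>(\<kappa> \<Otimes>\<^sub>M L))" if [measurable]: "E \<in> sets (M \<Otimes>\<^sub>M L)" for E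
  proof -
    have pE: "\<pi> -` E \<in> sets (\<kappa> \<Otimes>\<^sub>M L)" using measurable_sets[OF \<pi> that] by (simp only: sp\<kappa>L Int_UNIV_right)
    have \<pi>d: "\<pi> \<in> density (\<kappa> \<Otimes>\<^sub>M L) w \<rightarrow>\<^sub>M M \<Otimes>\<^sub>M L"
      unfolding measurable_cong_sets[OF sets_density refl] by (rule \<pi>)
    have "emeasure lam E = emeasure (density (\<kappa> \<Otimes>\<^sub>M L) w) (\<pi> -` E)"
      unfolding lam_def emeasure_distr[OF \<pi>d that] by (simp only: space_density sp\<kappa>L Int_UNIV_right)
    also have "\<dots> = (\<integral>\<^sup>+p. w p * indicator (\<pi> -` E) p \<partial>(\<kappa> \<Otimes>\<^sub>M L))" by (rule emeasure_density[OF w pE])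
    also have "\<dots> = (\<integral>\<^sup>+p. w p * indicator E (\<pi> p) \<partial>(\<kappa> \<Otimes>\<^sub>M L))"
      by (intro nn_integral_cong) (simp add: indicator_def)
    finally show ?thesis .
  qed
  have le: "emeasure lam E \<le> emeasure (M \<Otimes>\<^sub>M L) E" if E[measurable]: "E \<in> sets (M \<Otimes>\<^sub>M L)" for E
  proof -
    have "emeasure lam E \<le> (\<integral>\<^sup>+p. indicator E (\<pi> p) \<partial>(\<kappa> \<Otimes>\<^sub>M L))"
      unfolding lam[OF E] by (intro nn_integral_mono) (auto simp: w_def indicator_def)
    also have "\<dots> = (\<integral>\<^sup>+p. indicator E p \<partial>distr (\<kappa> \<Otimes>\<^sub>M L) (M \<Otimes>\<^sub>M L) \<pi>)"
      by (rule nn_integral_distr[symmetric]) measurable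
    finally show ?thesis by (simp only: distr\<pi> nn_integral_indicator[OF E])
  qed
  have iso: "mp_iso (M \<Otimes>\<^sub>M L) (group_ext R \<psi>)"
    by (rule mp_iso_group_ext[OF _ R \<psi>]) unfold_locales
  note [measurable] = mp_isoD(2)[OF iso]
  have sets_lam: "sets lam = sets (M \<Otimes>\<^sub>M L)" by (simp add: lam_def)
  have "distr lam lam (group_ext R \<psi>) = lam"
  proof (rule measure_eqI)
    fix E assume "E \<in> sets (distr lam lam (group_ext R \<psi>))"
    then have E[measurable]: "E \<in> sets (M \<Otimes>\<^sub>M L)" by (simp add: sets_lam)
    have gl: "group_ext R \<psi> \<in> lam \<rightarrow>\<^sub>M lam"
      unfolding measurable_cong_sets[OF sets_lam sets_lam] by (rule mp_isoD(2)[OF iso])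
    have "E \<in> sets lam" by (simp only: sets_lam E)
    then have "emeasure (distr lam lam (group_ext R \<psi>)) E = emeasure lam (group_ext R \<psi> -` E \<inter> space lam)"
      by (rule emeasure_distr[OF gl])
    also have "group_ext R \<psi> -` E \<inter> space lam = group_ext R \<psi> -` E \<inter> space (M \<Otimes>\<^sub>M L)"
      using sets_eq_imp_space_eq[OF sets_lam] by simp
    also have "emeasure lam \<dots> = (\<integral>\<^sup>+p. w (\<Psi> p) * indicator E (\<pi> (\<Psi> p)) \<partial>(\<kappa> \<Otimes>\<^sub>M L))"
      by (subst lam, measurable) (intro nn_integral_cong, simp add: w\<Psi> \<pi>\<Psi> sp indicator_def)
    also have "\<dots> = (\<integral>\<^sup>+p. w p * indicator E (\<pi> p) \<partial>distr (\<kappa> \<Otimes>\<^sub>M L) (\<kappa> \<Otimes>\<^sub>M L) \<Psi>)"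
      by (rule nn_integral_distr[symmetric]) measurable
    also have "\<dots> = emeasure lam E" by (simp only: mp_isoD(3)[OF \<Psi>] lam[OF E])
    finally show "emeasure (distr lam lam (group_ext R \<psi>)) E = emeasure lam E" .
  qed simp
  then obtain c where c: "\<And>E. E \<in> sets (M \<Otimes>\<^sub>M L) \<Longrightarrow> emeasure lam E = c * emeasure (M \<Otimes>\<^sub>M L) E"
    using invariant_measure_le_ergodic[OF PL.sigma_finite_measure_axioms iso erg sets_lam _ le] by blast
  define h where "h A g = emeasure \<kappa> {q. fst q \<in> A \<and> S (- g) (snd q) \<in> C}" for A g
  have h_eq: "h A g = (\<integral>\<^sup>+q. w (q, g) * indicator A (fst q) \<partial>\<kappa>)"
    and h_meas: "h A \<in> borel_measurable L" if [measurable]: "A \<in> sets M" for A g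
  proof -
    have "(\<lambda>q. S (- g) (snd q)) \<in> \<kappa> \<rightarrow>\<^sub>M N" for g
      by (rule mp_action_measurable[OF S]) measurable
    then have "{q\<in>space \<kappa>. fst q \<in> A \<and> S (- g) (snd q) \<in> C} \<in> sets \<kappa>" for g by measurable
    then show eq: "h A g = (\<integral>\<^sup>+q. w (q, g) * indicator A (fst q) \<partial>\<kappa>)" for g
      by (simp add: h_def sp\<kappa> w_def flip: nn_integral_indicator) (intro nn_integral_cong, auto simp: indicator_def)
    show "h A \<in> borel_measurable L"
    proof -
      have "h A = (\<lambda>g. \<integral>\<^sup>+q. w (q, g) * indicator A (fst q) \<partial>\<kappa>)" by (rule ext) (rule eq)
      also have "\<dots> \<in> borel_measurable L" by measurable
      finally show ?thesis .
    qed
  qed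
  have hB: "(\<integral>\<^sup>+g. h A g * indicator B g \<partial>L) = c * (emeasure M A * emeasure L B)"
    if [measurable]: "A \<in> sets M" "B \<in> sets borel" for A B
  proof -
    have "(\<integral>\<^sup>+g. h A g * indicator B g \<partial>L) = (\<integral>\<^sup>+g. \<integral>\<^sup>+q. w (q, g) * indicator (A \<times> B) (\<pi> (q, g)) \<partial>\<kappa> \<partial>L)"
    proof (rule nn_integral_cong)
      fix g
      show "h A g * indicator B g = (\<integral>\<^sup>+q. w (q, g) * indicator (A \<times> B) (\<pi> (q, g)) \<partial>\<kappa>)"
        by (cases "g \<in> B") (auto simp: h_eq \<pi>_def indicator_def intro!: nn_integral_cong)
    qed
    also have "\<dots> = emeasure lam (A \<times> B)"
    proof -
      have AB: "A \<times> B \<in> sets (M \<Otimes>\<^sub>M L)" using that by (intro pair_measureI) simp_all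
      have "(\<lambda>p. w p * indicator (A \<times> B) (\<pi> p)) \<in> borel_measurable (\<kappa> \<Otimes>\<^sub>M L)"
        by (intro borel_measurable_times_ennreal w measurable_compose[OF \<pi> borel_measurable_indicator[OF AB]])
      from \<kappa>L.nn_integral_snd[OF this] show ?thesis unfolding lam[OF AB] by simp
    qed
    also have "\<dots> = c * (emeasure M A * emeasure L B)"
      by (subst c) (auto simp: L.emeasure_pair_measure_Times)
    finally show ?thesis .
  qed
  obtain B where B: "B \<in> sets borel" "0 < emeasure L B" "emeasure L B < \<infinity>"
    using finite_positive_set_exists by blast
  \<comment> \<open>With \<open>A\<close> the whole space only the second marginal matters, and it
    is invariant under \<open>S (- g)\<close>. The resulting value identifies the unknown
    proportionality constant \<open>c\<close>.\<close>
  have hU: "h (space M) g = emeasure N C" for g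
  proof -
    have sndm: "snd \<in> \<kappa> \<rightarrow>\<^sub>M N" by measurable
    have X: "S (- g) -` C \<in> sets N"
      using measurable_sets[OF mp_actionD(4)[OF S] C] by (simp only: spN Int_UNIV_right)
    have "h (space M) g = emeasure \<kappa> (snd -` (S (- g) -` C) \<inter> space \<kappa>)"
      unfolding h_def by (rule arg_cong[where f = "emeasure \<kappa>"]) (auto simp: RM sp\<kappa>)
    also have "\<dots> = emeasure (distr \<kappa> N snd) (S (- g) -` C)" by (rule emeasure_distr[OF sndm X, symmetric])
    also have "\<dots> = emeasure N (S (- g) -` C \<inter> space N)" by (simp only: snd\<kappa> spN Int_UNIV_right)
    also have "\<dots> = emeasure (distr N N (S (- g))) C" by (rule emeasure_distr[OF mp_actionD(4)[OF S] C, symmetric])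
    finally show ?thesis by (simp add: mp_actionD(5)[OF S])
  qed
  have eqc: "emeasure N C * emeasure L B = c * emeasure L B"
    using hB[of "space M" B] B by (simp add: hU nn_integral_cmult M.emeasure_space_1)
  have cC: "c = emeasure N C"
    using arg_cong[OF eqc, of "\<lambda>x. x / emeasure L B"] B by (simp add: ennreal_mult_divide_eq less_top)
  have "AE g in L. h A g = emeasure M A * emeasure N C"
  proof (rule L.density_unique2)
    fix B assume "B \<in> sets L"
    then have Bb: "B \<in> sets borel" by simp
    have "(\<integral>\<^sup>+g\<in>B. emeasure M A * emeasure N C \<partial>L) = emeasure M A * emeasure N C * emeasure L B"
      by (rule nn_integral_cmult_indicator) fact
    also have "\<dots> = c * (emeasure M A * emeasure L B)" by (simp only: cC ac_simps)
    finally show "(\<integral>\<^sup>+g\<in>B. h A g \<partial>L) = (\<integral>\<^sup>+g\<in>B. emeasure M A * emeasure N C \<partial>L)"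
      using hB[OF A Bb] by (simp only:)
  qed (use h_meas[OF A] in auto)
  then show ?thesis by (simp add: h_def)
qed

text \<open>The exceptional null set of group elements depends on the fibre set, so a single good
  \<open>g\<close> is chosen for a countable generator. For this \<open>g\<close> the twisted
  joining is a product, and \<open>S\<close>-invariance of \<open>N\<close> removes the
  twist.\<close>

lemma rokhlin_joining_unique:
  fixes N :: "'y::second_countable_topology measure"
  assumes prM: "prob_space M" and R: "mp_iso M R" and \<psi>: "\<psi> \<in> borel_measurable M"
    and erg: "ergodic_map (M \<Otimes>\<^sub>M L) (group_ext R \<psi>)"
    and prN: "prob_space N" and setsN: "sets N = sets borel" and S: "mp_action N S"
    and sets\<kappa>: "sets \<kappa> = sets (M \<Otimes>\<^sub>M N)" and fst\<kappa>: "distr \<kappa> M fst = M" and snd\<kappa>: "distr \<kappa> N snd = N"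
    and inv\<kappa>: "distr \<kappa> \<kappa> (rokhlin_ext R \<psi> S) = \<kappa>"
  shows "\<kappa> = M \<Otimes>\<^sub>M N"
proof (rule sym, rule pair_measure_eqI)
  interpret M: prob_space M by fact
  interpret N: prob_space N by fact
  show "sigma_finite_measure M" "sigma_finite_measure N" by unfold_locales
  show "sets (M \<Otimes>\<^sub>M N) = sets \<kappa>" by (simp add: sets\<kappa>)
  have spN: "space N = UNIV" using sets_eq_imp_space_eq[OF setsN] by simp
  have sp\<kappa>: "space \<kappa> = UNIV" using sets_eq_imp_space_eq[OF sets\<kappa>] mp_isoD(1)[OF R] spN by (simp add: space_pair_measure)
  note [measurable_cong] = sets\<kappa>
  obtain G :: "'y set set" where G: "countable G" "Int_stable G" "UNIV \<in> G" "G \<subseteq> sets borel"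
    "sets borel = sigma_sets UNIV G"
    using countable_Int_stable_generator by blast
  fix A C assume A[measurable]: "A \<in> sets M" and C: "C \<in> sets N"
  have "AE g in L. emeasure \<kappa> {q. fst q \<in> A \<and> S (- g) (snd q) \<in> B} = emeasure M A * emeasure N B" if "B \<in> G" for B
    using that G(4) setsN
    by (intro rokhlin_joining_twisted_disintegration[OF prM R \<psi> erg prN spN S sets\<kappa> fst\<kappa> snd\<kappa> inv\<kappa> A]) auto
  then have "AE g in L. \<forall>B\<in>G. emeasure \<kappa> {q. fst q \<in> A \<and> S (- g) (snd q) \<in> B} = emeasure M A * emeasure N B"
    using G(1) by (simp add: AE_ball_countable)
  then have "\<exists>g. \<forall>B\<in>G. emeasure \<kappa> {q. fst q \<in> A \<and> S (- g) (snd q) \<in> B} = emeasure M A * emeasure N B"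
    by (rule AE_L_ex)
  then obtain g where g: "\<And>B. B \<in> G \<Longrightarrow> emeasure \<kappa> {q. fst q \<in> A \<and> S (- g) (snd q) \<in> B} = emeasure M A * emeasure N B"
    by blast
  have Sg[measurable]: "(\<lambda>q. S (- g) (snd q)) \<in> \<kappa> \<rightarrow>\<^sub>M N" by (rule mp_action_measurable[OF S]) measurable
  define m1 where "m1 = distr (density \<kappa> (\<lambda>q. indicator A (fst q))) N (\<lambda>q. S (- g) (snd q))"
  define m2 where "m2 = density N (\<lambda>_. emeasure M A)"
  have m1: "emeasure m1 B = emeasure \<kappa> {q. fst q \<in> A \<and> S (- g) (snd q) \<in> B}" if [measurable]: "B \<in> sets N" for B
  proof -
    have *: "(\<lambda>q. S (- g) (snd q)) -` B \<in> sets \<kappa>" using measurable_sets[OF Sg that] sp\<kappa> by simp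
    have "{q\<in>space \<kappa>. fst q \<in> A \<and> S (- g) (snd q) \<in> B} \<in> sets \<kappa>" by measurable
    then have B': "{q. fst q \<in> A \<and> S (- g) (snd q) \<in> B} \<in> sets \<kappa>" by (simp add: sp\<kappa>)
    have Sd: "(\<lambda>q. S (- g) (snd q)) \<in> density \<kappa> (\<lambda>q. indicator A (fst q)) \<rightarrow>\<^sub>M N"
      unfolding measurable_cong_sets[OF sets_density refl] by (rule Sg)
    have "emeasure m1 B = emeasure (density \<kappa> (\<lambda>q. indicator A (fst q))) ((\<lambda>q. S (- g) (snd q)) -` B)"
      unfolding m1_def emeasure_distr[OF Sd that] by (simp only: space_density sp\<kappa> Int_UNIV_right)
    also have "\<dots> = (\<integral>\<^sup>+q. indicator A (fst q) * indicator ((\<lambda>q. S (- g) (snd q)) -` B) q \<partial>\<kappa>)"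
      by (rule emeasure_density[OF _ *]) measurable
    also have "\<dots> = (\<integral>\<^sup>+q. indicator {q. fst q \<in> A \<and> S (- g) (snd q) \<in> B} q \<partial>\<kappa>)"
      by (intro nn_integral_cong) (auto simp: indicator_def)
    also have "\<dots> = emeasure \<kappa> {q. fst q \<in> A \<and> S (- g) (snd q) \<in> B}" by (rule nn_integral_indicator[OF B'])
    finally show ?thesis .
  qed
  have m2: "emeasure m2 B = emeasure M A * emeasure N B" if "B \<in> sets N" for B
    using that by (simp add: m2_def emeasure_density nn_integral_cmult)
  have "m1 = m2"
  proof (rule measure_eqI_generator_eq[OF G(2), of UNIV m1 m2 "\<lambda>_. UNIV"])
    show "sets m1 = sigma_sets UNIV G" "sets m2 = sigma_sets UNIV G"
      using G(5) setsN by (simp_all add: m1_def m2_def)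
    fix B assume "B \<in> G"
    then show "emeasure m1 B = emeasure m2 B" using G(4) setsN g[of B] m1[of B] m2[of B] by auto
  next
    show "emeasure m1 UNIV \<noteq> \<infinity>" for i :: nat
      using g[OF G(3)] m1[of UNIV] setsN M.emeasure_finite[of A] N.emeasure_finite[of UNIV]
      by (simp add: ennreal_mult_eq_top_iff)
  qed (use G in auto)
  \<comment> \<open>Chosen so that \<open>S (- g) y \<in> C'\<close> exactly when
    \<open>y \<in> C\<close>.\<close>
  define C' where "C' = S g -` C"
  have C': "C' \<in> sets N" using measurable_sets[OF mp_actionD(4)[OF S, of g] C] spN by (simp add: C'_def)
  have "emeasure \<kappa> (A \<times> C) = emeasure m1 C'"
    unfolding m1[OF C'] by (rule arg_cong[where f = "emeasure \<kappa>"]) (auto simp: C'_def mp_action_uminus[OF S])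
  also have "\<dots> = emeasure M A * emeasure N C'" by (simp only: \<open>m1 = m2\<close> m2[OF C'])
  also have "emeasure N C' = emeasure (distr N N (S g)) C"
    unfolding emeasure_distr[OF mp_actionD(4)[OF S] C] by (simp only: C'_def spN Int_UNIV_right)
  finally show "emeasure M A * emeasure N C = emeasure \<kappa> (A \<times> C)" by (simp add: mp_actionD(5)[OF S])
qed

section \<open>Translation eigenfunctions and continuous characters\<close>

lemma AE_zero_if_rectangle_integrals_zero_real:
  fixes f :: "'z \<times> 'g \<Rightarrow> real"
  assumes "sigma_finite_measure M" and f: "f \<in> borel_measurable (M \<Otimes>\<^sub>M L)"
    and bd: "\<And>p. \<bar>f p\<bar> \<le> C"
    and zero: "\<And>E K. E \<in> fmeasurable M \<Longrightarrow> compact K \<Longrightarrow> (\<integral>p. indicator (E \<times> K) p * f p \<partial>(M \<Otimes>\<^sub>M L)) = 0"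
  shows "AE p in M \<Otimes>\<^sub>M L. f p = 0"
proof -
  obtain K :: "nat \<Rightarrow> 'g set" where K: "\<And>n. compact (K n)" "(\<Union>n. K n) = UNIV"
    using sigma_compact by auto
  show ?thesis
  proof (rule AE_zero_if_rectangle_integrals_zero[OF assms(1) sigma_finite_L, where K = "\<lambda>n. \<Union>i\<le>n. K i"])
    show "Int_stable {K :: 'g set. compact K}" by (rule Int_stable_compact)
    show "{K. compact K} \<subseteq> fmeasurable L"
      using emeasure_L_compact borel_compact by (auto simp: fmeasurable_def)
    show "sets L = sigma_sets (space L) {K. compact K}" by (simp add: borel_eq_compact)
    show "range (\<lambda>n. \<Union>i\<le>n. K i) \<subseteq> {K. compact K}" using K(1) by (auto intro!: compact_UN)
    have "(\<Union>n. K n) \<subseteq> (\<Union>n. \<Union>i\<le>n. K i)" by (intro UN_mono) auto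
    then show "(\<Union>n. \<Union>i\<le>n. K i) = space L" using K(2) by (simp add: top.extremum_unique)
    show "incseq (\<lambda>n. \<Union>i\<le>n. K i)" unfolding incseq_def by (intro allI impI UN_mono) auto
  qed (use f bd zero in auto)
qed

lemma rectangle_integral_nonzero_exists:
  fixes f :: "'z \<times> 'g \<Rightarrow> complex"
  assumes "sigma_finite_measure M" and [measurable]: "f \<in> borel_measurable (M \<Otimes>\<^sub>M L)"
    and bd: "\<And>p. cmod (f p) \<le> C" and nz: "\<not> (AE p in M \<Otimes>\<^sub>M L. f p = 0)"
  shows "\<exists>E\<in>fmeasurable M. \<exists>K. compact K \<and> E \<times> K \<in> fmeasurable (M \<Otimes>\<^sub>M L) \<and>
    (\<integral>p. indicator (E \<times> K) p * f p \<partial>(M \<Otimes>\<^sub>M L)) \<noteq> 0"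
proof (rule ccontr)
  interpret M: sigma_finite_measure M by fact
  interpret L: sigma_finite_measure L by (rule sigma_finite_L)
  have rect: "E \<times> K \<in> fmeasurable (M \<Otimes>\<^sub>M L)" if "E \<in> fmeasurable M" "compact K" for E K
  proof -
    have "emeasure (M \<Otimes>\<^sub>M L) (E \<times> K) = emeasure M E * emeasure L K"
      using that borel_compact by (intro L.emeasure_pair_measure_Times) auto
    also have "\<dots> < \<infinity>"
      using that emeasure_L_compact[of K] by (auto simp: fmeasurable_def ennreal_mult_less_top)
    finally show ?thesis using that borel_compact by (intro fmeasurableI pair_measureI) auto
  qed
  assume "\<not> ?thesis"
  then have zero: "(\<integral>p. indicator (E \<times> K) p * f p \<partial>(M \<Otimes>\<^sub>M L)) = 0" if "E \<in> fmeasurable M" "compact K" for E K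
    using that rect by blast
  have int: "integrable (M \<Otimes>\<^sub>M L) (\<lambda>p. indicator (E \<times> K) p * f p)" if EK: "E \<in> fmeasurable M" "compact K" for E K
  proof -
    have [measurable]: "E \<times> K \<in> sets (M \<Otimes>\<^sub>M L)" using rect[OF EK] by auto
    have "integrable (M \<Otimes>\<^sub>M L) (\<lambda>p. C * indicator (E \<times> K) p)"
      using rect[OF EK] by (auto simp: fmeasurable_def)
    then show ?thesis
      by (rule Bochner_Integration.integrable_bound) (use bd in \<open>auto simp: indicator_def intro: order_trans[OF _ abs_ge_self]\<close>)
  qed
  have "AE p in M \<Otimes>\<^sub>M L. Re (f p) = 0"
  proof (rule AE_zero_if_rectangle_integrals_zero_real[OF assms(1)])
    show "\<bar>Re (f p)\<bar> \<le> C" for p using bd[of p] abs_Re_le_cmod order_trans by blast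
    fix E and K :: "'g set" assume EK: "E \<in> fmeasurable M" "compact K"
    have "(\<integral>p. indicator (E \<times> K) p * Re (f p) \<partial>(M \<Otimes>\<^sub>M L)) = (\<integral>p. Re (indicator (E \<times> K) p * f p) \<partial>(M \<Otimes>\<^sub>M L))"
      by (intro Bochner_Integration.integral_cong) (auto simp: indicator_def)
    also have "\<dots> = Re (\<integral>p. indicator (E \<times> K) p * f p \<partial>(M \<Otimes>\<^sub>M L))" by (rule integral_Re[OF int[OF EK]])
    also have "\<dots> = 0" by (simp only: zero[OF EK] zero_complex.sel)
    finally show "(\<integral>p. indicator (E \<times> K) p * Re (f p) \<partial>(M \<Otimes>\<^sub>M L)) = 0" .
  qed measurable
  moreover have "AE p in M \<Otimes>\<^sub>M L. Im (f p) = 0"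
  proof (rule AE_zero_if_rectangle_integrals_zero_real[OF assms(1)])
    show "\<bar>Im (f p)\<bar> \<le> C" for p using bd[of p] abs_Im_le_cmod order_trans by blast
    fix E and K :: "'g set" assume EK: "E \<in> fmeasurable M" "compact K"
    have "(\<integral>p. indicator (E \<times> K) p * Im (f p) \<partial>(M \<Otimes>\<^sub>M L)) = (\<integral>p. Im (indicator (E \<times> K) p * f p) \<partial>(M \<Otimes>\<^sub>M L))"
      by (intro Bochner_Integration.integral_cong) (auto simp: indicator_def)
    also have "\<dots> = Im (\<integral>p. indicator (E \<times> K) p * f p \<partial>(M \<Otimes>\<^sub>M L))" by (rule integral_Im[OF int[OF EK]])
    also have "\<dots> = 0" by (simp only: zero[OF EK] zero_complex.sel)
    finally show "(\<integral>p. indicator (E \<times> K) p * Im (f p) \<partial>(M \<Otimes>\<^sub>M L)) = 0" .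
  qed measurable
  ultimately have "AE p in M \<Otimes>\<^sub>M L. f p = 0"
    by eventually_elim (simp add: complex_eq_iff)
  with nz show False by simp
qed

lemma integral_translation:
  fixes f :: "'z \<times> 'g \<Rightarrow> complex"
  assumes "sigma_finite_measure M" "space M = UNIV" and [measurable]: "f \<in> borel_measurable (M \<Otimes>\<^sub>M L)"
  shows "(\<integral>p. f (fst p, h + snd p) \<partial>(M \<Otimes>\<^sub>M L)) = (\<integral>p. f p \<partial>(M \<Otimes>\<^sub>M L))"
proof -
  note iso = mp_iso_translation[OF assms(1,2), of h]
  have "(\<integral>p. f p \<partial>distr (M \<Otimes>\<^sub>M L) (M \<Otimes>\<^sub>M L) (\<lambda>p. (fst p, h + snd p))) = (\<integral>p. f (fst p, h + snd p) \<partial>(M \<Otimes>\<^sub>M L))"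
    using mp_isoD(2)[OF iso] by (intro integral_distr) auto
  then show ?thesis by (simp add: mp_isoD(3)[OF iso])
qed

text \<open>Multiplicativity is forced because \<open>f\<close> is not null. For continuity, a
  rectangle \<open>E \<times> K\<close> with nonzero integral is translated: its integral is
  multiplied by \<open>ch h\<close>, yet changes little for small \<open>h\<close> as
  \<open>f\<close> is bounded. Continuity at 0 spreads by multiplicativity.\<close>

lemma translation_eigenfunction_character:
  fixes f :: "'z \<times> 'g \<Rightarrow> complex"
  assumes sf: "sigma_finite_measure M" and spM: "space M = UNIV" and f[measurable]: "f \<in> borel_measurable (M \<Otimes>\<^sub>M L)"
    and bd: "\<And>p. cmod (f p) \<le> C" and nz: "\<not> (AE p in M \<Otimes>\<^sub>M L. f p = 0)"
    and eig: "\<And>h. AE p in M \<Otimes>\<^sub>M L. f (fst p, h + snd p) = ch h * f p"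
    and norm1: "\<And>h. cmod (ch h) = 1"
  shows "cont_character ch"
proof -
  interpret M: sigma_finite_measure M by fact
  interpret L: sigma_finite_measure L by (rule sigma_finite_L)
  interpret PL: pair_sigma_finite M L ..
  have hom: "ch (g + h) = ch g * ch h" for g h
  proof (rule ccontr)
    assume ne: "ch (g + h) \<noteq> ch g * ch h"
    have "AE p in M \<Otimes>\<^sub>M L. f (fst p, g + (h + snd p)) = ch g * f (fst p, h + snd p)"
      using mp_iso_AE[OF mp_iso_translation[OF sf spM, of h] eig[of g]] by simp
    then have "AE p in M \<Otimes>\<^sub>M L. f p = 0"
      using eig[of h] eig[of "g + h"] by eventually_elim (use ne in \<open>auto simp: add.assoc\<close>)
    with nz show False by simp
  qed
  have C: "0 \<le> C" using bd[of undefined] norm_ge_zero order_trans by blast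
  obtain E K where E: "E \<in> fmeasurable M" and K: "compact K" and EK: "E \<times> K \<in> fmeasurable (M \<Otimes>\<^sub>M L)"
    and u0: "(\<integral>p. indicator (E \<times> K) p * f p \<partial>(M \<Otimes>\<^sub>M L)) \<noteq> 0"
    using rectangle_integral_nonzero_exists[OF sf f bd nz] by blast
  define u where "u A = (\<integral>p. indicator A p * f p \<partial>(M \<Otimes>\<^sub>M L))" for A
  let ?Kh = "\<lambda>h. (\<lambda>x. h + x) ` K"
  have [measurable]: "K \<in> sets borel" "?Kh h \<in> sets borel" for h
    using borel_compact K compact_translate[OF K] by auto
  have [measurable]: "E \<in> sets M" using E by auto
  have uh: "u (E \<times> ?Kh h) = ch h * u (E \<times> K)" for h
  proof -
    have "u (E \<times> ?Kh h) = (\<integral>p. indicator (E \<times> ?Kh h) (fst p, h + snd p) * f (fst p, h + snd p) \<partial>(M \<Otimes>\<^sub>M L))"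
      unfolding u_def by (rule integral_translation[OF sf spM, symmetric]) measurable
    also have "\<dots> = (\<integral>p. ch h * (indicator (E \<times> K) p * f p) \<partial>(M \<Otimes>\<^sub>M L))"
    proof (rule Bochner_Integration.integral_cong_AE)
      show "AE p in M \<Otimes>\<^sub>M L. indicator (E \<times> ?Kh h) (fst p, h + snd p) * f (fst p, h + snd p) =
          ch h * (indicator (E \<times> K) p * f p)"
        using eig[of h] by eventually_elim (auto simp: indicator_def)
      show "(\<lambda>p. indicator (E \<times> ?Kh h) (fst p, h + snd p) * f (fst p, h + snd p)) \<in> borel_measurable (M \<Otimes>\<^sub>M L)"
        by measurable
    qed measurable
    finally show ?thesis by (simp add: u_def)
  qed
  have diff: "cmod (ch h - 1) * cmod (u (E \<times> K)) \<le>
      C * (measure M E * (measure L (?Kh h - K) + measure L (?Kh (- h) - K)))" for h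
  proof -
    have finL: "emeasure L (?Kh h - K) < \<infinity>" "emeasure L (K - ?Kh h) < \<infinity>" for h
      using emeasure_finite_subset_compact[of "?Kh h - K" "?Kh h"] emeasure_finite_subset_compact[of "K - ?Kh h" K]
        K compact_translate[OF K] by auto
    have fm: "E \<times> B \<in> fmeasurable (M \<Otimes>\<^sub>M L)" and ms: "measure (M \<Otimes>\<^sub>M L) (E \<times> B) = measure M E * measure L B"
      if "B \<in> sets borel" "emeasure L B < \<infinity>" for B
    proof -
      have eq: "emeasure (M \<Otimes>\<^sub>M L) (E \<times> B) = emeasure M E * emeasure L B"
        using that E by (intro L.emeasure_pair_measure_Times) auto
      then show "measure (M \<Otimes>\<^sub>M L) (E \<times> B) = measure M E * measure L B"
        by (simp add: measure_def enn2real_mult)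
      show "E \<times> B \<in> fmeasurable (M \<Otimes>\<^sub>M L)"
        using that E eq by (intro fmeasurableI pair_measureI) (auto simp: fmeasurable_def ennreal_mult_less_top)
    qed
    have fmh: "E \<times> ?Kh h \<in> fmeasurable (M \<Otimes>\<^sub>M L)"
      using emeasure_L_compact[OF compact_translate[OF K]] by (intro fm) auto
    define A where "A = E \<times> ?Kh h"
    define B where "B = E \<times> K"
    have [measurable]: "A \<in> sets (M \<Otimes>\<^sub>M L)" "B \<in> sets (M \<Otimes>\<^sub>M L)" by (auto simp: A_def B_def)
    have AB: "A - B = E \<times> (?Kh h - K)" "B - A = E \<times> (K - ?Kh h)" by (auto simp: A_def B_def)
    have int: "integrable (M \<Otimes>\<^sub>M L) (\<lambda>p. indicator A p * f p)"
      if "A \<in> fmeasurable (M \<Otimes>\<^sub>M L)" for A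
    proof -
      have [measurable]: "A \<in> sets (M \<Otimes>\<^sub>M L)" using that by auto
      have "integrable (M \<Otimes>\<^sub>M L) (\<lambda>p. C * indicator A p)" using that by (auto simp: fmeasurable_def)
      then show ?thesis
        by (rule Bochner_Integration.integrable_bound) (use bd C in \<open>auto simp: indicator_def\<close>)
    qed
    have "u A - u B = (\<integral>p. indicator A p * f p - indicator B p * f p \<partial>(M \<Otimes>\<^sub>M L))"
      unfolding u_def using fmh EK by (intro Bochner_Integration.integral_diff[symmetric] int) (auto simp: A_def B_def)
    also have "cmod \<dots> \<le> (\<integral>p. C * indicator (A - B) p + C * indicator (B - A) p \<partial>(M \<Otimes>\<^sub>M L))"
    proof (rule norm_integral_le_AE)
      show "integrable (M \<Otimes>\<^sub>M L) (\<lambda>p. indicator A p * f p - indicator B p * f p)"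
        using fmh EK by (intro Bochner_Integration.integrable_diff int) (auto simp: A_def B_def)
      show "integrable (M \<Otimes>\<^sub>M L) (\<lambda>p. C * indicator (A - B) p + C * indicator (B - A) p)"
        unfolding AB using fm[OF _ finL(1)[of h]] fm[OF _ finL(2)[of h]]
        by (auto simp: fmeasurable_def)
    qed (use bd in \<open>auto simp: indicator_def\<close>)
    also have "\<dots> = C * measure (M \<Otimes>\<^sub>M L) (A - B) + C * measure (M \<Otimes>\<^sub>M L) (B - A)"
      unfolding AB using fm[OF _ finL(1)[of h]] fm[OF _ finL(2)[of h]]
      by (subst Bochner_Integration.integral_add) (auto simp: fmeasurable_def)
    also have "\<dots> = C * (measure M E * (measure L (?Kh h - K) + measure L (K - ?Kh h)))"
    proof -
      have "?Kh h - K \<in> sets borel" "K - ?Kh h \<in> sets borel" by measurable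
      then show ?thesis unfolding AB by (simp only: ms finL distrib_left)
    qed
    \<comment> \<open>The other half of the symmetric difference is a translate of the same kind of
      set for \<open>- h\<close>, so one smallness estimate serves both halves.\<close>
    also have "measure L (K - ?Kh h) = measure L (?Kh (- h) - K)"
    proof -
      have "(\<lambda>x. - h + x) ` (K - ?Kh h) = ?Kh (- h) - K"
      proof (intro equalityI subsetI)
        fix x assume "x \<in> ?Kh (- h) - K"
        then obtain k where k: "k \<in> K" "x = - h + k" "x \<notin> K" by auto
        moreover have "k \<notin> ?Kh h"
        proof
          assume "k \<in> ?Kh h"
          then obtain k' where "k' \<in> K" "k = h + k'" by auto
          then have "x = k'" using k by simp
          then show False using k \<open>k' \<in> K\<close> by simp
        qed
        ultimately show "x \<in> (\<lambda>x. - h + x) ` (K - ?Kh h)" by blast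
      next
        fix x assume "x \<in> (\<lambda>x. - h + x) ` (K - ?Kh h)"
        then obtain k where k: "k \<in> K" "k \<notin> ?Kh h" "x = - h + k" by auto
        have "x \<notin> K"
        proof
          assume "x \<in> K"
          then have "h + x \<in> ?Kh h" by blast
          then show False using k by simp
        qed
        then show "x \<in> ?Kh (- h) - K" using k by auto
      qed
      then show ?thesis
        using emeasure_L_image[of "K - ?Kh h" "- h"] by (simp add: measure_def)
    qed
    finally have "cmod (u A - u B) \<le> C * (measure M E * (measure L (?Kh h - K) + measure L (?Kh (- h) - K)))" .
    moreover have "u A - u B = (ch h - 1) * u (E \<times> K)" using uh[of h] by (simp add: A_def B_def algebra_simps)
    ultimately show ?thesis by (simp add: norm_mult)
  qed
  have near1: "\<exists>V. open V \<and> 0 \<in> V \<and> (\<forall>h\<in>V. cmod (ch h - 1) < e)" if e: "e > 0" for e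
  proof -
    \<comment> \<open>Chosen so that \<open>(C * measure M E + 1) * (2 * d)\<close> equals
      \<open>e\<close> times the modulus of the reference integral; the 1 keeps the denominator
      positive.\<close>
    define d where "d = e * cmod (u (E \<times> K)) / (2 * (C * measure M E + 1))"
    have C1: "C * measure M E + 1 > 0" using C by (simp add: add_nonneg_pos)
    have uK: "cmod (u (E \<times> K)) > 0" using u0 by (simp add: u_def)
    have d: "d > 0" unfolding d_def using e uK C1 by simp
    obtain V where V: "open V" "0 \<in> V" "\<And>h. h \<in> V \<Longrightarrow> measure L (?Kh h - K) < d"
      using measure_translate_diff_small[OF K d] by blast
    \<comment> \<open>Symmetrised, because the estimate involves both \<open>h\<close> and
      \<open>- h\<close>.\<close>
    let ?V = "V \<inter> uminus -` V"
    have "open (uminus -` V)" using V(1) by (rule open_vimage) (intro continuous_intros)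
    then have "open ?V" using V(1) by auto
    moreover have "cmod (ch h - 1) < e" if h: "h \<in> ?V" for h
    proof -
      have "cmod (ch h - 1) * cmod (u (E \<times> K)) \<le>
        (C * measure M E) * (measure L (?Kh h - K) + measure L (?Kh (- h) - K))"
        using diff[of h] by (simp add: mult.assoc)
      also have "\<dots> \<le> (C * measure M E) * (2 * d)"
        using V(3)[of h] V(3)[of "- h"] h C by (intro mult_left_mono) auto
      also have "\<dots> < (C * measure M E + 1) * (2 * d)" using d by simp
      also have "\<dots> = e * cmod (u (E \<times> K))"
      proof -
        have "x * (2 * (y / (2 * x))) = y" if "x > 0" for x y :: real using that by simp
        from this[OF C1] show ?thesis unfolding d_def .
      qed
      finally show ?thesis using uK by simp
    qed
    ultimately show ?thesis using V(2) by (intro exI[of _ ?V]) auto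
  qed
  have "continuous_on UNIV ch"
    unfolding continuous_on_def
  proof
    fix g
    show "(ch \<longlongrightarrow> ch g) (at g within UNIV)"
    proof (rule tendstoI)
      fix e :: real assume "e > 0"
      from near1[OF this] obtain V where V: "open V" "0 \<in> V" "\<And>h. h \<in> V \<Longrightarrow> cmod (ch h - 1) < e" by blast
      have "open ((\<lambda>x. x - g) -` V)" using V(1) by (rule open_vimage) (intro continuous_intros)
      moreover have "dist (ch x) (ch g) < e" if "x \<in> (\<lambda>x. x - g) -` V" for x
      proof -
        have "ch x = ch g * ch (x - g)" using hom[of g "x - g"] by simp
        then have "ch x - ch g = ch g * (ch (x - g) - 1)" by (simp add: algebra_simps)
        then show ?thesis using V(3)[of "x - g"] that norm1[of g] by (simp add: dist_norm norm_mult)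
      qed
      ultimately show "\<forall>\<^sub>F x in at g within UNIV. dist (ch x) (ch g) < e"
        unfolding eventually_at_topological using V(2) by (intro exI[of _ "(\<lambda>x. x - g) -` V"]) auto
    qed
  qed
  then show ?thesis using hom norm1 by (simp add: cont_character_def)
qed

text \<open>Dividing out the character leaves a function invariant under each translation up to a
  null set that depends on the translation; Fubini makes it independent of the group
  coordinate.\<close>

lemma translation_eigenfunction_factor:
  fixes f :: "'z \<times> 'g \<Rightarrow> complex"
  assumes sf: "sigma_finite_measure M" and spM: "space M = UNIV" and f[measurable]: "f \<in> borel_measurable (M \<Otimes>\<^sub>M L)"
    and bd: "\<And>p. cmod (f p) \<le> C"
    and eig: "\<And>h. AE p in M \<Otimes>\<^sub>M L. f (fst p, h + snd p) = ch h * f p"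
    and chr: "cont_character ch"
  shows "\<exists>v\<in>borel_measurable M. (\<forall>z. cmod (v z) \<le> C) \<and> (AE p in M \<Otimes>\<^sub>M L. f p = ch (snd p) * v (fst p))"
proof -
  interpret M: sigma_finite_measure M by fact
  interpret L: sigma_finite_measure L by (rule sigma_finite_L)
  interpret PL: pair_sigma_finite M L ..
  interpret PLL: pair_sigma_finite "M \<Otimes>\<^sub>M L" L ..
  have chi: "continuous_on UNIV ch" "\<And>a b. ch (a + b) = ch a * ch b" "\<And>a. cmod (ch a) = 1"
    using chr by (auto simp: cont_character_def)
  have [measurable]: "ch \<in> borel_measurable borel"
    using chi(1) by (rule borel_measurable_continuous_onI)
  have unit: "cnj (ch a) * ch a = 1" for a
    using chi(3)[of a] by (metis complex_norm_square mult.commute of_real_1 one_power2)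
  define k where "k p = cnj (ch (snd p)) * f p" for p
  have k[measurable]: "k \<in> borel_measurable (M \<Otimes>\<^sub>M L)"
  proof -
    have "(\<lambda>a. cnj (ch a)) \<in> borel_measurable L"
      using chi(1) by (simp cong: measurable_cong_sets) (intro borel_measurable_continuous_onI continuous_intros)
    from borel_measurable_times[OF measurable_compose[OF measurable_snd this] f] show ?thesis
      by (simp only: k_def[abs_def])
  qed
  have fk: "f p = ch (snd p) * k p" for p
  proof -
    have "ch (snd p) * k p = (cnj (ch (snd p)) * ch (snd p)) * f p" unfolding k_def by (simp only: ac_simps)
    then show ?thesis by (simp only: unit mult_1)
  qed
  have kinv: "AE p in M \<Otimes>\<^sub>M L. k (fst p, h + snd p) = k p" for h
    using eig[of h]
  proof eventually_elim
    case (elim p)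
    have "k (fst p, h + snd p) = (cnj (ch h) * ch h) * (cnj (ch (snd p)) * f p)"
      using elim by (simp add: k_def chi(2))
    then show ?case by (simp add: unit) (simp add: k_def)
  qed
  let ?P = "\<lambda>p h. k (fst p, h + snd p) = k p"
  have meas: "{q\<in>space ((M \<Otimes>\<^sub>M L) \<Otimes>\<^sub>M L). ?P (fst q) (snd q)} \<in> sets ((M \<Otimes>\<^sub>M L) \<Otimes>\<^sub>M L)"
    by measurable
  have "AE h in L. AE p in M \<Otimes>\<^sub>M L. ?P p h" using kinv by simp
  then have "AE p in M \<Otimes>\<^sub>M L. AE h in L. ?P p h" using PLL.AE_commute[OF meas] by simp
  then have "AE z in M. AE g in L. AE h in L. k (z, h + g) = k (z, g)"
    using PL.AE_pair[of "\<lambda>p. AE h in L. ?P p h"] by simp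
  moreover have "{p\<in>space (M \<Otimes>\<^sub>M L). AE h in L. k (fst p, h + snd p) = k (fst p, snd p)} \<in> sets (M \<Otimes>\<^sub>M L)"
    using L.pred_AE[where N = "M \<Otimes>\<^sub>M L" and P = ?P] meas by (simp add: pred_def)
  ultimately have "AE g in L. AE z in M. AE h in L. k (z, h + g) = k (z, g)"
    using PL.AE_commute[of "\<lambda>z g. AE h in L. k (z, h + g) = k (z, g)"] by simp
  \<comment> \<open>One \<open>g\<close> works for almost all \<open>z\<close>, so the factor
    \<open>v\<close> can be taken as the section of \<open>k\<close> at \<open>g\<close>, which is
    measurable and bounded everywhere.\<close>
  then have "\<exists>g. AE z in M. AE h in L. k (z, h + g) = k (z, g)"
    by (rule AE_L_ex)
  then obtain g where g: "AE z in M. AE h in L. k (z, h + g) = k (z, g)" by blast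
  define v where "v z = k (z, g)" for z
  have [measurable]: "v \<in> borel_measurable M" unfolding v_def by measurable
  have "cmod (v z) \<le> C" for z using bd[of "(z, g)"] chi(3) by (simp add: v_def k_def norm_mult)
  moreover have "AE p in M \<Otimes>\<^sub>M L. k p = v (fst p)"
  proof (rule PL.AE_pair_measure)
    show "{p\<in>space (M \<Otimes>\<^sub>M L). k p = v (fst p)} \<in> sets (M \<Otimes>\<^sub>M L)" by measurable
    have L': "AE h in L. P (- g + h)" if "AE h in L. P h" for P
    proof -
      have "AE h in distr L L (\<lambda>x. - g + x). P h" unfolding distr_L_translation by (rule that)
      then show ?thesis by (rule AE_distrD[rotated]) measurable
    qed
    show "AE z in M. AE h in L. k (z, h) = v (fst (z, h))"
      using g
    proof eventually_elim
      case (elim z)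
      from L'[OF elim] show ?case by (simp add: v_def)
    qed
  qed
  then have "AE p in M \<Otimes>\<^sub>M L. f p = ch (snd p) * v (fst p)"
    by eventually_elim (simp add: fk)
  ultimately show ?thesis by (intro bexI[of _ v]) auto
qed

end

section \<open>Eigenfunctions of nonergodic Rokhlin extensions\<close>

lemma borel_measurable_cnj[measurable (raw)]:
  assumes "f \<in> borel_measurable M"
  shows "(\<lambda>x. cnj (f x)) \<in> borel_measurable M"
  by (rule borel_measurable_continuous_on[OF _ assms]) (intro continuous_intros)

lemma AE_pair_fst:
  assumes "sigma_finite_measure N" and AE: "AE x in M. P x"
  shows "AE p in M \<Otimes>\<^sub>M N. P (fst p)"
proof -
  interpret N: sigma_finite_measure N by fact
  obtain A where A: "{x\<in>space M. \<not> P x} \<subseteq> A" "emeasure M A = 0" "A \<in> sets M"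
    using AE by (rule AE_E)
  show ?thesis
  proof (rule AE_I[of _ _ "A \<times> space N"])
    show "{p \<in> space (M \<Otimes>\<^sub>M N). \<not> P (fst p)} \<subseteq> A \<times> space N"
      using A(1) by (auto simp: space_pair_measure)
    show "emeasure (M \<Otimes>\<^sub>M N) (A \<times> space N) = 0"
      using A(2,3) by (simp add: N.emeasure_pair_measure_Times)
    show "A \<times> space N \<in> sets (M \<Otimes>\<^sub>M N)" using A(3) by (intro pair_measureI) auto
  qed
qed

text \<open>Cauchy-Schwarz on \<open>A\<close>, from nonnegativity of the variance of
  \<open>cmod (f x)\<close> around its mean \<open>k\<close>. When \<open>A\<close> is null the
  integral vanishes outright.\<close>

lemma integral_square_le:
  fixes f :: "'a \<Rightarrow> complex"
  assumes A: "A \<in> fmeasurable M" and [measurable]: "f \<in> borel_measurable M" and bd: "\<And>x. cmod (f x) \<le> C"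
  shows "(cmod (\<integral>x. indicator A x * f x \<partial>M))\<^sup>2 \<le> measure M A * (\<integral>x. indicator A x * (cmod (f x))\<^sup>2 \<partial>M)"
proof -
  have [measurable]: "A \<in> sets M" using A by auto
  have C: "0 \<le> C" using bd[of undefined] norm_ge_zero order_trans by blast
  have ind: "integrable M (\<lambda>x. c * indicator A x)" for c :: real using A by (auto simp: fmeasurable_def)
  have i1: "integrable M (\<lambda>x. indicator A x * cmod (f x))"
    by (rule Bochner_Integration.integrable_bound[OF ind[of C]]) (use bd C in \<open>auto simp: indicator_def\<close>)
  have i2: "integrable M (\<lambda>x. indicator A x * (cmod (f x))\<^sup>2)"
    by (rule Bochner_Integration.integrable_bound[OF ind[of "C\<^sup>2"]])
       (use bd C in \<open>auto simp: indicator_def intro!: power_mono\<close>)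
  define I where "I = (\<integral>x. indicator A x * cmod (f x) \<partial>M)"
  define J where "J = (\<integral>x. indicator A x * (cmod (f x))\<^sup>2 \<partial>M)"
  have "cmod (\<integral>x. indicator A x * f x \<partial>M) \<le> (\<integral>x. cmod (indicator A x * f x) \<partial>M)"
    by (rule integral_norm_bound)
  also have "\<dots> = I" unfolding I_def
    by (intro Bochner_Integration.integral_cong) (auto simp: norm_mult indicator_def)
  finally have le: "cmod (\<integral>x. indicator A x * f x \<partial>M) \<le> I" .
  have "I\<^sup>2 \<le> measure M A * J"
  proof (cases "measure M A = 0")
    case True
    have "0 \<le> (\<integral>x. C * indicator A x - indicator A x * cmod (f x) \<partial>M)"
      using bd by (intro Bochner_Integration.integral_nonneg) (auto simp: indicator_def)
    also have "\<dots> = C * measure M A - I"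
      using ind i1 A by (simp add: I_def Bochner_Integration.integral_diff)
    finally have "I \<le> 0" using True by simp
    moreover have "0 \<le> I" unfolding I_def by (intro Bochner_Integration.integral_nonneg) auto
    ultimately show ?thesis using True by simp
  next
    case False
    then have pos: "0 < measure M A" by (simp add: zero_less_measure_iff)
    define k where "k = I / measure M A"
    have "0 \<le> (\<integral>x. indicator A x * (cmod (f x) - k)\<^sup>2 \<partial>M)"
      by (intro Bochner_Integration.integral_nonneg) auto
    also have "\<dots> = (\<integral>x. (indicator A x * (cmod (f x))\<^sup>2 - 2 * k * (indicator A x * cmod (f x))) + k\<^sup>2 * indicator A x \<partial>M)"
      by (intro Bochner_Integration.integral_cong) (auto simp: power2_eq_square algebra_simps)
    also have "\<dots> = J - 2 * k * I + k\<^sup>2 * measure M A"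
      using ind i1 i2 A by (simp add: I_def J_def Bochner_Integration.integral_diff Bochner_Integration.integral_add)
    also have "\<dots> = J - I\<^sup>2 / measure M A"
      using pos by (simp add: k_def power2_eq_square field_simps)
    finally show ?thesis using pos by (simp add: field_simps)
  qed
  moreover have "(cmod (\<integral>x. indicator A x * f x \<partial>M))\<^sup>2 \<le> I\<^sup>2" using le by (intro power_mono) auto
  ultimately show ?thesis by (simp add: J_def)
qed

definition inner_L2 :: "'y measure \<Rightarrow> ('y \<Rightarrow> complex) \<Rightarrow> ('y \<Rightarrow> complex) \<Rightarrow> complex" where
  "inner_L2 N a b = (\<integral>y. a y * cnj (b y) \<partial>N)"

section \<open>Invariant functions as vector fields on the Mackey space\<close>

text \<open>The base is only sigma-finite: in the application it is a probability space times the
  group, and \<open>Q\<close> is the extension by the second cocycle, while \<open>\<psi>\<close> is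
  the first cocycle.\<close>

locale rokhlin_system = haar_group L
  for L :: "'g::{topological_ab_group_add, second_countable_topology, t2_space} measure" +
  fixes M :: "'z measure" and Q :: "'z \<Rightarrow> 'z" and \<psi> :: "'z \<Rightarrow> 'g"
    and N :: "'y measure" and S :: "'g \<Rightarrow> 'y \<Rightarrow> 'y"
  assumes sfM: "sigma_finite_measure M" and Q: "mp_iso M Q" and ergQ: "ergodic_map M Q"
    and \<psi>[measurable]: "\<psi> \<in> borel_measurable M"
    and prN: "prob_space N" and spN: "space N = UNIV"
    and S: "mp_action N S"
begin

sublocale M: sigma_finite_measure M by (rule sfM)
sublocale N: prob_space N by (rule prN)
sublocale L: sigma_finite_measure L by (rule sigma_finite_L)
sublocale PL: pair_sigma_finite M L ..
sublocale MN: pair_sigma_finite M N ..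
sublocale PLN: pair_sigma_finite "M \<Otimes>\<^sub>M L" N ..

abbreviation "m \<equiv> M \<Otimes>\<^sub>M L"
text \<open>When \<open>Q\<close> is itself a group extension this is, up to the order of
  coordinates, the extension by a pair of cocycles. It may be nonergodic, and the translations act
  on its ergodic components as the Mackey action restricted to one factor.\<close>

abbreviation "\<Gamma> \<equiv> group_ext Q \<psi>"

lemma spM: "space M = UNIV" and Q_measurable[measurable]: "Q \<in> M \<rightarrow>\<^sub>M M" and distr_Q: "distr M M Q = M"
  using mp_isoD[OF Q] by auto

lemma sp_m: "space m = UNIV" "space (M \<Otimes>\<^sub>M N) = UNIV" "space (m \<Otimes>\<^sub>M N) = UNIV"
  by (simp_all add: space_pair_measure spM spN)

lemma \<Gamma>: "mp_iso m \<Gamma>"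
  by (rule mp_iso_group_ext[OF sfM Q \<psi>])

lemma \<Gamma>_measurable[measurable]: "\<Gamma> \<in> m \<rightarrow>\<^sub>M m"
  by (rule mp_isoD(2)[OF \<Gamma>])

lemma S_measurable[measurable]: "S g \<in> N \<rightarrow>\<^sub>M N"
  by (rule mp_actionD(4)[OF S])

lemma S_add: "S (g + h) y = S g (S h y)"
  by (rule mp_actionD(3)[OF S])

lemma integral_S: "f \<in> borel_measurable N \<Longrightarrow> (\<integral>y. f (S g y) \<partial>N) = (\<integral>y. f y \<partial>N)"
  for f :: "'y \<Rightarrow> 'b::{banach, second_countable_topology}"
  using integral_distr[of "S g" N N f] by (simp add: mp_actionD(5)[OF S])

text \<open>The \<open>\<Gamma>\<close>-invariant function \<open>\<omega> \<mapsto> X (z, S g \<cdot>)\<close> for \<open>\<omega> = (z, g)\<close> is viewed as a function from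
  the ergodic components of \<open>\<Gamma>\<close> to \<open>L\<^sup>2(N)\<close>.\<close>
definition admissible :: "('z \<times> 'y \<Rightarrow> complex) \<Rightarrow> bool" where
  "admissible X \<longleftrightarrow> X \<in> borel_measurable (M \<Otimes>\<^sub>M N) \<and> (\<exists>B. \<forall>p. cmod (X p) \<le> B) \<and>
     (\<forall>z y. X (Q z, S (\<psi> z) y) = X (z, y))"

definition msq :: "('z \<times> 'y \<Rightarrow> complex) \<Rightarrow> 'z \<Rightarrow> real" where
  "msq X z = (\<integral>y. (cmod (X (z, y)))\<^sup>2 \<partial>N)"

text \<open>The integral over the window \<open>A\<close> of the vector field attached to
  \<open>X\<close>, evaluated at the fibre point \<open>y\<close>.\<close>

definition smear :: "('z \<times> 'y \<Rightarrow> complex) \<Rightarrow> ('z \<times> 'g) set \<Rightarrow> 'y \<Rightarrow> complex" where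
  "smear X A y = (\<integral>p. indicator A p * X (fst p, S (snd p) y) \<partial>m)"

definition shifted :: "'g \<Rightarrow> ('z \<times> 'g) set \<Rightarrow> ('z \<times> 'g) set" where
  "shifted h A = {p. (fst p, - h + snd p) \<in> A}"

lemma admissibleD:
  assumes "admissible X"
  shows "X \<in> borel_measurable (M \<Otimes>\<^sub>M N)" "X (Q z, S (\<psi> z) y) = X (z, y)"
  using assms by (auto simp: admissible_def)

lemma orbit_measurable:
  assumes X: "X \<in> borel_measurable (M \<Otimes>\<^sub>M N)" and p[measurable]: "p \<in> K \<rightarrow>\<^sub>M M" "g \<in> borel_measurable K" "y \<in> K \<rightarrow>\<^sub>M N"
  shows "(\<lambda>x. X (p x, S (g x) (y x))) \<in> borel_measurable K"
proof -
  have "(\<lambda>x. (p x, S (g x) (y x))) \<in> K \<rightarrow>\<^sub>M M \<Otimes>\<^sub>M N"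
    by (intro measurable_Pair p(1) mp_action_measurable[OF S]) measurable
  from measurable_compose[OF this X] show ?thesis .
qed

lemma orbit_measurable_m:
  assumes "X \<in> borel_measurable (M \<Otimes>\<^sub>M N)"
  shows "(\<lambda>p. X (fst p, S (snd p) y)) \<in> borel_measurable m"
  by (rule orbit_measurable[OF assms]) (auto simp: spN)

lemma section_measurable:
  assumes "X \<in> borel_measurable (M \<Otimes>\<^sub>M N)"
  shows "(\<lambda>y. X (z, y)) \<in> borel_measurable N" "(\<lambda>y. X (z, S g y)) \<in> borel_measurable N"
proof -
  show 1: "(\<lambda>y. X (z, y)) \<in> borel_measurable N"
    by (rule measurable_compose[OF measurable_Pair1' assms]) (simp add: spM)
  show "(\<lambda>y. X (z, S g y)) \<in> borel_measurable N"
    by (rule measurable_compose[OF S_measurable 1])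
qed

lemma smear_measurable:
  assumes "X \<in> borel_measurable (M \<Otimes>\<^sub>M N)" and [measurable]: "A \<in> sets m"
  shows "smear X A \<in> borel_measurable N"
proof -
  have [measurable]: "(\<lambda>q. X (fst (snd q), S (snd (snd q)) (fst q))) \<in> borel_measurable (N \<Otimes>\<^sub>M m)"
    by (rule orbit_measurable[OF assms(1)]) measurable
  have "(\<lambda>y. \<integral>p. indicator A p * X (fst p, S (snd p) y) \<partial>m) \<in> borel_measurable N"
    by (rule PL.borel_measurable_lebesgue_integral) (simp add: split_beta', measurable)
  then show ?thesis by (simp add: smear_def[abs_def])
qed

lemma integrable_indicator_m:
  assumes "A \<in> fmeasurable m" "X \<in> borel_measurable (M \<Otimes>\<^sub>M N)" "\<And>p. cmod (X p) \<le> B"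
  shows "integrable m (\<lambda>p. indicator A p * X (fst p, S (snd p) y))"
proof -
  have [measurable]: "A \<in> sets m" using assms(1) by auto
  note orbit_measurable_m[OF assms(2), of y, measurable]
  have "integrable m (\<lambda>p. B * indicator A p)" using assms(1) by (auto simp: fmeasurable_def)
  then show ?thesis
    by (rule Bochner_Integration.integrable_bound)
       (use assms(3) in \<open>auto simp: indicator_def intro: order_trans[OF _ abs_ge_self]\<close>)
qed

lemma smear_bounded:
  assumes "A \<in> fmeasurable m" "X \<in> borel_measurable (M \<Otimes>\<^sub>M N)" "\<And>p. cmod (X p) \<le> B"
  shows "cmod (smear X A y) \<le> B * measure m A"
proof -
  have "cmod (smear X A y) \<le> (\<integral>p. B * indicator A p \<partial>m)"
    unfolding smear_def
  proof (rule norm_integral_le_AE[OF integrable_indicator_m[OF assms]])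
    show "integrable m (\<lambda>p. B * indicator A p)" using assms(1) by (auto simp: fmeasurable_def)
  qed (use assms(3) in \<open>auto simp: indicator_def\<close>)
  then show ?thesis using assms(1) by simp
qed

lemma fmeasurable_shifted:
  assumes "A \<in> fmeasurable m"
  shows "shifted h A \<in> fmeasurable m" "measure m (shifted h A) = measure m A"
proof -
  note iso = mp_iso_translation[OF sfM spM, of "- h"]
  have eq: "shifted h A = (\<lambda>p. (fst p, - h + snd p)) -` A \<inter> space m" by (auto simp: shifted_def sp_m)
  have A: "A \<in> sets m" using assms by auto
  have "emeasure m (shifted h A) = emeasure (distr m m (\<lambda>p. (fst p, - h + snd p))) A"
    using A mp_isoD(2)[OF iso] unfolding eq by (intro emeasure_distr[symmetric])
  then have em: "emeasure m (shifted h A) = emeasure m A" by (simp only: mp_isoD(3)[OF iso])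
  then show "measure m (shifted h A) = measure m A" by (simp add: measure_def)
  show "shifted h A \<in> fmeasurable m"
    using em assms measurable_sets[OF mp_isoD(2)[OF iso] A] eq by (auto simp: fmeasurable_def)
qed

lemma fmeasurable_\<Gamma>:
  assumes "A \<in> fmeasurable m"
  shows "\<Gamma> -` A \<in> fmeasurable m"
proof -
  have A: "A \<in> sets m" using assms by auto
  have "emeasure m (\<Gamma> -` A) = emeasure (distr m m \<Gamma>) A"
    using A by (subst emeasure_distr) (auto simp: sp_m)
  then have "emeasure m (\<Gamma> -` A) = emeasure m A" by (simp only: mp_isoD(3)[OF \<Gamma>])
  moreover have "\<Gamma> -` A \<in> sets m" using measurable_sets[OF \<Gamma>_measurable A] by (simp add: sp_m)
  ultimately show ?thesis using assms by (auto simp: fmeasurable_def)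
qed

text \<open>Invariance of Haar measure and commutativity of the group: translating the window
  amounts to applying the unitary operator of \<open>S h\<close> to the integrated vector.\<close>

lemma smear_shifted:
  assumes X: "X \<in> borel_measurable (M \<Otimes>\<^sub>M N)" and A: "A \<in> sets m"
  shows "smear X (shifted h A) y = smear X A (S h y)"
proof -
  note [measurable] = A orbit_measurable_m[OF X]
  have [measurable]: "shifted h A \<in> sets m"
  proof -
    have "(\<lambda>p. (fst p, - h + snd p)) -` A \<inter> space m \<in> sets m"
      by (rule measurable_sets[OF mp_isoD(2)[OF mp_iso_translation[OF sfM spM]] A])
    then show ?thesis by (simp add: shifted_def sp_m vimage_def)
  qed
  have "(\<integral>p. indicator (shifted h A) (fst p, h + snd p) * X (fst (fst p, h + snd p), S (snd (fst p, h + snd p)) y) \<partial>m)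
     = (\<integral>p. indicator (shifted h A) p * X (fst p, S (snd p) y) \<partial>m)"
    by (rule integral_translation[OF sfM spM]) measurable
  moreover have "S (h + g) y = S g (S h y)" for g by (simp add: S_add[symmetric] add.commute)
  ultimately show ?thesis unfolding smear_def by (simp add: shifted_def indicator_def)
qed

text \<open>Admissibility makes the vector field invariant under \<open>\<Gamma>\<close>, which
  preserves the measure.\<close>

lemma smear_\<Gamma>:
  assumes X: "admissible X" and A: "A \<in> sets m"
  shows "smear X (\<Gamma> -` A) y = smear X A y"
proof -
  note [measurable] = A orbit_measurable_m[OF admissibleD(1)[OF X]]
  have "smear X (\<Gamma> -` A) y = (\<integral>p. indicator A (\<Gamma> p) * X (fst (\<Gamma> p), S (snd (\<Gamma> p)) y) \<partial>m)"
    unfolding smear_def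
    by (intro Bochner_Integration.integral_cong)
       (auto simp: group_ext_def S_add admissibleD(2)[OF X] indicator_def split_beta)
  also have "\<dots> = (\<integral>p. indicator A p * X (fst p, S (snd p) y) \<partial>distr m m \<Gamma>)"
    by (rule integral_distr[symmetric]) measurable
  finally show ?thesis by (simp add: mp_isoD(3)[OF \<Gamma>] smear_def)
qed

lemma smear_Un:
  assumes X: "X \<in> borel_measurable (M \<Otimes>\<^sub>M N)" "\<And>p. cmod (X p) \<le> B"
    and AB: "A \<in> fmeasurable m" "A' \<in> fmeasurable m" "A \<inter> A' = {}"
  shows "smear X (A \<union> A') y = smear X A y + smear X A' y"
proof -
  have "smear X (A \<union> A') y = (\<integral>p. indicator A p * X (fst p, S (snd p) y) + indicator A' p * X (fst p, S (snd p) y) \<partial>m)"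
    unfolding smear_def using AB(3)
    by (intro Bochner_Integration.integral_cong) (auto simp: indicator_def)
  then show ?thesis
    using integrable_indicator_m[OF AB(1) X] integrable_indicator_m[OF AB(2) X]
    by (simp add: smear_def)
qed

text \<open>\<open>S h\<close> commutes with the whole action, so 1 + l U_h preserves equivariance.
  This is what closes the class of admissible functions under the twists.\<close>

lemma admissible_twist:
  assumes X: "admissible X"
  shows "admissible (\<lambda>p. X p + l * X (fst p, S h (snd p)))"
proof -
  obtain B where B: "\<And>p. cmod (X p) \<le> B" using X by (auto simp: admissible_def)
  note [measurable] = admissibleD(1)[OF X]
  have "(\<lambda>p. X (fst p, S h (snd p))) \<in> borel_measurable (M \<Otimes>\<^sub>M N)" by measurable
  moreover have "cmod (X p + l * X (fst p, S h (snd p))) \<le> B + cmod l * B" for p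
  proof -
    have "cmod (X p + l * X (fst p, S h (snd p))) \<le> cmod (X p) + cmod l * cmod (X (fst p, S h (snd p)))"
      using norm_triangle_ineq[of "X p" "l * X (fst p, S h (snd p))"] by (simp add: norm_mult)
    also have "\<dots> \<le> B + cmod l * B" using B by (intro add_mono mult_left_mono) auto
    finally show ?thesis .
  qed
  moreover have "X (Q z, S h (S (\<psi> z) y)) = X (z, S h y)" for z y
  proof -
    have "S h (S (\<psi> z) y) = S (\<psi> z) (S h y)" by (simp add: S_add[symmetric] add.commute)
    then show ?thesis by (simp add: admissibleD(2)[OF X])
  qed
  ultimately show ?thesis
    unfolding admissible_def
    by (intro conjI exI[of _ "B + cmod l * B"] allI borel_measurable_add borel_measurable_times
          borel_measurable_const admissibleD(1)[OF X])
       (simp_all add: admissibleD(2)[OF X])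
qed

lemma smear_twist:
  assumes X: "X \<in> borel_measurable (M \<Otimes>\<^sub>M N)" "\<And>p. cmod (X p) \<le> B" and A: "A \<in> fmeasurable m"
  shows "smear (\<lambda>p. X p + l * X (fst p, S h (snd p))) A y = smear X A y + l * smear X A (S h y)"
proof -
  have comm: "S h (S g y) = S g (S h y)" for g by (simp add: S_add[symmetric] add.commute)
  have "smear (\<lambda>p. X p + l * X (fst p, S h (snd p))) A y =
    (\<integral>p. indicator A p * X (fst p, S (snd p) y) + l * (indicator A p * X (fst p, S (snd p) (S h y))) \<partial>m)"
    unfolding smear_def
    by (intro Bochner_Integration.integral_cong) (auto simp: comm algebra_simps)
  then show ?thesis
    using integrable_indicator_m[OF A X, of y] integrable_indicator_m[OF A X, of "S h y"]
    by (simp add: smear_def)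
qed

text \<open>Of the four terms in the expansion, the two diagonal ones agree because
  \<open>S h\<close> preserves \<open>N\<close>, and the last cross term is brought to the first
  argument by substituting \<open>S (- h)\<close>.\<close>

lemma inner_L2_twist:
  assumes [measurable]: "a \<in> borel_measurable N" "b \<in> borel_measurable N"
    and bd: "\<And>y. cmod (a y) \<le> B" "\<And>y. cmod (b y) \<le> B'" and l: "cmod l = 1"
  shows "inner_L2 N (\<lambda>y. a y + l * a (S h y)) (\<lambda>y. b y + l * b (S h y)) =
    2 * inner_L2 N a b + l * inner_L2 N (\<lambda>y. a (S h y)) b + cnj l * inner_L2 N (\<lambda>y. a (S (- h) y)) b"
proof -
  have int: "integrable N (\<lambda>y. a (S g y) * cnj (b (S k y)))" for g k
  proof (rule N.integrable_const_bound[where B = "B * B'"])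
    have B0: "0 \<le> B" using bd(1)[of undefined] norm_ge_zero order_trans by blast
    then have "cmod (a (S g y) * cnj (b (S k y))) \<le> B * B'" for y
      unfolding norm_mult complex_mod_cnj by (intro mult_mono bd) auto
    then show "AE y in N. cmod (a (S g y) * cnj (b (S k y))) \<le> B * B'" by simp
  qed measurable
  have S0: "S 0 y = y" for y using mp_actionD(2)[OF S] by simp
  have i: "integrable N (\<lambda>y. a y * cnj (b y))" "integrable N (\<lambda>y. a (S h y) * cnj (b y))"
    "integrable N (\<lambda>y. a y * cnj (b (S h y)))" "integrable N (\<lambda>y. a (S h y) * cnj (b (S h y)))"
    using int[of 0 0] int[of h 0] int[of 0 h] int[of h h] by (simp_all add: S0)
  have ll: "l * cnj l = 1" using l by (metis complex_norm_square of_real_1 one_power2)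
  have "inner_L2 N (\<lambda>y. a y + l * a (S h y)) (\<lambda>y. b y + l * b (S h y)) =
    (\<integral>y. a y * cnj (b y) + l * (a (S h y) * cnj (b y)) + cnj l * (a y * cnj (b (S h y)))
       + a (S h y) * cnj (b (S h y)) \<partial>N)"
    unfolding inner_L2_def
  proof (intro Bochner_Integration.integral_cong refl)
    fix y
    have "(a y + l * a (S h y)) * cnj (b y + l * b (S h y)) = a y * cnj (b y) + l * (a (S h y) * cnj (b y))
      + cnj l * (a y * cnj (b (S h y))) + (l * cnj l) * (a (S h y) * cnj (b (S h y)))"
      by (simp add: algebra_simps)
    then show "(a y + l * a (S h y)) * cnj (b y + l * b (S h y)) = a y * cnj (b y) + l * (a (S h y) * cnj (b y))
      + cnj l * (a y * cnj (b (S h y))) + a (S h y) * cnj (b (S h y))" by (simp add: ll)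
  qed
  also have "\<dots> = inner_L2 N a b + l * inner_L2 N (\<lambda>y. a (S h y)) b
      + cnj l * (\<integral>y. a y * cnj (b (S h y)) \<partial>N) + (\<integral>y. a (S h y) * cnj (b (S h y)) \<partial>N)"
    using i by (simp add: inner_L2_def)
  also have "(\<integral>y. a (S h y) * cnj (b (S h y)) \<partial>N) = inner_L2 N a b"
    unfolding inner_L2_def by (rule integral_S) measurable
  also have "(\<integral>y. a y * cnj (b (S h y)) \<partial>N) = (\<integral>y. a (S (- h) y) * cnj (b (S h (S (- h) y))) \<partial>N)"
    by (rule integral_S[symmetric]) measurable
  also have "\<dots> = inner_L2 N (\<lambda>y. a (S (- h) y)) b"
    by (simp add: inner_L2_def mp_action_uminus[OF S])
  finally show ?thesis by (simp add: algebra_simps)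
qed

text \<open>\<open>S\<close> preserves \<open>N\<close>, so the squared fibre norm is
  \<open>Q\<close>-invariant, and \<open>Q\<close> is ergodic.\<close>

lemma msq_const:
  assumes X: "admissible X"
  shows "\<exists>c. AE z in M. msq X z = c"
proof -
  note [measurable] = admissibleD(1)[OF X]
  have [measurable]: "msq X \<in> borel_measurable M"
    unfolding msq_def[abs_def] by measurable
  have "msq X (Q z) = msq X z" for z
  proof -
    note [measurable] = section_measurable[OF admissibleD(1)[OF X]]
    have "msq X (Q z) = (\<integral>y. (cmod (X (Q z, S (\<psi> z) y)))\<^sup>2 \<partial>N)"
      unfolding msq_def by (rule integral_S[symmetric]) measurable
    then show ?thesis by (simp add: admissibleD(2)[OF X] msq_def)
  qed
  then show ?thesis
    using ergodic_map_AE_invariant_const[OF ergQ distr_Q, of "msq X"] by auto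
qed

text \<open>Cauchy-Schwarz over the window for each \<open>y\<close>, then Fubini; the inner fibre
  integral is the constant \<open>c\<close> almost everywhere.\<close>

lemma smear_msq_le:
  assumes X: "admissible X" and c: "AE z in M. msq X z = c" and A: "A \<in> fmeasurable m"
  shows "(\<integral>y. (cmod (smear X A y))\<^sup>2 \<partial>N) \<le> (measure m A)\<^sup>2 * c"
proof -
  obtain B where B: "\<And>p. cmod (X p) \<le> B" using X by (auto simp: admissible_def)
  note Xm = admissibleD(1)[OF X]
  have As[measurable]: "A \<in> sets m" using A by auto
  note [measurable] = orbit_measurable_m[OF Xm] smear_measurable[OF Xm As]
  have XX[measurable]: "(\<lambda>q. X (fst (fst q), S (snd (fst q)) (snd q))) \<in> borel_measurable (m \<Otimes>\<^sub>M N)"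
    by (rule orbit_measurable[OF Xm]) measurable
  let ?F = "\<lambda>p y. indicator A p * (cmod (X (fst p, S (snd p) y)))\<^sup>2"
  have fm: "emeasure (m \<Otimes>\<^sub>M N) (A \<times> space N) < \<infinity>"
    using A by (subst N.emeasure_pair_measure_Times) (auto simp: N.emeasure_space_1 fmeasurable_def)
  have intF: "integrable (m \<Otimes>\<^sub>M N) (\<lambda>q. ?F (fst q) (snd q))"
  proof (rule Bochner_Integration.integrable_bound)
    show "integrable (m \<Otimes>\<^sub>M N) (\<lambda>q. B\<^sup>2 * indicator (A \<times> space N) q)" using fm As by auto
    show "AE q in m \<Otimes>\<^sub>M N. norm (?F (fst q) (snd q)) \<le> norm (B\<^sup>2 * indicator (A \<times> space N) q)"
      using B by (auto simp: indicator_def spN intro!: power_mono)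
  qed measurable
  have "(\<integral>y. (cmod (smear X A y))\<^sup>2 \<partial>N) \<le> (\<integral>y. measure m A * (\<integral>p. ?F p y \<partial>m) \<partial>N)"
  proof (rule Bochner_Integration.integral_mono)
    show "integrable N (\<lambda>y. (cmod (smear X A y))\<^sup>2)"
      by (rule N.integrable_const_bound[where B = "(B * measure m A)\<^sup>2"])
         (use smear_bounded[OF A Xm B] in \<open>auto intro!: power_mono\<close>)
    show "integrable N (\<lambda>y. measure m A * (\<integral>p. ?F p y \<partial>m))"
      using PLN.integrable_snd[of "\<lambda>p y. ?F p y"] intF by (simp add: split_beta')
    show "(cmod (smear X A y))\<^sup>2 \<le> measure m A * (\<integral>p. ?F p y \<partial>m)" for y
      unfolding smear_def using B by (intro integral_square_le[OF A]) auto
  qed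
  also have "\<dots> = measure m A * (\<integral>p. (\<integral>y. ?F p y \<partial>N) \<partial>m)"
    using PLN.Fubini_integral[of ?F] intF by (simp add: split_beta')
  also have "(\<integral>p. (\<integral>y. ?F p y \<partial>N) \<partial>m) = (\<integral>p. c * indicator A p \<partial>m)"
  proof (rule Bochner_Integration.integral_cong_AE)
    have msq: "(\<integral>y. (cmod (X (z, S g y)))\<^sup>2 \<partial>N) = msq X z" for z g
      unfolding msq_def
      by (rule integral_S) (use section_measurable[OF Xm] in measurable)
    have [measurable]: "msq X \<in> borel_measurable M"
      unfolding msq_def[abs_def] using Xm by measurable
    have "AE p in m. msq X (fst p) = c"
      using c by (rule AE_pair_fst[OF sigma_finite_L])
    then show "AE p in m. (\<integral>y. ?F p y \<partial>N) = c * indicator A p"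
      by eventually_elim (simp add: msq)
    show "(\<lambda>p. \<integral>y. ?F p y \<partial>N) \<in> borel_measurable m" by measurable
  qed measurable
  also have "measure m A * (\<integral>p. c * indicator A p \<partial>m) = (measure m A)\<^sup>2 * c"
    using A by (simp add: power2_eq_square)
  finally show ?thesis .
qed

end

section \<open>Windows, coordinates and the compact convex problem\<close>

text \<open>\<open>E0\<close> is used to average correlations over a base of possibly infinite
  measure; \<open>E\<close> and \<open>F\<close> are the two windows whose averages are
  compared.\<close>

locale rokhlin_window = rokhlin_system L M Q \<psi> N S
  for L :: "'g::{topological_ab_group_add, second_countable_topology, t2_space} measure"
    and M :: "'z measure" and Q \<psi> and N :: "'y measure" and S +
  fixes E0 :: "'z set" and E F :: "('z \<times> 'g) set"
  assumes E0: "E0 \<in> fmeasurable M" "measure M E0 > 0"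
    and E: "E \<in> fmeasurable m" "measure m E > 0"
    and F: "F \<in> fmeasurable m" "measure m F > 0"
begin

text \<open>Difference of two window averages of the vector field; it vanishes when the field is
  constant, so a nonzero contrast witnesses that the field varies over the Mackey space.\<close>

definition contrast :: "('z \<times> 'y \<Rightarrow> complex) \<Rightarrow> 'y \<Rightarrow> complex" where
  "contrast X y = of_real (1 / measure m E) * smear X E y - of_real (1 / measure m F) * smear X F y"

text \<open>The autocorrelation of the vector field; its value at 0 is the constant squared
  norm.\<close>

definition corr :: "('z \<times> 'y \<Rightarrow> complex) \<Rightarrow> 'g \<Rightarrow> complex" where
  "corr X h = of_real (1 / measure M E0) *
     (\<integral>z. indicator E0 z * inner_L2 N (\<lambda>y. X (z, S h y)) (\<lambda>y. X (z, y)) \<partial>M)"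

text \<open>Autocorrelations and window functionals are recorded in one point of a product space, so
  that a single extreme point produces a character together with an eigenfunctional for it. The
  value 0 outside sets of finite measure is a filler.\<close>

definition coords :: "('z \<times> 'y \<Rightarrow> complex) \<Rightarrow> 'g + ('z \<times> 'g) set \<Rightarrow> complex" where
  "coords X j = (case j of Inl h \<Rightarrow> corr X h
     | Inr A \<Rightarrow> if A \<in> fmeasurable m then inner_L2 N (smear X A) (contrast X) else 0)"

definition act :: "'g \<Rightarrow> 'g + ('z \<times> 'g) set \<Rightarrow> 'g + ('z \<times> 'g) set" where
  "act h j = (case j of Inl k \<Rightarrow> Inl (h + k) | Inr A \<Rightarrow> Inr (shifted h A))"

text \<open>In units of the squared norm c of the field: an integrated vector over \<open>A\<close>
  has norm at most \<open>measure m A\<close> times sqrt c, and the contrast has norm at most 2 sqrt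
  c.\<close>

definition bnd :: "'g + ('z \<times> 'g) set \<Rightarrow> real" where
  "bnd j = (case j of Inl k \<Rightarrow> 1 | Inr A \<Rightarrow> 2 * measure m A)"

lemma contrast_measurable:
  assumes X: "X \<in> borel_measurable (M \<Otimes>\<^sub>M N)"
  shows "contrast X \<in> borel_measurable N"
proof -
  have [measurable]: "smear X E \<in> borel_measurable N" "smear X F \<in> borel_measurable N"
    using E F by (auto intro: smear_measurable[OF X])
  show ?thesis unfolding contrast_def[abs_def] by measurable
qed

lemma contrast_bounded:
  assumes X: "X \<in> borel_measurable (M \<Otimes>\<^sub>M N)" "\<And>p. cmod (X p) \<le> B"
  shows "cmod (contrast X y) \<le> 2 * B"
proof -
  have "cmod (contrast X y) \<le> cmod (of_real (1 / measure m E) * smear X E y) + cmod (of_real (1 / measure m F) * smear X F y)"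
    unfolding contrast_def by (rule norm_triangle_ineq4)
  also have "\<dots> \<le> B + B"
    using smear_bounded[OF E(1) X, of y] smear_bounded[OF F(1) X, of y] E(2) F(2)
    by (intro add_mono) (simp_all add: norm_mult norm_divide field_simps)
  finally show ?thesis by simp
qed

lemma contrast_twist:
  assumes X: "X \<in> borel_measurable (M \<Otimes>\<^sub>M N)" "\<And>p. cmod (X p) \<le> B"
  shows "contrast (\<lambda>p. X p + l * X (fst p, S h (snd p))) y = contrast X y + l * contrast X (S h y)"
  unfolding contrast_def smear_twist[OF X E(1)] smear_twist[OF X F(1)] by (simp add: algebra_simps)

lemma inner_section_measurable:
  assumes X: "X \<in> borel_measurable (M \<Otimes>\<^sub>M N)"
  shows "(\<lambda>z. inner_L2 N (\<lambda>y. X (z, S h y)) (\<lambda>y. X (z, y))) \<in> borel_measurable M"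
proof -
  have [measurable]: "(\<lambda>q. X (fst q, S h (snd q))) \<in> borel_measurable (M \<Otimes>\<^sub>M N)"
    by (rule orbit_measurable[OF X]) measurable
  note [measurable] = X
  have "(\<lambda>z. \<integral>y. X (z, S h y) * cnj (X (z, y)) \<partial>N) \<in> borel_measurable M"
    by (rule N.borel_measurable_lebesgue_integral) (simp add: split_beta', measurable)
  then show ?thesis by (simp add: inner_L2_def)
qed

lemma inner_L2_bounded:
  assumes "\<And>y. cmod (a y) \<le> B" "\<And>y. cmod (b y) \<le> B'"
    and [measurable]: "a \<in> borel_measurable N" "b \<in> borel_measurable N"
  shows "cmod (inner_L2 N a b) \<le> B * B'"
proof -
  have B: "0 \<le> B" "0 \<le> B'" using assms(1,2)[of undefined] norm_ge_zero order_trans by blast+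
  have le: "cmod (a y * cnj (b y)) \<le> B * B'" for y
    using assms(1,2)[of y] B by (simp add: norm_mult mult_mono)
  have "cmod (inner_L2 N a b) \<le> (\<integral>y. B * B' \<partial>N)"
    unfolding inner_L2_def
    by (rule norm_integral_le_AE[OF N.integrable_const_bound[where B = "B * B'"]])
       (use le in auto)
  then show ?thesis by (simp add: N.prob_space)
qed

lemma corr_integrable:
  assumes X: "X \<in> borel_measurable (M \<Otimes>\<^sub>M N)" "\<And>p. cmod (X p) \<le> B"
  shows "integrable M (\<lambda>z. indicator E0 z * inner_L2 N (\<lambda>y. X (z, S h y)) (\<lambda>y. X (z, y)))"
proof -
  have [measurable]: "E0 \<in> sets M" using E0 by auto
  note [measurable] = inner_section_measurable[OF X(1)]
  have "integrable M (\<lambda>z. (B * B) * indicator E0 z)" using E0 by (auto simp: fmeasurable_def)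
  then show ?thesis
  proof (rule Bochner_Integration.integrable_bound)
    have "cmod (inner_L2 N (\<lambda>y. X (z, S h y)) (\<lambda>y. X (z, y))) \<le> B * B" for z
      using X by (intro inner_L2_bounded section_measurable[OF X(1)]) auto
    then show "AE z in M. norm (indicator E0 z * inner_L2 N (\<lambda>y. X (z, S h y)) (\<lambda>y. X (z, y)))
        \<le> norm ((B * B) * indicator E0 z)"
      by (auto simp: indicator_def)
  qed measurable
qed

text \<open>The abstract twist of the coordinates comes from the operator 1 + l U_h on the function.
  Hence domination, which speaks about all iterated twists, reduces to one inequality for all
  admissible functions.\<close>

lemma twist_coords:
  assumes X: "admissible X" and l: "cmod l = 1"
  shows "twist act (l, h) (coords X) = coords (\<lambda>p. X p + l * X (fst p, S h (snd p)))"
proof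
  obtain B where B: "\<And>p. cmod (X p) \<le> B" using X by (auto simp: admissible_def)
  note Xm = admissibleD(1)[OF X]
  fix j :: "'g + ('z \<times> 'g) set"
  show "twist act (l, h) (coords X) j = coords (\<lambda>p. X p + l * X (fst p, S h (snd p))) j"
  proof (cases j)
    case (Inl k)
    let ?I = "\<lambda>k z. indicator E0 z * inner_L2 N (\<lambda>y. X (z, S k y)) (\<lambda>y. X (z, y))"
    have pw: "inner_L2 N (\<lambda>y. X (z, S k y) + l * X (z, S h (S k y))) (\<lambda>y. X (z, y) + l * X (z, S h y)) =
      2 * inner_L2 N (\<lambda>y. X (z, S k y)) (\<lambda>y. X (z, y)) + l * inner_L2 N (\<lambda>y. X (z, S (h + k) y)) (\<lambda>y. X (z, y))
       + cnj l * inner_L2 N (\<lambda>y. X (z, S (- h + k) y)) (\<lambda>y. X (z, y))" for z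
    proof -
      have c: "S k (S g y) = S (g + k) y" "S g (S k y) = S (g + k) y" for g y
        by (simp_all add: S_add[symmetric] add.commute)
      show ?thesis
        using inner_L2_twist[OF section_measurable(2)[OF Xm, of z k] section_measurable(1)[OF Xm, of z] B B l, of h]
        by (simp add: c)
    qed
    have "coords (\<lambda>p. X p + l * X (fst p, S h (snd p))) j =
      of_real (1 / measure M E0) * (\<integral>z. 2 * ?I k z + l * ?I (h + k) z + cnj l * ?I (- h + k) z \<partial>M)"
      by (simp add: coords_def Inl corr_def pw) (intro disjI2 Bochner_Integration.integral_cong, auto simp: algebra_simps)
    also have "\<dots> = of_real (1 / measure M E0) *
       (2 * (\<integral>z. ?I k z \<partial>M) + l * (\<integral>z. ?I (h + k) z \<partial>M) + cnj l * (\<integral>z. ?I (- h + k) z \<partial>M))"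
      using corr_integrable[OF Xm B] by simp
    also have "\<dots> = 2 * corr X k + l * corr X (h + k) + cnj l * corr X (- h + k)"
      by (simp add: corr_def algebra_simps)
    finally show ?thesis by (simp add: twist_def coords_def act_def Inl)
  next
    case (Inr A)
    show ?thesis
    proof (cases "A \<in> fmeasurable m")
      case True
      then have As: "A \<in> sets m" by auto
      have sh: "smear X (shifted g A) = (\<lambda>y. smear X A (S g y))" for g
        by (rule ext) (rule smear_shifted[OF Xm As])
      have tw: "smear (\<lambda>p. X p + l * X (fst p, S h (snd p))) A = (\<lambda>y. smear X A y + l * smear X A (S h y))"
        "contrast (\<lambda>p. X p + l * X (fst p, S h (snd p))) = (\<lambda>y. contrast X y + l * contrast X (S h y))"
        by (rule ext, rule smear_twist[OF Xm B True], rule ext, rule contrast_twist[OF Xm B])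
      define C where "C = max (B * measure m A) (2 * B)"
      have bd: "cmod (smear X A y) \<le> C" "cmod (contrast X y) \<le> C" for y
        using smear_bounded[OF True Xm B, of y] contrast_bounded[OF Xm B, of y] by (auto simp: C_def)
      show ?thesis
        using True fmeasurable_shifted(1)[OF True]
          inner_L2_twist[OF smear_measurable[OF Xm As] contrast_measurable[OF Xm] bd l, of h]
        by (simp add: twist_def coords_def act_def Inr sh tw)
    next
      case False
      \<comment> \<open>Translates of \<open>A\<close> fail to have finite measure together with
        \<open>A\<close>, so all terms take the filler value 0.\<close>
      have "shifted g A \<notin> fmeasurable m" for g
      proof
        assume "shifted g A \<in> fmeasurable m"
        then have "shifted (- g) (shifted g A) \<in> fmeasurable m" by (rule fmeasurable_shifted)
        moreover have "shifted (- g) (shifted g A) = A" by (auto simp: shifted_def)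
        ultimately show False using False by simp
      qed
      then show ?thesis using False by (simp add: twist_def coords_def act_def Inr)
    qed
  qed
qed

lemma fold_twist_coords:
  assumes "admissible X" "\<forall>q\<in>set qs. cmod (fst q) = 1"
  shows "\<exists>X'. admissible X' \<and> fold (twist act) qs (coords X) = coords X'"
  using assms
proof (induction qs arbitrary: X)
  case (Cons q qs)
  have "twist act q (coords X) = coords (\<lambda>p. X p + fst q * X (fst p, S (snd q) (snd p)))"
    using twist_coords[OF Cons.prems(1), of "fst q" "snd q"] Cons.prems(2) by simp
  then show ?case
    using Cons.IH[OF admissible_twist[OF Cons.prems(1), of "fst q" "snd q"]] Cons.prems(2) by simp
qed auto

text \<open>Cauchy-Schwarz in the form of a weighted inequality between arithmetic and geometric
  means; the weight \<open>s\<close> is chosen at each use as a ratio of norm bounds.\<close>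

lemma cmod_inner_L2_le:
  assumes [measurable]: "a \<in> borel_measurable N" "b \<in> borel_measurable N"
    and bd: "\<And>y. cmod (a y) \<le> B" "\<And>y. cmod (b y) \<le> B'" and s: "s > 0"
  shows "cmod (inner_L2 N a b) \<le> ((\<integral>y. (cmod (a y))\<^sup>2 \<partial>N) / s + s * (\<integral>y. (cmod (b y))\<^sup>2 \<partial>N)) / 2"
proof -
  have i: "integrable N (\<lambda>y. (cmod (a y))\<^sup>2)" "integrable N (\<lambda>y. (cmod (b y))\<^sup>2)"
    by (rule N.integrable_const_bound[where B = "B\<^sup>2"], use bd in \<open>auto intro!: power_mono\<close>)
       (rule N.integrable_const_bound[where B = "B'\<^sup>2"], use bd in \<open>auto intro!: power_mono\<close>)
  have B: "0 \<le> B" "0 \<le> B'" using bd[of undefined] norm_ge_zero order_trans by blast+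
  have le: "cmod (a y * cnj (b y)) \<le> B * B'" for y
    using bd[of y] B by (simp add: norm_mult mult_mono)
  have amgm: "x * y \<le> (x\<^sup>2 / s + s * y\<^sup>2) / 2" for x y :: real
  proof -
    have "0 \<le> (x - s * y)\<^sup>2 / s" using s by simp
    also have "\<dots> = x\<^sup>2 / s - 2 * (x * y) + s * y\<^sup>2"
      using s by (simp add: power2_eq_square field_simps)
    finally show ?thesis by simp
  qed
  have "cmod (inner_L2 N a b) \<le> (\<integral>y. ((cmod (a y))\<^sup>2 / s + s * (cmod (b y))\<^sup>2) / 2 \<partial>N)"
    unfolding inner_L2_def
  proof (rule norm_integral_le_AE[OF N.integrable_const_bound[where B = "B * B'"]])
    show "integrable N (\<lambda>y. ((cmod (a y))\<^sup>2 / s + s * (cmod (b y))\<^sup>2) / 2)" using i by simp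
    show "AE y in N. norm (a y * cnj (b y)) \<le> ((cmod (a y))\<^sup>2 / s + s * (cmod (b y))\<^sup>2) / 2"
      using amgm by (simp add: norm_mult)
  qed (use le in auto)
  also have "\<dots> = ((\<integral>y. (cmod (a y))\<^sup>2 \<partial>N) / s + s * (\<integral>y. (cmod (b y))\<^sup>2 \<partial>N)) / 2"
    using i by simp
  finally show ?thesis .
qed

lemma corr_0:
  assumes X: "admissible X" and c: "AE z in M. msq X z = c"
  shows "corr X 0 = of_real c"
proof -
  note Xm = admissibleD(1)[OF X]
  have [measurable]: "E0 \<in> sets M" using E0 by auto
  note [measurable] = inner_section_measurable[OF Xm]
  have eq: "inner_L2 N (\<lambda>y. X (z, S 0 y)) (\<lambda>y. X (z, y)) = of_real (msq X z)" for z
    using mp_actionD(2)[OF S] by (simp add: inner_L2_def msq_def complex_norm_square[symmetric] of_real_power[symmetric] del: of_real_power)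
  have "(\<integral>z. indicator E0 z * inner_L2 N (\<lambda>y. X (z, S 0 y)) (\<lambda>y. X (z, y)) \<partial>M) = (\<integral>z. of_real (c * indicator E0 z) \<partial>M)"
  proof (rule Bochner_Integration.integral_cong_AE)
    show "AE z in M. indicator E0 z * inner_L2 N (\<lambda>y. X (z, S 0 y)) (\<lambda>y. X (z, y)) = of_real (c * indicator E0 z)"
      using c by eventually_elim (simp add: eq indicator_def)
  qed measurable
  also have "\<dots> = of_real (c * measure M E0)" using E0 by (simp only: integral_complex_of_real) simp
  finally show ?thesis using E0(2) by (simp add: corr_def)
qed

text \<open>Each coordinate is an inner product, or an average of such, of vectors whose norms are
  controlled by \<open>c\<close>; and \<open>c\<close> is the coordinate at
  \<open>Inl 0\<close>.\<close>

lemma coords_bound: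
  assumes X: "admissible X"
  shows "cmod (coords X j) \<le> bnd j * Re (coords X (Inl 0))"
proof -
  obtain B where B: "\<And>p. cmod (X p) \<le> B" using X by (auto simp: admissible_def)
  note Xm = admissibleD(1)[OF X]
  obtain c where c: "AE z in M. msq X z = c" using msq_const[OF X] by blast
  have c0: "coords X (Inl 0) = of_real c" using corr_0[OF X c] by (simp add: coords_def)
  show ?thesis
  proof (cases j)
    case (Inl h)
    have [measurable]: "E0 \<in> sets M" using E0 by auto
    have le: "cmod (inner_L2 N (\<lambda>y. X (z, S h y)) (\<lambda>y. X (z, y))) \<le> msq X z" for z
    proof -
      have "(\<integral>y. (cmod (X (z, S h y)))\<^sup>2 \<partial>N) = msq X z"
        unfolding msq_def by (rule integral_S) (use section_measurable[OF Xm] in measurable)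
      then show ?thesis
        using cmod_inner_L2_le[OF section_measurable(2)[OF Xm, of z h] section_measurable(1)[OF Xm, of z] B B, of 1]
        by (simp add: msq_def)
    qed
    have "cmod (\<integral>z. indicator E0 z * inner_L2 N (\<lambda>y. X (z, S h y)) (\<lambda>y. X (z, y)) \<partial>M) \<le> (\<integral>z. c * indicator E0 z \<partial>M)"
    proof (rule norm_integral_le_AE)
      show "AE z in M. norm (indicator E0 z * inner_L2 N (\<lambda>y. X (z, S h y)) (\<lambda>y. X (z, y))) \<le> c * indicator E0 z"
        using c by eventually_elim (use le in \<open>auto simp: indicator_def\<close>)
    qed (use E0 corr_integrable[OF Xm B] in \<open>auto simp: fmeasurable_def\<close>)
    also have "\<dots> = c * measure M E0" using E0 by simp
    finally have "cmod (corr X h) \<le> c"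
      using E0(2) by (simp add: corr_def norm_mult norm_divide field_simps)
    then show ?thesis using c0 by (simp add: Inl coords_def bnd_def)
  next
    case (Inr A)
    show ?thesis
    proof (cases "A \<in> fmeasurable m")
      case False
      \<comment> \<open>Needed even for the filler coordinate 0. The almost sure inequality yields
        it because \<open>E0\<close> shows that \<open>M\<close> is not the zero measure.\<close>
      moreover have "0 \<le> c"
      proof -
        have "AE z in M. 0 \<le> c" using c by eventually_elim (auto simp: msq_def)
        moreover have "emeasure M (space M) \<noteq> 0"
        proof
          assume "emeasure M (space M) = 0"
          then have "emeasure M E0 = 0" using emeasure_space[of M E0] by simp
          then show False using E0(2) by (simp add: measure_def)
        qed
        ultimately show ?thesis using ae_filter_eq_bot_iff[of M] by (auto simp: eventually_const_iff)
      qed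
      ultimately show ?thesis using c0 by (simp add: Inr coords_def bnd_def)
    next
      case True
      then have As: "A \<in> sets m" by auto
      note sm = smear_measurable[OF Xm As] and cm = contrast_measurable[OF Xm]
      have Es: "E \<in> sets m" "F \<in> sets m" using E F by auto
      note [measurable] = sm cm smear_measurable[OF Xm Es(1)] smear_measurable[OF Xm Es(2)]
      have ca: "(\<integral>y. (cmod (smear X A y))\<^sup>2 \<partial>N) \<le> (measure m A)\<^sup>2 * c"
        by (rule smear_msq_le[OF X c True])
      \<comment> \<open>Each normalised window average has squared norm at most \<open>c\<close>,
        and the squared modulus of a difference is at most twice the sum of the squared moduli,
        which gives 4.\<close>
      have cb: "(\<integral>y. (cmod (contrast X y))\<^sup>2 \<partial>N) \<le> 4 * c"
      proof -
        let ?e = "\<lambda>y. (2 / (measure m E)\<^sup>2) * (cmod (smear X E y))\<^sup>2"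
        let ?f = "\<lambda>y. (2 / (measure m F)\<^sup>2) * (cmod (smear X F y))\<^sup>2"
        have sq: "integrable N (\<lambda>y. (cmod (g y))\<^sup>2)" if [measurable]: "g \<in> borel_measurable N"
          and "\<And>y. cmod (g y) \<le> C" for g :: "'y \<Rightarrow> complex" and C
          by (rule N.integrable_const_bound[where B = "C\<^sup>2"]) (use that(2) in \<open>auto intro!: power_mono\<close>)
        have ie: "integrable N ?e" "integrable N ?f"
          by (intro integrable_mult_right sq[OF _ smear_bounded[OF E(1) Xm B]] sq[OF _ smear_bounded[OF F(1) Xm B]], measurable)+
        have "(\<integral>y. (cmod (contrast X y))\<^sup>2 \<partial>N) \<le> (\<integral>y. ?e y + ?f y \<partial>N)"
        proof (rule Bochner_Integration.integral_mono)
          show "integrable N (\<lambda>y. (cmod (contrast X y))\<^sup>2)"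
            by (rule sq[OF cm contrast_bounded[OF Xm B]])
          show "integrable N (\<lambda>y. ?e y + ?f y)" using ie by simp
          fix y
          let ?a = "cmod (of_real (1 / measure m E) * smear X E y)" and ?b = "cmod (of_real (1 / measure m F) * smear X F y)"
          have "(cmod (contrast X y))\<^sup>2 \<le> (?a + ?b)\<^sup>2"
            unfolding contrast_def by (intro power_mono norm_triangle_ineq4) auto
          also have "\<dots> \<le> 2 * ?a\<^sup>2 + 2 * ?b\<^sup>2"
            using sum_squares_bound[of ?a ?b] by (simp add: power2_eq_square algebra_simps)
          also have "\<dots> = ?e y + ?f y"
            by (simp add: norm_mult norm_divide power_divide power_mult_distrib)
          finally show "(cmod (contrast X y))\<^sup>2 \<le> ?e y + ?f y" .
        qed
        also have "\<dots> = (2 / (measure m E)\<^sup>2) * (\<integral>y. (cmod (smear X E y))\<^sup>2 \<partial>N)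
            + (2 / (measure m F)\<^sup>2) * (\<integral>y. (cmod (smear X F y))\<^sup>2 \<partial>N)"
          using ie by (subst Bochner_Integration.integral_add) auto
        also have "\<dots> \<le> (2 / (measure m E)\<^sup>2) * ((measure m E)\<^sup>2 * c) + (2 / (measure m F)\<^sup>2) * ((measure m F)\<^sup>2 * c)"
          using smear_msq_le[OF X c E(1)] smear_msq_le[OF X c F(1)]
          by (intro add_mono mult_left_mono) auto
        also have "\<dots> = 4 * c" using E(2) F(2) by simp
        finally show ?thesis .
      qed
      have "cmod (inner_L2 N (smear X A) (contrast X)) \<le> 2 * measure m A * c"
      proof (cases "measure m A = 0")
        case True
        have "smear X A y = 0" for y
          using smear_bounded[OF \<open>A \<in> fmeasurable m\<close> Xm B, of y] True by simp
        then show ?thesis using True by (simp add: inner_L2_def)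
      next
        case False
        \<comment> \<open>The weight \<open>measure m A / 2\<close> is the ratio of the two norm
          bounds; with it both summands equal \<open>2 * measure m A * c\<close> before halving, so
          nothing is lost.\<close>
        then have pos: "measure m A / 2 > 0" by (simp add: zero_less_measure_iff)
        have "cmod (inner_L2 N (smear X A) (contrast X)) \<le>
          ((\<integral>y. (cmod (smear X A y))\<^sup>2 \<partial>N) / (measure m A / 2) + (measure m A / 2) * (\<integral>y. (cmod (contrast X y))\<^sup>2 \<partial>N)) / 2"
          by (rule cmod_inner_L2_le[OF sm cm smear_bounded[OF \<open>A \<in> fmeasurable m\<close> Xm B] contrast_bounded[OF Xm B] pos])
        also have "\<dots> \<le> (((measure m A)\<^sup>2 * c) / (measure m A / 2) + (measure m A / 2) * (4 * c)) / 2"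
          using ca cb pos by (intro divide_right_mono add_mono mult_left_mono) auto
        also have "\<dots> = 2 * measure m A * c" using pos by (simp add: power2_eq_square field_simps)
        finally show ?thesis .
      qed
      then show ?thesis using c0 True by (simp add: Inr coords_def bnd_def)
    qed
  qed
qed

lemma dominated_coords:
  assumes "admissible X"
  shows "dominated act bnd (Inl 0) (coords X)"
  unfolding dominated_def
proof (intro allI impI)
  fix qs :: "(complex \<times> 'g) list" and j assume "\<forall>q\<in>set qs. cmod (fst q) = 1"
  then obtain X' where "admissible X'" "fold (twist act) qs (coords X) = coords X'"
    using fold_twist_coords[OF assms] by blast
  then show "cmod (fold (twist act) qs (coords X) j) \<le> bnd j * Re (fold (twist act) qs (coords X) (Inl 0))"
    using coords_bound by simp
qed

text \<open>Finite additivity and \<open>\<Gamma>\<close>-invariance are pointwise equations, hence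
  closed in the product topology and stable under twists. Countable additivity is recovered
  afterwards from the bound \<open>bnd\<close>.\<close>

definition additive_coords :: "('g + ('z \<times> 'g) set \<Rightarrow> complex) set" where
  "additive_coords = {f. (\<forall>A\<in>fmeasurable m. \<forall>B\<in>fmeasurable m. A \<inter> B = {} \<longrightarrow> f (Inr (A \<union> B)) = f (Inr A) + f (Inr B)) \<and>
     (\<forall>A\<in>fmeasurable m. f (Inr (\<Gamma> -` A)) = f (Inr A))}"

lemma closed_additive_coords: "closed additive_coords"
  unfolding additive_coords_def Ball_def
  by (intro closed_Collect_conj closed_Collect_all closed_Collect_imp open_Collect_const
      closed_Collect_eq continuous_intros continuous_on_product_coordinates)

lemma additive_coords_twist:
  assumes f: "f \<in> additive_coords"
  shows "twist act q f \<in> additive_coords"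
proof -
  have add: "f (Inr (A \<union> B)) = f (Inr A) + f (Inr B)" if "A \<in> fmeasurable m" "B \<in> fmeasurable m" "A \<inter> B = {}" for A B
    using f that by (auto simp: additive_coords_def)
  have inv: "f (Inr (\<Gamma> -` A)) = f (Inr A)" if "A \<in> fmeasurable m" for A
    using f that by (auto simp: additive_coords_def)
  have Un: "shifted h (A \<union> B) = shifted h A \<union> shifted h B" for h A B by (auto simp: shifted_def)
  have Int: "shifted h A \<inter> shifted h B = {}" if "A \<inter> B = {}" for h A B using that by (auto simp: shifted_def)
  have \<Gamma>sh: "shifted h (\<Gamma> -` A) = \<Gamma> -` shifted h A" for h A
    by (auto simp: shifted_def group_ext_def algebra_simps split_beta)
  show ?thesis
    unfolding additive_coords_def
    using add inv fmeasurable_shifted(1) Int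
    by (simp add: twist_def act_def Un \<Gamma>sh algebra_simps)
qed

lemma additive_coords_scale:
  assumes "f \<in> additive_coords"
  shows "(\<lambda>j. of_real c * f j) \<in> additive_coords"
  using assms by (simp add: additive_coords_def algebra_simps)

lemma coords_additive:
  assumes X: "admissible X"
  shows "coords X \<in> additive_coords"
proof -
  obtain B where B: "\<And>p. cmod (X p) \<le> B" using X by (auto simp: admissible_def)
  note Xm = admissibleD(1)[OF X]
  have "coords X (Inr (A \<union> A')) = coords X (Inr A) + coords X (Inr A')"
    if A: "A \<in> fmeasurable m" "A' \<in> fmeasurable m" "A \<inter> A' = {}" for A A'
  proof -
    have U: "A \<union> A' \<in> fmeasurable m" using A by (intro fmeasurable.Un)
    have int: "integrable N (\<lambda>y. smear X A y * cnj (contrast X y))" if A: "A \<in> fmeasurable m" for A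
    proof -
      have [measurable]: "smear X A \<in> borel_measurable N" "contrast X \<in> borel_measurable N"
        using smear_measurable[OF Xm] contrast_measurable[OF Xm] A by auto
      have "cmod (smear X A y * cnj (contrast X y)) \<le> (B * measure m A) * (2 * B)" for y
      proof -
        have "0 \<le> B" using B[of undefined] norm_ge_zero order_trans by blast
        then show ?thesis
          using smear_bounded[OF A Xm B, of y] contrast_bounded[OF Xm B, of y]
          unfolding norm_mult complex_mod_cnj by (intro mult_mono) auto
      qed
      then show ?thesis by (intro N.integrable_const_bound) auto
    qed
    have "inner_L2 N (smear X (A \<union> A')) (contrast X) =
      (\<integral>y. smear X A y * cnj (contrast X y) + smear X A' y * cnj (contrast X y) \<partial>N)"
      by (simp add: inner_L2_def smear_Un[OF Xm B A] algebra_simps)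
    then show ?thesis using A U int by (simp add: coords_def inner_L2_def)
  qed
  moreover have "coords X (Inr (\<Gamma> -` A)) = coords X (Inr A)" if "A \<in> fmeasurable m" for A
  proof -
    have "smear X (\<Gamma> -` A) = smear X A" using that by (intro ext smear_\<Gamma>[OF X]) auto
    then show ?thesis using that fmeasurable_\<Gamma>[OF that] by (simp add: coords_def)
  qed
  ultimately show ?thesis by (simp add: additive_coords_def)
qed

text \<open>On coordinates of an admissible function this is the squared norm of the contrast. It
  vanishes when the window functional is a multiple of \<open>m\<close>, so a positive value
  excludes the trivial character.\<close>

definition gap :: "('g + ('z \<times> 'g) set \<Rightarrow> complex) \<Rightarrow> real" where
  "gap f = Re (f (Inr E)) / measure m E - Re (f (Inr F)) / measure m F"

lemma gap_coords:
  assumes X: "admissible X"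
  shows "gap (coords X) = (\<integral>y. (cmod (contrast X y))\<^sup>2 \<partial>N)"
proof -
  obtain B where B: "\<And>p. cmod (X p) \<le> B" using X by (auto simp: admissible_def)
  note Xm = admissibleD(1)[OF X]
  have int: "integrable N (\<lambda>y. smear X A y * cnj (contrast X y))" if A: "A \<in> fmeasurable m" for A
  proof -
    have [measurable]: "smear X A \<in> borel_measurable N" "contrast X \<in> borel_measurable N"
      using smear_measurable[OF Xm] contrast_measurable[OF Xm] A by auto
    have "cmod (smear X A y * cnj (contrast X y)) \<le> (B * measure m A) * (2 * B)" for y
    proof -
      have "0 \<le> B" using B[of undefined] norm_ge_zero order_trans by blast
      then show ?thesis
        using smear_bounded[OF A Xm B, of y] contrast_bounded[OF Xm B, of y]
        unfolding norm_mult complex_mod_cnj by (intro mult_mono) auto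
    qed
    then show ?thesis by (intro N.integrable_const_bound) auto
  qed
  have "of_real (1 / measure m E) * inner_L2 N (smear X E) (contrast X)
      - of_real (1 / measure m F) * inner_L2 N (smear X F) (contrast X)
    = (\<integral>y. of_real (1 / measure m E) * (smear X E y * cnj (contrast X y))
      - of_real (1 / measure m F) * (smear X F y * cnj (contrast X y)) \<partial>N)"
    using int[OF E(1)] int[OF F(1)]
    by (simp only: inner_L2_def Bochner_Integration.integral_diff integrable_mult_right integral_mult_right_zero)
  also have "\<dots> = (\<integral>y. of_real ((cmod (contrast X y))\<^sup>2) \<partial>N)"
  proof (intro Bochner_Integration.integral_cong refl)
    fix y
    have "of_real (1 / measure m E) * (smear X E y * cnj (contrast X y))
      - of_real (1 / measure m F) * (smear X F y * cnj (contrast X y)) = contrast X y * cnj (contrast X y)"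
      unfolding contrast_def by (simp only: left_diff_distrib mult.assoc)
    then show "of_real (1 / measure m E) * (smear X E y * cnj (contrast X y))
      - of_real (1 / measure m F) * (smear X F y * cnj (contrast X y)) = of_real ((cmod (contrast X y))\<^sup>2)"
      by (simp only: complex_norm_square)
  qed
  also have "\<dots> = of_real (\<integral>y. (cmod (contrast X y))\<^sup>2 \<partial>N)" by (rule integral_complex_of_real)
  finally have "Re (of_real (1 / measure m E) * inner_L2 N (smear X E) (contrast X)
      - of_real (1 / measure m F) * inner_L2 N (smear X F) (contrast X)) = (\<integral>y. (cmod (contrast X y))\<^sup>2 \<partial>N)"
    by (simp only: Re_complex_of_real)
  then show ?thesis using E(1) F(1) by (simp add: gap_def coords_def Re_divide_of_real)
qed

lemma continuous_gap: "continuous_on UNIV gap"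
  unfolding gap_def[abs_def] divide_inverse
  by (intro continuous_intros continuous_on_Re continuous_on_product_coordinates)

text \<open>The extreme point is taken among the maximisers of \<open>gap\<close>, so its gap is at
  least that of the starting point, where it is the squared norm of the contrast divided by
  \<open>c\<close>.\<close>

lemma eigen_coords_exists:
  assumes X: "admissible X" and pos: "(\<integral>y. (cmod (contrast X y))\<^sup>2 \<partial>N) > 0" and nz: "\<not> (AE z in M. msq X z = 0)"
  shows "\<exists>f ch. f \<in> additive_coords \<and> (\<forall>A. cmod (f (Inr A)) \<le> 2 * measure m A) \<and> 0 < gap f \<and>
     (\<forall>h A. f (Inr (shifted h A)) = ch h * f (Inr A)) \<and> (\<forall>h. cmod (ch h) = 1)"
proof -
  obtain c where c: "AE z in M. msq X z = c" using msq_const[OF X] by blast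
  have cpos: "c > 0"
  proof -
    have "c \<noteq> 0" using c nz by auto
    moreover have "\<not> c < 0"
    proof
      assume "c < 0"
      have "AE z in M. msq X z = 0"
        using c
      proof eventually_elim
        case (elim z)
        have "0 \<le> msq X z" by (simp add: msq_def)
        then show ?case using elim \<open>c < 0\<close> by simp
      qed
      then show False using nz by simp
    qed
    ultimately show ?thesis by simp
  qed
  \<comment> \<open>Division by the constant squared norm normalises the coordinate at
    \<open>Inl 0\<close> to 1.\<close>
  define f0 where "f0 = (\<lambda>j. of_real (1 / c) * coords X j)"
  have "\<exists>f ch. f \<in> additive_coords \<and> (\<forall>j. cmod (f j) \<le> bnd j) \<and> gap f0 \<le> gap f \<and> (\<forall>h j. f (act h j) = ch h * f j) \<and>
     (\<forall>g h. ch (g + h) = ch g * ch h) \<and> (\<forall>h. cmod (ch h) = 1)"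
  proof (rule dominated_eigenfunction_exists)
    show "act 0 j = j" for j by (cases j) (auto simp: act_def shifted_def)
    show "act (g + h) j = act g (act h j)" for g h j
      by (cases j) (auto simp: act_def shifted_def algebra_simps)
    show "bnd (act h (Inl 0)) = 1" for h by (simp add: bnd_def act_def)
    show "closed additive_coords" by (rule closed_additive_coords)
    show "twist act q f \<in> additive_coords" if "f \<in> additive_coords" for f q
      using that by (rule additive_coords_twist)
    show "(\<lambda>j. of_real c * f j) \<in> additive_coords" if "f \<in> additive_coords" for f c
      using that by (rule additive_coords_scale)
    show "f0 \<in> additive_coords" unfolding f0_def by (intro additive_coords_scale coords_additive X)
    show "dominated act bnd (Inl 0) f0"
      unfolding f0_def using cpos by (intro dominated_scale dominated_coords X) auto
    show "f0 (Inl 0) = 1" using corr_0[OF X c] cpos by (simp add: f0_def coords_def)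
    show "continuous_on UNIV gap" by (rule continuous_gap)
    show "gap (\<lambda>j. of_real t * a j + of_real (1 - t) * b j) = t * gap a + (1 - t) * gap b" for a b t
      by (simp add: gap_def algebra_simps add_divide_distrib diff_divide_distrib)
  qed
  then obtain f ch where f: "f \<in> additive_coords" "\<And>j. cmod (f j) \<le> bnd j" "gap f0 \<le> gap f"
    "\<And>h j. f (act h j) = ch h * f j" "\<And>h. cmod (ch h) = 1" by blast
  have "gap f0 = gap (coords X) / c" by (simp add: f0_def gap_def diff_divide_distrib mult.commute)
  also have "\<dots> > 0" using cpos pos gap_coords[OF X] by simp
  finally have "0 < gap f" using f(3) by simp
  then show ?thesis
    using f(1,5) f(2)[of "Inr _"] f(4)[of _ "Inr _"] by (intro exI[of _ f] exI[of _ ch]) (simp add: bnd_def act_def)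
qed

text \<open>The window functional at the extreme point has a bounded density, which inherits
  \<open>\<Gamma>\<close>-invariance and the translation eigenvalue. It therefore splits as a
  character times a function \<open>v\<close> on the base, and invariance under
  \<open>\<Gamma>\<close> becomes the twisted equation for \<open>v\<close>.\<close>

lemma eigenfunction_exists:
  assumes X: "admissible X" and pos: "(\<integral>y. (cmod (contrast X y))\<^sup>2 \<partial>N) > 0" and nz: "\<not> (AE z in M. msq X z = 0)"
  shows "\<exists>ch v. cont_character ch \<and> (\<exists>h. ch h \<noteq> 1) \<and> v \<in> borel_measurable M \<and> (\<forall>z. cmod (v z) \<le> 4) \<and>
    (AE z in M. v (Q z) * ch (\<psi> z) = v z) \<and> \<not> (AE z in M. v z = 0)"
proof -
  obtain f ch where f: "f \<in> additive_coords" "\<And>A. cmod (f (Inr A)) \<le> 2 * measure m A" "0 < gap f"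
    "\<And>h A. f (Inr (shifted h A)) = ch h * f (Inr A)" and norm1: "\<And>h. cmod (ch h) = 1"
    using eigen_coords_exists[OF assms] by blast
  \<comment> \<open>The first 2 is the one in \<open>bnd\<close>; the second is the loss from
    treating real and imaginary parts separately.\<close>
  have "\<exists>u\<in>borel_measurable m. (\<forall>p. cmod (u p) \<le> 2 * 2) \<and>
    (\<forall>A\<in>fmeasurable m. (\<integral>p. indicator A p * u p \<partial>m) = f (Inr A))"
    by (rule sigma_finite_measure.additive_bounded_density[OF PL.sigma_finite_measure_axioms]) (use f(1,2) in \<open>auto simp: additive_coords_def\<close>)
  then obtain u where u[measurable]: "u \<in> borel_measurable m" and ub: "\<And>p. cmod (u p) \<le> 4"
    and uA: "\<And>A. A \<in> fmeasurable m \<Longrightarrow> (\<integral>p. indicator A p * u p \<partial>m) = f (Inr A)" by auto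
  have eig: "AE p in m. u (fst p, h + snd p) = ch h * u p" for h
  proof (rule sigma_finite_measure.AE_eq_if_integrals_eq[OF PL.sigma_finite_measure_axioms, where C = 4])
    have tr: "(\<lambda>p. (fst p, h + snd p)) \<in> m \<rightarrow>\<^sub>M m" by (rule mp_isoD(2)[OF mp_iso_translation[OF sfM spM]])
    show "(\<lambda>p. u (fst p, h + snd p)) \<in> borel_measurable m" by (rule measurable_compose[OF tr u])
    fix A assume A: "A \<in> fmeasurable m"
    then have As[measurable]: "A \<in> sets m" by auto
    have [measurable]: "shifted h A \<in> sets m" using fmeasurable_shifted(1)[OF A] by (rule fmeasurableD)
    have "(\<integral>p. indicator A p * u (fst p, h + snd p) \<partial>m) =
      (\<integral>p. indicator (shifted h A) (fst p, h + snd p) * u (fst p, h + snd p) \<partial>m)"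
      by (intro Bochner_Integration.integral_cong) (auto simp: shifted_def indicator_def)
    also have "\<dots> = (\<integral>p. indicator (shifted h A) p * u p \<partial>m)"
      by (rule integral_translation[OF sfM spM]) measurable
    also have "\<dots> = ch h * (\<integral>p. indicator A p * u p \<partial>m)"
      by (simp add: uA[OF A] uA[OF fmeasurable_shifted(1)[OF A]] f(4))
    also have "\<dots> = (\<integral>p. indicator A p * (ch h * u p) \<partial>m)"
      by (subst integral_mult_right_zero[symmetric]) (simp add: ac_simps)
    finally show "(\<integral>p. indicator A p * u (fst p, h + snd p) \<partial>m) = (\<integral>p. indicator A p * (ch h * u p) \<partial>m)" .
  qed (use ub norm1 in \<open>auto simp: norm_mult\<close>)
  have inv: "AE p in m. u (\<Gamma> p) = u p"
  proof (rule sigma_finite_measure.AE_eq_if_integrals_eq[OF PL.sigma_finite_measure_axioms, where C = 4])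
    fix A assume A: "A \<in> fmeasurable m"
    then have As[measurable]: "A \<in> sets m" by auto
    obtain \<Gamma>' where \<Gamma>': "\<Gamma>' \<in> m \<rightarrow>\<^sub>M m" "\<And>p. \<Gamma>' (\<Gamma> p) = p" "\<And>p. \<Gamma> (\<Gamma>' p) = p"
      using \<Gamma> by (auto simp: mp_iso_def)
    define B where "B = \<Gamma>' -` A"
    have Bs[measurable]: "B \<in> sets m" using measurable_sets[OF \<Gamma>'(1) As] by (simp add: B_def sp_m)
    \<comment> \<open>Invariance of the functional concerns preimages under \<open>\<Gamma>\<close>,
      so \<open>A\<close> is first written as one.\<close>
    have AB: "A = \<Gamma> -` B" by (rule set_eqI) (simp only: B_def vimage_eq \<Gamma>'(2))
    have "emeasure m B = emeasure (distr m m \<Gamma>) B" by (simp add: mp_isoD(3)[OF \<Gamma>])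
    also have "\<dots> = emeasure m A" using emeasure_distr[OF mp_isoD(2)[OF \<Gamma>] Bs] by (simp only: AB sp_m Int_UNIV_right)
    finally have B: "B \<in> fmeasurable m" using A Bs by (auto simp: fmeasurable_def)
    have "(\<integral>p. indicator A p * u (\<Gamma> p) \<partial>m) = (\<integral>p. indicator B (\<Gamma> p) * u (\<Gamma> p) \<partial>m)"
      unfolding AB by (simp add: indicator_def)
    also have "\<dots> = (\<integral>p. indicator B p * u p \<partial>distr m m \<Gamma>)"
      by (rule integral_distr[symmetric]) measurable
    also have "\<dots> = f (Inr B)" by (simp add: mp_isoD(3)[OF \<Gamma>] uA[OF B])
    also have "\<dots> = f (Inr A)" using f(1) B by (simp add: AB additive_coords_def)
    finally show "(\<integral>p. indicator A p * u (\<Gamma> p) \<partial>m) = (\<integral>p. indicator A p * u p \<partial>m)" by (simp add: uA[OF A])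
  qed (use ub in auto)
  have unz: "\<not> (AE p in m. u p = 0)"
  proof
    assume ae: "AE p in m. u p = 0"
    have "f (Inr A) = 0" if A: "A \<in> fmeasurable m" for A
    proof -
      have [measurable]: "A \<in> sets m" using A by auto
      have "(\<integral>p. indicator A p * u p \<partial>m) = (\<integral>p. 0 \<partial>m)"
        by (rule Bochner_Integration.integral_cong_AE) (use ae in auto)
      then show ?thesis using uA[OF A] by simp
    qed
    then show False using f(3) E F by (simp add: gap_def)
  qed
  have chr: "cont_character ch"
    by (rule translation_eigenfunction_character[OF sfM spM u ub unz eig norm1])
  obtain v where v[measurable]: "v \<in> borel_measurable M" and vb: "\<And>z. cmod (v z) \<le> 4"
    and uv: "AE p in m. u p = ch (snd p) * v (fst p)"
    using translation_eigenfunction_factor[OF sfM spM u ub eig chr] by blast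
  have hom: "ch (a + b) = ch a * ch b" for a b using chr by (simp add: cont_character_def)
  have vQ: "AE z in M. v (Q z) * ch (\<psi> z) = v z"
  proof -
    have "AE p in m. v (Q (fst p)) * ch (\<psi> (fst p)) = v (fst p)"
      using mp_iso_AE[OF \<Gamma> uv] uv inv
    proof eventually_elim
      case (elim p)
      have "ch (\<psi> (fst p) + snd p) * v (Q (fst p)) = ch (snd p) * v (fst p)"
        using elim by (simp add: group_ext_def split_beta)
      moreover have "ch (snd p) \<noteq> 0" using norm1[of "snd p"] by auto
      ultimately show ?case by (simp add: hom mult.commute)
    qed
    then have "AE z in M. AE g in L. v (Q z) * ch (\<psi> z) = v z" using PL.AE_pair by fastforce
    then show ?thesis by eventually_elim (rule AE_L_const)
  qed
  have vnz: "\<not> (AE z in M. v z = 0)"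
  proof
    assume "AE z in M. v z = 0"
    then have "AE p in m. v (fst p) = 0" by (rule AE_pair_fst[OF sigma_finite_L])
    with uv have "AE p in m. u p = 0" by eventually_elim simp
    with unz show False by simp
  qed
  \<comment> \<open>For the trivial character \<open>v\<close> would be \<open>Q\<close>-invariant,
    hence constant, so the functional would be a multiple of \<open>m\<close> and the gap
    zero.\<close>
  have "\<exists>h. ch h \<noteq> 1"
  proof (rule ccontr)
    assume "\<not> ?thesis"
    then have one: "ch h = 1" for h by simp
    have "AE z in M. v (Q z) = v z" using vQ by (simp add: one)
    then obtain k where "AE z in M. v z = k"
      using ergodic_map_AE_invariant_const[OF ergQ distr_Q v] by blast
    then have "AE p in m. v (fst p) = k" by (rule AE_pair_fst[OF sigma_finite_L])
    with uv have uk: "AE p in m. u p = k" by eventually_elim (simp add: one)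
    have "f (Inr A) = k * of_real (measure m A)" if A: "A \<in> fmeasurable m" for A
    proof -
      have [measurable]: "A \<in> sets m" using A by auto
      have "(\<integral>p. indicator A p * u p \<partial>m) = (\<integral>p. k * of_real (indicator A p) \<partial>m)"
        by (rule Bochner_Integration.integral_cong_AE) (use uk in \<open>auto simp: indicator_def\<close>)
      also have "\<dots> = k * of_real (measure m A)"
        using A by (simp only: integral_mult_right_zero integral_complex_of_real) simp
      finally show ?thesis using uA[OF A] by simp
    qed
    then show False using f(3) E F by (simp add: gap_def)
  qed
  then show ?thesis using chr v vb vQ vnz by blast
qed

end

context rokhlin_system
begin

text \<open>If no window detects a variation of \<open>\<omega> \<mapsto> X (z, S g y)\<close>, this function depends on \<open>y\<close> only, so
  every \<open>S\<close>-orbit meets the sections of \<open>D\<close> trivially.\<close>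
lemma nonergodic_rokhlin_eigenfunction:
  assumes ergS: "ergodic_action N S" and nerg: "\<not> ergodic_map (M \<Otimes>\<^sub>M N) (rokhlin_ext Q \<psi> S)"
  shows "\<exists>ch v. cont_character ch \<and> (\<exists>h. ch h \<noteq> 1) \<and> v \<in> borel_measurable M \<and> (\<forall>z. cmod (v z) \<le> 4) \<and>
    (AE z in M. v (Q z) * ch (\<psi> z) = v z) \<and> \<not> (AE z in M. v z = 0)"
proof -
  have iso: "mp_iso (M \<Otimes>\<^sub>M N) (rokhlin_ext Q \<psi> S)"
    by (rule mp_iso_rokhlin_ext[OF sfM N.sigma_finite_measure_axioms Q \<psi> spN S])
  obtain D where D[measurable]: "D \<in> sets (M \<Otimes>\<^sub>M N)"
    and Dinv: "rokhlin_ext Q \<psi> S -` D \<inter> space (M \<Otimes>\<^sub>M N) = D"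
    and triv: "\<not> ((AE p in M \<Otimes>\<^sub>M N. p \<in> D) \<or> (AE p in M \<Otimes>\<^sub>M N. p \<notin> D))"
    using nerg ergodic_mapI[OF mp_isoD(2)[OF iso]] by blast
  define X where "X p = (indicator D p :: complex)" for p
  have Xm[measurable]: "X \<in> borel_measurable (M \<Otimes>\<^sub>M N)" unfolding X_def by measurable
  have XB: "cmod (X p) \<le> 1" for p by (simp add: X_def indicator_def)
  have Dinv': "(Q z, S (\<psi> z) y) \<in> D \<longleftrightarrow> (z, y) \<in> D" for z y
  proof -
    have "(z, y) \<in> rokhlin_ext Q \<psi> S -` D \<inter> space (M \<Otimes>\<^sub>M N) \<longleftrightarrow> (z, y) \<in> D" by (simp only: Dinv)
    then show ?thesis by (simp add: sp_m rokhlin_ext_def)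
  qed
  have X: "admissible X"
    unfolding admissible_def using Xm XB Dinv' by (auto simp: X_def indicator_def)
  have nz: "\<not> (AE z in M. msq X z = 0)"
  proof
    assume "AE z in M. msq X z = 0"
    then have "AE z in M. AE y in N. (z, y) \<notin> D"
    proof eventually_elim
      case (elim z)
      note [measurable] = section_measurable(1)[OF Xm, of z]
      have "AE y in N. (cmod (X (z, y)))\<^sup>2 = 0"
        using elim unfolding msq_def
        by (subst (asm) integral_nonneg_eq_0_iff_AE)
           (use XB in \<open>auto intro!: N.integrable_const_bound[where B = 1] simp: power_le_one\<close>)
      then show ?case by eventually_elim (auto simp: X_def)
    qed
    moreover have "{p \<in> space (M \<Otimes>\<^sub>M N). p \<notin> D} \<in> sets (M \<Otimes>\<^sub>M N)" by measurable
    ultimately have "AE p in M \<Otimes>\<^sub>M N. p \<notin> D" by (intro MN.AE_pair_measure)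
    with triv show False by simp
  qed
  obtain E0 where E0: "E0 \<in> fmeasurable M" "measure M E0 > 0"
  proof -
    obtain A :: "nat \<Rightarrow> 'z set" where A: "range A \<subseteq> sets M" "(\<Union>i. A i) = space M" "\<And>i. emeasure M (A i) \<noteq> \<infinity>"
      using M.sigma_finite by metis
    have "\<exists>i. emeasure M (A i) \<noteq> 0"
    proof (rule ccontr)
      assume "\<not> ?thesis"
      then have "A i \<in> null_sets M" for i using A(1) by (auto simp: null_sets_def)
      then have "(\<Union>i. A i) \<in> null_sets M" by (rule null_sets_UN)
      then have null: "space M \<in> null_sets M" using A(2) by simp
      have "AE z in M. msq X z = 0"
        by (rule AE_I'[OF null]) auto
      with nz show False by contradiction
    qed
    then obtain i where "emeasure M (A i) \<noteq> 0" by blast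
    then have "A i \<in> fmeasurable M" "measure M (A i) > 0"
      using A(1,3) by (auto simp: fmeasurable_def less_top measure_def enn2real_positive_iff zero_less_iff_neq_zero)
    then show ?thesis by (rule that)
  qed
  obtain B0 where B0: "B0 \<in> sets borel" "0 < emeasure L B0" "emeasure L B0 < \<infinity>"
    using finite_positive_set_exists by blast
  define F where "F = E0 \<times> B0"
  have emF: "emeasure m F = emeasure M E0 * emeasure L B0"
    unfolding F_def using E0 B0 by (intro L.emeasure_pair_measure_Times) auto
  have F: "F \<in> fmeasurable m" "measure m F > 0"
  proof -
    have "emeasure m F < \<infinity>" using emF E0 B0 by (auto simp: fmeasurable_def ennreal_mult_less_top)
    then show "F \<in> fmeasurable m" using E0 B0 by (auto simp: F_def fmeasurable_def)
    show "measure m F > 0"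
      using E0(2) B0 by (simp add: measure_def emF enn2real_mult enn2real_positive_iff)
  qed
  \<comment> \<open>If no \<open>E\<close> differed from the reference window \<open>F\<close>,
    every window average would be the same function \<open>q\<close> of \<open>y\<close>, and the
    vector field would equal \<open>q\<close>.\<close>
  have "\<exists>E. E \<in> fmeasurable m \<and> measure m E > 0 \<and>
    \<not> (AE y in N. of_real (1 / measure m E) * smear X E y - of_real (1 / measure m F) * smear X F y = 0)"
  proof (rule ccontr)
    assume "\<not> ?thesis"
    then have same: "AE y in N. of_real (1 / measure m E) * smear X E y = of_real (1 / measure m F) * smear X F y"
      if "E \<in> fmeasurable m" "measure m E > 0" for E using that by auto
    define q where "q y = Re (of_real (1 / measure m F) * smear X F y)" for y
    have [measurable]: "smear X F \<in> borel_measurable N" using F by (intro smear_measurable[OF Xm]) auto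
    have q[measurable]: "q \<in> borel_measurable N" unfolding q_def by measurable
    have qb: "\<bar>q y\<bar> \<le> 1" for y
    proof -
      have "\<bar>q y\<bar> \<le> cmod (of_real (1 / measure m F) * smear X F y)" unfolding q_def by (rule abs_Re_le_cmod)
      also have "\<dots> \<le> 1" using smear_bounded[OF F(1) Xm XB, of y] F(2) by (simp add: norm_mult norm_divide field_simps)
      finally show ?thesis .
    qed
    have Resm: "AE y in N. Re (smear X E y) = measure m E * q y" if E: "E \<in> fmeasurable m" for E
    proof (cases "measure m E = 0")
      case True
      have "smear X E y = 0" for y using smear_bounded[OF E Xm XB, of y] True by simp
      then show ?thesis using True by simp
    next
      case False
      then have pos: "measure m E > 0" by (simp add: zero_less_measure_iff)
      from same[OF E pos] show ?thesis
      proof eventually_elim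
        case (elim y)
        have "q y = Re (of_real (1 / measure m E) * smear X E y)" by (simp only: q_def elim)
        then show ?case using pos by (simp add: Re_divide_of_real)
      qed
    qed
    have orb[measurable]: "(\<lambda>r. X (fst (fst r), S (snd (fst r)) (snd r))) \<in> borel_measurable (m \<Otimes>\<^sub>M N)"
      by (rule orbit_measurable[OF Xm]) measurable
    \<comment> \<open>The vector field is real, being the orbit of an indicator; comparing its real
      part with \<open>q\<close> on all rectangles shows that the difference vanishes almost
      everywhere.\<close>
    define d where "d r = Re (X (fst (fst r), S (snd (fst r)) (snd r))) - q (snd r)" for r
    have dm[measurable]: "d \<in> borel_measurable (m \<Otimes>\<^sub>M N)" unfolding d_def by measurable
    have db: "\<bar>d r\<bar> \<le> 2" for r
    proof -
      have ReX: "\<bar>Re (X p)\<bar> \<le> 1" for p using XB[of p] abs_Re_le_cmod[of "X p"] by linarith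
      show ?thesis unfolding d_def using qb[of "snd r"] ReX[of "(fst (fst r), S (snd (fst r)) (snd r))"] by linarith
    qed
    have "AE r in m \<Otimes>\<^sub>M N. d r = 0"
    proof (rule AE_zero_if_rectangle_integrals_zero[where \<K> = "sets N" and K = "\<lambda>_. space N" and C = 2])
      show "sigma_finite_measure m" "sigma_finite_measure N" by unfold_locales
      show "Int_stable (sets N)" by (auto simp: Int_stable_def)
      show "sets N \<subseteq> fmeasurable N" by (auto simp: fmeasurable_def less_top[symmetric])
      show "sets N = sigma_sets (space N) (sets N)" by (simp add: sets.sigma_sets_eq)
      fix E B assume E: "E \<in> fmeasurable m" and B[measurable]: "B \<in> sets N"
      have Es[measurable]: "E \<in> sets m" using E by auto
      have fin: "emeasure (m \<Otimes>\<^sub>M N) (E \<times> B) < \<infinity>"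
        using E by (subst N.emeasure_pair_measure_Times)
          (auto simp: less_top[symmetric] fmeasurable_def ennreal_mult_eq_top_iff)
      have "integrable (m \<Otimes>\<^sub>M N) (\<lambda>r. 2 * indicator (E \<times> B) r :: real)" using fin pair_measureI[OF Es B]
        by (intro integrable_mult_right integrable_real_indicator)
      then have "integrable (m \<Otimes>\<^sub>M N) (\<lambda>r. indicator (E \<times> B) r * d r)"
        by (rule Bochner_Integration.integrable_bound) (use db in \<open>auto simp: indicator_def\<close>)
      then have "(\<integral>r. indicator (E \<times> B) r * d r \<partial>(m \<Otimes>\<^sub>M N)) = (\<integral>y. (\<integral>p. indicator (E \<times> B) (p, y) * d (p, y) \<partial>m) \<partial>N)"
        by (simp add: PLN.integral_snd split_beta')
      also have "\<dots> = (\<integral>y. 0 \<partial>N)"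
      proof (rule Bochner_Integration.integral_cong_AE)
        show "(\<lambda>y. \<integral>p. indicator (E \<times> B) (p, y) * d (p, y) \<partial>m) \<in> borel_measurable N" by measurable
        show "AE y in N. (\<integral>p. indicator (E \<times> B) (p, y) * d (p, y) \<partial>m) = 0"
          using Resm[OF E]
        proof eventually_elim
          case (elim y)
          have iE: "integrable m (\<lambda>p. indicator E p * q y)" using E by (auto simp: fmeasurable_def)
          have "(\<integral>p. indicator (E \<times> B) (p, y) * d (p, y) \<partial>m) =
            (\<integral>p. indicator B y * (Re (indicator E p * X (fst p, S (snd p) y)) - indicator E p * q y) \<partial>m)"
            by (intro Bochner_Integration.integral_cong) (auto simp: d_def indicator_def)
          also have "\<dots> = indicator B y * (Re (smear X E y) - measure m E * q y)"
          proof -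
            have iX: "integrable m (\<lambda>p. indicator E p * X (fst p, S (snd p) y))"
              using integrable_indicator_m[OF E Xm XB, of y] by simp
            have "(\<integral>p. Re (indicator E p * X (fst p, S (snd p) y)) \<partial>m) = Re (smear X E y)"
              unfolding smear_def by (rule integral_Re[OF iX])
            moreover have "(\<integral>p. indicator E p * q y \<partial>m) = measure m E * q y"
              using E by (simp add: sp_m)
            moreover note Bochner_Integration.integral_diff[OF integrable_Re[OF iX] iE]
            ultimately have "(\<integral>p. Re (indicator E p * X (fst p, S (snd p) y)) - indicator E p * q y \<partial>m) =
                Re (smear X E y) - measure m E * q y"
              by (simp only:)
            then show ?thesis by (simp only: integral_mult_right_zero)
          qed
          finally show ?case using elim by simp
        qed
      qed measurable
      finally show "(\<integral>r. indicator (E \<times> B) r * d r \<partial>(m \<Otimes>\<^sub>M N)) = 0" by simp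
    qed (use dm db in \<open>auto simp: incseq_def\<close>)
    then have "AE p in m. AE y in N. d (p, y) = 0" by (rule PLN.AE_pair)
    moreover have "{r \<in> space (m \<Otimes>\<^sub>M N). d r = 0} \<in> sets (m \<Otimes>\<^sub>M N)" by measurable
    note PLN.AE_commute[of "\<lambda>p y. d (p, y) = 0", unfolded prod.collapse, OF this]
    ultimately have "AE y in N. AE p in m. d (p, y) = 0" by (simp only:)
    then have "AE y in N. (AE p in m. (fst p, S (snd p) y) \<in> D) \<or> (AE p in m. \<not> (fst p, S (snd p) y) \<in> D)"
    proof eventually_elim
      case (elim y)
      \<comment> \<open>For fixed \<open>y\<close> the field is almost everywhere the constant
        \<open>q y\<close>, and an indicator takes only the values 0 and 1, so the orbit lies almost
        surely inside or outside \<open>D\<close>.\<close>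
      show ?case
      proof (cases "q y = 1")
        case True
        have "AE p in m. (fst p, S (snd p) y) \<in> D"
          using elim
        proof eventually_elim
          case (elim p)
          then show ?case using True by (cases "(fst p, S (snd p) y) \<in> D") (simp_all add: d_def X_def)
        qed
        then show ?thesis ..
      next
        case False
        have "AE p in m. \<not> (fst p, S (snd p) y) \<in> D"
          using elim
        proof eventually_elim
          case (elim p)
          then show ?case using False by (cases "(fst p, S (snd p) y) \<in> D") (simp_all add: d_def X_def)
        qed
        then show ?thesis ..
      qed
    qed
    then have "(AE p in M \<Otimes>\<^sub>M N. p \<in> D) \<or> (AE p in M \<Otimes>\<^sub>M N. \<not> p \<in> D)"
      by (intro orbitwise_trivial_imp_trivial[OF sfM spM N.sigma_finite_measure_axioms spN S ergS]) auto
    with triv show False by simp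
  qed
  then obtain E where E: "E \<in> fmeasurable m" "measure m E > 0" and ne:
    "\<not> (AE y in N. of_real (1 / measure m E) * smear X E y - of_real (1 / measure m F) * smear X F y = 0)"
    by blast
  interpret W: rokhlin_window L M Q \<psi> N S E0 E F
    by unfold_locales (use E0 E F in auto)
  have "(\<integral>y. (cmod (W.contrast X y))\<^sup>2 \<partial>N) > 0"
  proof -
    note [measurable] = W.contrast_measurable[OF Xm]
    have i: "integrable N (\<lambda>y. (cmod (W.contrast X y))\<^sup>2)"
    proof (rule N.integrable_const_bound[where B = "(2 * 1)\<^sup>2"])
      show "AE y in N. norm ((cmod (W.contrast X y))\<^sup>2) \<le> (2 * 1)\<^sup>2"
        unfolding real_norm_def abs_power2 by (intro AE_I2 power_mono W.contrast_bounded[OF Xm XB] norm_ge_zero)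
    qed measurable
    have "(\<integral>y. (cmod (W.contrast X y))\<^sup>2 \<partial>N) \<noteq> 0"
    proof
      assume "(\<integral>y. (cmod (W.contrast X y))\<^sup>2 \<partial>N) = 0"
      then have "AE y in N. (cmod (W.contrast X y))\<^sup>2 = 0"
        using i by (subst (asm) integral_nonneg_eq_0_iff_AE) auto
      then have "AE y in N. W.contrast X y = 0" by eventually_elim simp
      with ne show False by (simp only: W.contrast_def simp_thms)
    qed
    moreover have "(\<integral>y. (cmod (W.contrast X y))\<^sup>2 \<partial>N) \<ge> 0" by (intro Bochner_Integration.integral_nonneg) auto
    ultimately show ?thesis unfolding less_le by auto
  qed
  from W.eigenfunction_exists[OF X this nz] show ?thesis .
qed

end

section \<open>From an eigenfunction to the Mackey action\<close>

context haar_group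
begin

text \<open>The twisted equation for \<open>v\<close> controls only the first group coordinate.
  Ergodicity of the extension by \<open>\<psi>2\<close> supplies the second: a translate of
  \<open>v\<close> satisfies the same equation, so its product with the conjugate of
  \<open>v\<close> is invariant and therefore constant.\<close>

lemma rokhlin_ext_ergodic_of_mackey:
  fixes W :: "'w measure" and N :: "'y measure"
  assumes prW: "prob_space W" and R: "mp_iso W R"
    and \<psi>1[measurable]: "\<psi>1 \<in> borel_measurable W" and \<psi>2[measurable]: "\<psi>2 \<in> borel_measurable W"
    and erg2: "ergodic_map (W \<Otimes>\<^sub>M L) (group_ext R \<psi>2)"
    and wm: "mackey_weakly_mixing W R (L \<Otimes>\<^sub>M L) (\<lambda>w. (\<psi>1 w, \<psi>2 w))"
    and prN: "prob_space N" and spN: "space N = UNIV" and S: "mp_action N S" and ergS: "ergodic_action N S"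
  shows "ergodic_map ((W \<Otimes>\<^sub>M L) \<Otimes>\<^sub>M N) (rokhlin_ext (group_ext R \<psi>2) (\<lambda>p. \<psi>1 (fst p)) S)"
proof (rule ccontr)
  interpret W: prob_space W by fact
  interpret L: sigma_finite_measure L by (rule sigma_finite_L)
  interpret WL: pair_sigma_finite W L ..
  interpret LL: pair_sigma_finite L L ..
  interpret WLL: pair_sigma_finite W "L \<Otimes>\<^sub>M L" ..
  have spW: "space W = UNIV" by (rule mp_isoD(1)[OF R])
  have sfW: "sigma_finite_measure W" by unfold_locales
  have spWL: "space (W \<Otimes>\<^sub>M L) = UNIV" by (simp add: space_pair_measure spW)
  define G where "G = group_ext R \<psi>2"
  have G: "mp_iso (W \<Otimes>\<^sub>M L) G" unfolding G_def by (rule mp_iso_group_ext[OF sfW R \<psi>2])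
  have sfWL: "sigma_finite_measure (W \<Otimes>\<^sub>M L)" by (rule WL.sigma_finite_measure_axioms)
  interpret sys: rokhlin_system L "W \<Otimes>\<^sub>M L" G "\<lambda>p. \<psi>1 (fst p)" N S
  proof (intro rokhlin_system.intro rokhlin_system_axioms.intro haar_group_axioms sfWL G prN spN S)
    show "ergodic_map (W \<Otimes>\<^sub>M L) G" unfolding G_def by (rule erg2)
    show "(\<lambda>p. \<psi>1 (fst p)) \<in> borel_measurable (W \<Otimes>\<^sub>M L)" by measurable
  qed
  assume "\<not> ergodic_map ((W \<Otimes>\<^sub>M L) \<Otimes>\<^sub>M N) (rokhlin_ext (group_ext R \<psi>2) (\<lambda>p. \<psi>1 (fst p)) S)"
  then obtain ch v where chr: "cont_character ch" and nontriv: "\<exists>h. ch h \<noteq> 1"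
    and v[measurable]: "v \<in> borel_measurable (W \<Otimes>\<^sub>M L)" and vb: "\<And>p. cmod (v p) \<le> 4"
    and vG: "AE p in W \<Otimes>\<^sub>M L. v (G p) * ch (\<psi>1 (fst p)) = v p"
    and vnz: "\<not> (AE p in W \<Otimes>\<^sub>M L. v p = 0)"
    using sys.nonergodic_rokhlin_eigenfunction[OF ergS] by (auto simp: G_def)
  have ch: "continuous_on UNIV ch" "\<And>a b. ch (a + b) = ch a * ch b" "\<And>a. cmod (ch a) = 1"
    using chr by (auto simp: cont_character_def)
  have [measurable]: "ch \<in> borel_measurable borel"
    using ch(1) by (rule borel_measurable_continuous_onI)
  have unit: "ch a * cnj (ch a) = 1" for a
    using ch(3)[of a] by (metis complex_norm_square of_real_1 one_power2)
  note erg = erg2[folded G_def]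
  note dG = mp_isoD(3)[OF G]
  have ne: P if "AE p in W \<Otimes>\<^sub>M L. P" for P
  proof (rule ccontr)
    assume "\<not> P"
    have "AE p in W \<Otimes>\<^sub>M L. v p = 0" using that by (rule eventually_mono) (use \<open>\<not> P\<close> in simp)
    with vnz show False by contradiction
  qed
  have [measurable]: "(\<lambda>p. v (fst p, k + snd p)) \<in> borel_measurable (W \<Otimes>\<^sub>M L)" for k by measurable
  obtain r where r: "AE p in W \<Otimes>\<^sub>M L. cmod (v p) = r"
  proof -
    have "AE p in W \<Otimes>\<^sub>M L. cmod (v (G p)) = cmod (v p)"
      using vG
    proof eventually_elim
      case (elim p)
      have "cmod (v p) = cmod (v (G p)) * cmod (ch (\<psi>1 (fst p)))" by (simp add: elim[symmetric] norm_mult)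
      then show ?case by (simp add: ch(3))
    qed
    then show ?thesis using that ergodic_map_AE_invariant_const[OF erg dG, of "\<lambda>p. cmod (v p)"] by auto
  qed
  have r0: "r \<noteq> 0"
  proof
    assume "r = 0"
    from r have "AE p in W \<Otimes>\<^sub>M L. v p = 0" by eventually_elim (use \<open>r = 0\<close> in simp)
    with vnz show False by simp
  qed
  have Gsh: "G (fst p, k + snd p) = (fst (G p), k + snd (G p))" for p k
    by (simp add: G_def group_ext_def split_beta algebra_simps)
  \<comment> \<open>\<open>G\<close> commutes with translations, and both factors pick up
    \<open>ch (\<psi>1 w)\<close> and its conjugate, which cancel because the character is
    unimodular.\<close>
  have "\<exists>c. AE p in W \<Otimes>\<^sub>M L. v (fst p, k + snd p) * cnj (v p) = c" for k
  proof (rule ergodic_map_AE_invariant_const[OF erg dG])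
    show "AE p in W \<Otimes>\<^sub>M L. v (fst (G p), k + snd (G p)) * cnj (v (G p)) = v (fst p, k + snd p) * cnj (v p)"
      using vG mp_iso_AE[OF mp_iso_translation[OF sfW spW, of k] vG]
    proof eventually_elim
      case (elim p)
      have "v (fst p, k + snd p) * cnj (v p) =
        v (fst (G p), k + snd (G p)) * cnj (v (G p)) * (ch (\<psi>1 (fst p)) * cnj (ch (\<psi>1 (fst p))))"
        by (subst elim(1)[symmetric], subst elim(2)[symmetric]) (simp add: Gsh)
      then show ?case by (simp add: unit)
    qed
  qed measurable
  then obtain c where c: "\<And>k. AE p in W \<Otimes>\<^sub>M L. v (fst p, k + snd p) * cnj (v p) = c k"
    using choice[of "\<lambda>k c. AE p in W \<Otimes>\<^sub>M L. v (fst p, k + snd p) * cnj (v p) = c"] by auto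
  \<comment> \<open>As \<open>cmod (v p) = r\<close> almost everywhere, multiplying the invariant
    product by \<open>v\<close> and dividing by the square of \<open>r\<close> isolates the
    translate of \<open>v\<close>.\<close>
  define ch' where "ch' k = c k / of_real (r\<^sup>2)" for k
  have eig: "AE p in W \<Otimes>\<^sub>M L. v (fst p, k + snd p) = ch' k * v p" for k
    using c[of k] r
  proof eventually_elim
    case (elim p)
    have "of_real (r\<^sup>2) = v p * cnj (v p)" using elim(2) by (metis complex_norm_square)
    then have "v (fst p, k + snd p) * of_real (r\<^sup>2) = c k * v p"
      using elim(1) by (simp add: ac_simps flip: elim(1))
    then show ?case using r0 by (simp add: ch'_def field_simps)
  qed
  have norm1: "cmod (ch' k) = 1" for k
  proof (rule ne)
    show "AE p in W \<Otimes>\<^sub>M L. cmod (ch' k) = 1"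
      using eig[of k] r mp_iso_AE[OF mp_iso_translation[OF sfW spW, of k] r]
    proof eventually_elim
      case (elim p)
      have "r = cmod (ch' k) * r" using elim by (simp add: norm_mult)
      then show ?case using r0 by simp
    qed
  qed
  have chr': "cont_character ch'"
    by (rule translation_eigenfunction_character[OF sfW spW v vb vnz eig norm1])
  have ch': "continuous_on UNIV ch'" "\<And>a b. ch' (a + b) = ch' a * ch' b"
    using chr' by (auto simp: cont_character_def)
  have ch'0: "ch' 0 = 1"
  proof -
    have "ch' 0 * ch' 0 = ch' 0" using ch'(2)[of 0 0] by simp
    moreover have "ch' 0 \<noteq> 0" using norm1[of 0] by auto
    ultimately show ?thesis by simp
  qed
  \<comment> \<open>Null sets remain null after inserting the first group coordinate, on which
    nothing depends.\<close>
  have lift: "AE z in W \<Otimes>\<^sub>M (L \<Otimes>\<^sub>M L). P (fst z, snd (snd z))"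
    if P[measurable]: "Measurable.pred (W \<Otimes>\<^sub>M L) P" and ae: "AE p in W \<Otimes>\<^sub>M L. P p" for P
  proof (rule WLL.AE_pair_measure)
    have "(\<lambda>z. (fst z, snd (snd z))) \<in> W \<Otimes>\<^sub>M (L \<Otimes>\<^sub>M L) \<rightarrow>\<^sub>M W \<Otimes>\<^sub>M L" by measurable
    then have "Measurable.pred (W \<Otimes>\<^sub>M (L \<Otimes>\<^sub>M L)) (\<lambda>z. P (fst z, snd (snd z)))"
      using P by (rule measurable_compose)
    then show "{z \<in> space (W \<Otimes>\<^sub>M (L \<Otimes>\<^sub>M L)). P (fst z, snd (snd z))} \<in> sets (W \<Otimes>\<^sub>M (L \<Otimes>\<^sub>M L))"
      by (simp add: pred_def)
    show "AE w in W. AE h in L \<Otimes>\<^sub>M L. P (fst (w, h), snd (snd (w, h)))"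
      using WL.AE_pair[OF ae]
    proof eventually_elim
      case (elim w)
      have "(\<lambda>g. (w, g)) \<in> L \<rightarrow>\<^sub>M W \<Otimes>\<^sub>M L" by (rule measurable_Pair1') (simp add: spW)
      then have Pw: "Measurable.pred L (\<lambda>g. P (w, g))" using P by (rule measurable_compose)
      have "AE h in L \<Otimes>\<^sub>M L. P (w, snd h)"
      proof (rule LL.AE_pair_measure)
        have "Measurable.pred (L \<Otimes>\<^sub>M L) (\<lambda>h. P (w, snd h))"
          using measurable_compose[OF measurable_snd Pw] .
        then show "{h \<in> space (L \<Otimes>\<^sub>M L). P (w, snd h)} \<in> sets (L \<Otimes>\<^sub>M L)" by (simp add: pred_def)
      qed (use elim in simp)
      then show ?case by simp
    qed
  qed
  \<comment> \<open>Adding \<open>\<psi>1 w\<close> to the first group coordinate contributes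
    exactly the factor \<open>ch (\<psi>1 w)\<close> that compensates the change of \<open>v\<close>
    under \<open>G\<close>.\<close>
  define f where "f z = ch (fst (snd z)) * v (fst z, snd (snd z))" for z :: "'w \<times> ('g \<times> 'g)"
  define chi where "chi h = ch (fst h) * ch' (snd h)" for h :: "'g \<times> 'g"
  have f_meas: "f \<in> borel_measurable (W \<Otimes>\<^sub>M (L \<Otimes>\<^sub>M L))" unfolding f_def by measurable
  have f_bd: "cmod (f z) \<le> 4" for z using vb by (simp add: f_def norm_mult ch(3))
  have chi: "cont_character chi"
  proof -
    have "continuous_on UNIV (\<lambda>h :: 'g \<times> 'g. ch (fst h))" "continuous_on UNIV (\<lambda>h :: 'g \<times> 'g. ch' (snd h))"
      by (rule continuous_on_compose2[OF ch(1)]; auto intro: continuous_intros)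
         (rule continuous_on_compose2[OF ch'(1)]; auto intro: continuous_intros)
    then show ?thesis
      unfolding cont_character_def chi_def
      by (auto intro!: continuous_on_mult simp: ch(2,3) ch'(2) norm1 norm_mult)
  qed
  have f_inv: "AE z in W \<Otimes>\<^sub>M (L \<Otimes>\<^sub>M L). f (group_ext R (\<lambda>w. (\<psi>1 w, \<psi>2 w)) z) = f z"
  proof -
    have [measurable]: "G \<in> W \<Otimes>\<^sub>M L \<rightarrow>\<^sub>M W \<Otimes>\<^sub>M L" by (rule mp_isoD(2)[OF G])
    have "AE z in W \<Otimes>\<^sub>M (L \<Otimes>\<^sub>M L). v (G (fst z, snd (snd z))) * ch (\<psi>1 (fst z)) = v (fst z, snd (snd z))"
      using lift[OF _ vG] by simp
    then show ?thesis
    proof eventually_elim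
      case (elim z)
      have "f (group_ext R (\<lambda>w. (\<psi>1 w, \<psi>2 w)) z) =
        ch (fst (snd z)) * (v (G (fst z, snd (snd z))) * ch (\<psi>1 (fst z)))"
        by (simp add: f_def group_ext_def G_def split_beta ch(2))
      then show ?case by (simp only: elim) (simp add: f_def)
    qed
  qed
  have f_nz: "\<not> (AE z in W \<Otimes>\<^sub>M (L \<Otimes>\<^sub>M L). f z = 0)"
  proof
    assume "AE z in W \<Otimes>\<^sub>M (L \<Otimes>\<^sub>M L). f z = 0"
    then have "AE z in W \<Otimes>\<^sub>M (L \<Otimes>\<^sub>M L). v (fst z, snd (snd z)) = 0"
    proof eventually_elim
      case (elim z)
      have "ch (fst (snd z)) \<noteq> 0" using ch(3)[of "fst (snd z)"] by auto
      then show ?case using elim by (simp add: f_def)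
    qed
    then have "AE w in W. AE h in L \<Otimes>\<^sub>M L. v (w, snd h) = 0" using WLL.AE_pair by fastforce
    then have "AE w in W. AE g in L. v (w, g) = 0"
    proof eventually_elim
      case (elim w)
      then have "AE a in L. AE b in L. v (w, b) = 0" using LL.AE_pair by fastforce
      then show ?case by (rule AE_L_const)
    qed
    moreover have "{p \<in> space (W \<Otimes>\<^sub>M L). v p = 0} \<in> sets (W \<Otimes>\<^sub>M L)" by measurable
    ultimately have "AE p in W \<Otimes>\<^sub>M L. v p = 0" by (intro WL.AE_pair_measure)
    with vnz show False by simp
  qed
  have f_eig: "AE z in W \<Otimes>\<^sub>M (L \<Otimes>\<^sub>M L). f (fst z, snd z + h) = chi h * f z" for h
  proof -
    have "AE z in W \<Otimes>\<^sub>M (L \<Otimes>\<^sub>M L). v (fst z, snd h + snd (snd z)) = ch' (snd h) * v (fst z, snd (snd z))"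
      using lift[OF _ eig[of "snd h"]] by simp
    then show ?thesis
      by eventually_elim (simp add: f_def chi_def ch(2) add.commute[of _ "snd h"])
  qed
  have "\<forall>h. chi h = 1"
    using wm[unfolded mackey_weakly_mixing_def, rule_format, of chi f] chi f_meas f_bd f_inv f_nz f_eig by blast
  \<comment> \<open>The second character is 1 at 0, so restricting to the first coordinate
    contradicts nontriviality of \<open>ch\<close>.\<close>
  then have "chi (h, 0) = 1" for h by blast
  then have "ch h = 1" for h by (simp add: chi_def ch'0)
  with nontriv show False by simp
qed

text \<open>Both cocycles read only the point of \<open>W\<close>, so the Rokhlin fibre and the
  group coordinate can be adjoined in either order; the coordinate exchange preserves the product
  measure by Fubini.\<close>

lemma ergodic_map_rearrange:
  fixes W :: "'w measure" and N :: "'y measure"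
  assumes "sigma_finite_measure W" "sigma_finite_measure N" and spW: "space W = UNIV" and spN: "space N = UNIV"
    and [measurable]: "R \<in> W \<rightarrow>\<^sub>M W" "\<psi>1 \<in> borel_measurable W" "\<psi>2 \<in> borel_measurable W" and S: "mp_action N S"
    and erg: "ergodic_map ((W \<Otimes>\<^sub>M L) \<Otimes>\<^sub>M N) (rokhlin_ext (group_ext R \<psi>2) (\<lambda>p. \<psi>1 (fst p)) S)"
  shows "ergodic_map ((W \<Otimes>\<^sub>M N) \<Otimes>\<^sub>M L) (group_ext (rokhlin_ext R \<psi>1 S) (\<lambda>p. \<psi>2 (fst p)))"
proof (rule ergodic_map_factor[OF erg, where e = "\<lambda>q. ((fst (fst q), snd q), snd (fst q))"])
  interpret W: sigma_finite_measure W by fact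
  interpret N: sigma_finite_measure N by fact
  interpret L: sigma_finite_measure L by (rule sigma_finite_L)
  interpret LN: pair_sigma_finite L N ..
  interpret WL: pair_sigma_finite W L ..
  interpret WN: pair_sigma_finite W N ..
  show "space ((W \<Otimes>\<^sub>M L) \<Otimes>\<^sub>M N) = UNIV" "space ((W \<Otimes>\<^sub>M N) \<Otimes>\<^sub>M L) = UNIV"
    by (simp_all add: space_pair_measure spW spN)
  let ?e = "\<lambda>q. ((fst (fst q), snd q), snd (fst q))"
  show e: "?e \<in> (W \<Otimes>\<^sub>M L) \<Otimes>\<^sub>M N \<rightarrow>\<^sub>M (W \<Otimes>\<^sub>M N) \<Otimes>\<^sub>M L" by measurable
  show "distr ((W \<Otimes>\<^sub>M L) \<Otimes>\<^sub>M N) ((W \<Otimes>\<^sub>M N) \<Otimes>\<^sub>M L) ?e = (W \<Otimes>\<^sub>M N) \<Otimes>\<^sub>M L"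
  proof (rule measure_eqI)
    fix A assume "A \<in> sets (distr ((W \<Otimes>\<^sub>M L) \<Otimes>\<^sub>M N) ((W \<Otimes>\<^sub>M N) \<Otimes>\<^sub>M L) ?e)"
    then have A[measurable]: "A \<in> sets ((W \<Otimes>\<^sub>M N) \<Otimes>\<^sub>M L)" by simp
    have fA: "(\<lambda>q. indicator A (?e q) :: ennreal) \<in> borel_measurable ((W \<Otimes>\<^sub>M L) \<Otimes>\<^sub>M N)"
      by (rule measurable_compose[OF e borel_measurable_indicator[OF A]])
    have "emeasure (distr ((W \<Otimes>\<^sub>M L) \<Otimes>\<^sub>M N) ((W \<Otimes>\<^sub>M N) \<Otimes>\<^sub>M L) ?e) A
      = (\<integral>\<^sup>+q. indicator A q \<partial>distr ((W \<Otimes>\<^sub>M L) \<Otimes>\<^sub>M N) ((W \<Otimes>\<^sub>M N) \<Otimes>\<^sub>M L) ?e)"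
      by (rule nn_integral_indicator[symmetric]) (simp only: sets_distr A)
    also have "\<dots> = (\<integral>\<^sup>+q. indicator A (?e q) \<partial>((W \<Otimes>\<^sub>M L) \<Otimes>\<^sub>M N))"
      by (rule nn_integral_distr[OF e]) measurable
    also have "\<dots> = (\<integral>\<^sup>+p. \<integral>\<^sup>+y. indicator A (?e (p, y)) \<partial>N \<partial>(W \<Otimes>\<^sub>M L))"
      by (rule N.nn_integral_fst[OF fA, symmetric])
    also have "\<dots> = (\<integral>\<^sup>+w. \<integral>\<^sup>+g. \<integral>\<^sup>+y. indicator A (?e ((w, g), y)) \<partial>N \<partial>L \<partial>W)"
      by (rule L.nn_integral_fst[OF N.borel_measurable_nn_integral_fst[OF fA], symmetric])
    also have "\<dots> = (\<integral>\<^sup>+w. \<integral>\<^sup>+y. \<integral>\<^sup>+g. indicator A ((w, y), g) \<partial>L \<partial>N \<partial>W)"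
    proof (rule nn_integral_cong)
      fix w assume "w \<in> space W"
      then have "(\<lambda>r. ((w, snd r), fst r)) \<in> L \<Otimes>\<^sub>M N \<rightarrow>\<^sub>M (W \<Otimes>\<^sub>M N) \<Otimes>\<^sub>M L"
        by (intro measurable_Pair measurable_const measurable_fst measurable_snd)
      from measurable_compose[OF this borel_measurable_indicator[OF A]]
      have "(\<lambda>(g, y). indicator A ((w, y), g) :: ennreal) \<in> borel_measurable (L \<Otimes>\<^sub>M N)"
        by (simp only: split_beta')
      from LN.Fubini'[OF this]
      show "(\<integral>\<^sup>+g. \<integral>\<^sup>+y. indicator A (?e ((w, g), y)) \<partial>N \<partial>L) = (\<integral>\<^sup>+y. \<integral>\<^sup>+g. indicator A ((w, y), g) \<partial>L \<partial>N)"
        by simp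
    qed
    also have "\<dots> = (\<integral>\<^sup>+p. \<integral>\<^sup>+g. indicator A (p, g) \<partial>L \<partial>(W \<Otimes>\<^sub>M N))"
      by (rule N.nn_integral_fst[OF L.borel_measurable_nn_integral_fst[OF borel_measurable_indicator[OF A]]])
    also have "\<dots> = emeasure ((W \<Otimes>\<^sub>M N) \<Otimes>\<^sub>M L) A"
      using A by (rule L.emeasure_pair_measure[symmetric])
    finally show "emeasure (distr ((W \<Otimes>\<^sub>M L) \<Otimes>\<^sub>M N) ((W \<Otimes>\<^sub>M N) \<Otimes>\<^sub>M L) ?e) A = emeasure ((W \<Otimes>\<^sub>M N) \<Otimes>\<^sub>M L) A" .
  qed simp
  have "rokhlin_ext R \<psi>1 S \<in> W \<Otimes>\<^sub>M N \<rightarrow>\<^sub>M W \<Otimes>\<^sub>M N"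
    unfolding rokhlin_ext_def split_beta' by (intro measurable_Pair mp_action_measurable[OF S]) measurable
  note [measurable] = this
  show "group_ext (rokhlin_ext R \<psi>1 S) (\<lambda>p. \<psi>2 (fst p)) \<in> (W \<Otimes>\<^sub>M N) \<Otimes>\<^sub>M L \<rightarrow>\<^sub>M (W \<Otimes>\<^sub>M N) \<Otimes>\<^sub>M L"
    unfolding group_ext_def split_beta' by measurable
qed (simp add: rokhlin_ext_def group_ext_def split_beta)

end

section \<open>Joinings of Rokhlin extensions\<close>

text \<open>Reduces joinings of powers of the extension to joinings of two Rokhlin extensions over
  powers of \<open>T\<close>.\<close>

lemma rokhlin_ext_funpow:
  fixes \<phi> :: "'x \<Rightarrow> 'g::{topological_space, ab_group_add}" and S :: "'g \<Rightarrow> 'b \<Rightarrow> 'b"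
  assumes "mp_action N S"
  shows "rokhlin_ext T \<phi> S ^^ n = rokhlin_ext (T ^^ n) (cocycle_sum T \<phi> n) S"
proof (induction n)
  case 0
  then show ?case using mp_actionD(2)[OF assms] by (auto simp: rokhlin_ext_def cocycle_sum_def)
next
  case (Suc n)
  have step: "(rokhlin_ext T \<phi> S ^^ Suc n) (x, y) = rokhlin_ext (T ^^ Suc n) (cocycle_sum T \<phi> (Suc n)) S (x, y)" for x y
    using mp_actionD(3)[OF assms, of "\<phi> ((T ^^ n) x)" "cocycle_sum T \<phi> n x" y]
    by (simp add: Suc.IH) (simp add: rokhlin_ext_def cocycle_sum_def add.commute)
  show ?case
  proof
    fix p :: "'x \<times> 'b"
    show "(rokhlin_ext T \<phi> S ^^ Suc n) p = rokhlin_ext (T ^^ Suc n) (cocycle_sum T \<phi> (Suc n)) S p"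
      using step[of "fst p" "snd p"] by (simp only: prod.collapse)
  qed
qed

lemma mp_iso_funpow:
  assumes "mp_iso M T"
  shows "mp_iso M (T ^^ n)"
proof -
  obtain T' where T': "T' \<in> M \<rightarrow>\<^sub>M M" "\<And>x. T' (T x) = x" "\<And>x. T (T' x) = x"
    using assms by (auto simp: mp_iso_def)
  note T = mp_isoD[OF assms]
  show ?thesis
  proof (induction n)
    case 0
    have "distr M M (\<lambda>x. x) = M" by (rule distr_id)
    then show ?case using T(1) by (auto simp: mp_iso_def id_def intro!: bexI[of _ "\<lambda>x. x"])
  next
    case (Suc n)
    obtain U where U: "U \<in> M \<rightarrow>\<^sub>M M" "\<And>x. U ((T ^^ n) x) = x" "\<And>x. (T ^^ n) (U x) = x"
      using Suc by (auto simp: mp_iso_def)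
    note Tn = mp_isoD[OF Suc]
    have "distr (distr M M (T ^^ n)) M T = distr M M (T \<circ> (T ^^ n))"
      by (rule distr_distr[OF T(2) Tn(2)])
    then have "distr M M (T ^^ Suc n) = M" by (simp add: Tn(3) T(3) o_def)
    moreover have "T ^^ Suc n \<in> M \<rightarrow>\<^sub>M M" using measurable_comp[OF Tn(2) T(2)] by simp
    moreover have "U \<circ> T' \<in> M \<rightarrow>\<^sub>M M" using measurable_comp[OF T'(1) U(1)] .
    ultimately show ?case
      unfolding mp_iso_def using T(1) T' U by (auto intro!: bexI[of _ "U \<circ> T'"])
  qed
qed

lemma mp_iso_automorphism: "mp_automorphism M T \<Longrightarrow> mp_iso M T"
  unfolding mp_automorphism_def mp_iso_def mp_map_def
  by (auto intro!: bexI[of _ "inv T"] simp: bij_is_inj bij_is_surj surj_f_inv_f)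

lemma cocycle_sum_measurable:
  fixes \<phi> :: "'x \<Rightarrow> 'g::{topological_ab_group_add, second_countable_topology}"
  assumes T: "mp_iso M T" and \<phi>: "\<phi> \<in> borel_measurable M"
  shows "cocycle_sum T \<phi> n \<in> borel_measurable M"
proof -
  have "(\<lambda>x. \<phi> ((T ^^ i) x)) \<in> borel_measurable M" for i
    by (rule measurable_compose[OF mp_isoD(2)[OF mp_iso_funpow[OF T]] \<phi>])
  then have "(\<lambda>x. \<Sum>i<n. \<phi> ((T ^^ i) x)) \<in> borel_measurable M"
    by (induction n) auto
  then show ?thesis by (simp add: cocycle_sum_def[abs_def])
qed

text \<open>Allows an assumption about the first coordinate of all joinings to be used for the
  second coordinate.\<close>

lemma ergodic_joinings_swap:
  assumes spM: "space M = UNIV" and A[measurable]: "A \<in> M \<rightarrow>\<^sub>M M" and B[measurable]: "B \<in> M \<rightarrow>\<^sub>M M"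
    and \<eta>: "\<eta> \<in> ergodic_joinings M A B"
  shows "distr \<eta> (M \<Otimes>\<^sub>M M) (\<lambda>p. (snd p, fst p)) \<in> ergodic_joinings M B A"
proof -
  let ?s = "\<lambda>p. (snd p, fst p)"
  let ?\<eta> = "distr \<eta> (M \<Otimes>\<^sub>M M) ?s"
  have sets[measurable_cong]: "sets \<eta> = sets (M \<Otimes>\<^sub>M M)" and pr: "prob_space \<eta>"
    and m1: "distr \<eta> M fst = M" and m2: "distr \<eta> M snd = M"
    and mp: "distr \<eta> \<eta> (\<lambda>(x, y). (A x, B y)) = \<eta>"
    and erg: "ergodic_map \<eta> (\<lambda>(x, y). (A x, B y))"
    using \<eta> by (auto simp: ergodic_joinings_def mp_map_def)
  interpret prob_space \<eta> by fact
  have sp: "space \<eta> = UNIV" using sets_eq_imp_space_eq[OF sets] spM by (simp add: space_pair_measure)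
  have s[measurable]: "?s \<in> \<eta> \<rightarrow>\<^sub>M M \<Otimes>\<^sub>M M" by measurable
  have spP: "space (M \<Otimes>\<^sub>M M) = UNIV" by (simp add: space_pair_measure spM)
  have BA[measurable]: "(\<lambda>(x, y). (B x, A y)) \<in> M \<Otimes>\<^sub>M M \<rightarrow>\<^sub>M M \<Otimes>\<^sub>M M" by measurable
  have AB[measurable]: "(\<lambda>(x, y). (A x, B y)) \<in> \<eta> \<rightarrow>\<^sub>M \<eta>" by measurable
  have "distr ?\<eta> ?\<eta> (\<lambda>(x, y). (B x, A y)) = distr ?\<eta> (M \<Otimes>\<^sub>M M) (\<lambda>(x, y). (B x, A y))"
    by (rule distr_cong) auto
  also have "\<dots> = distr \<eta> (M \<Otimes>\<^sub>M M) ((\<lambda>(x, y). (B x, A y)) \<circ> ?s)"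
    by (rule distr_distr) auto
  also have "(\<lambda>(x, y). (B x, A y)) \<circ> ?s = ?s \<circ> (\<lambda>(x, y). (A x, B y))" by auto
  also have "distr \<eta> (M \<Otimes>\<^sub>M M) (?s \<circ> (\<lambda>(x, y). (A x, B y))) = distr (distr \<eta> \<eta> (\<lambda>(x, y). (A x, B y))) (M \<Otimes>\<^sub>M M) ?s"
    by (rule distr_distr[symmetric]) auto
  finally have mp': "distr ?\<eta> ?\<eta> (\<lambda>(x, y). (B x, A y)) = ?\<eta>" by (simp only: mp)
  have "distr ?\<eta> M fst = distr \<eta> M (fst \<circ> ?s)" "distr ?\<eta> M snd = distr \<eta> M (snd \<circ> ?s)"
    by (rule distr_distr; auto)+
  moreover have c: "fst \<circ> ?s = snd" "snd \<circ> ?s = fst" by (auto simp: fun_eq_iff)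
  ultimately have "distr ?\<eta> M fst = M" "distr ?\<eta> M snd = M" by (simp_all only: c m1 m2)
  moreover have "prob_space ?\<eta>" by (rule prob_space_distr) measurable
  moreover have "ergodic_map ?\<eta> (\<lambda>(x, y). (B x, A y))"
    by (rule ergodic_map_factor[OF erg, where e = ?s]) (auto simp: sp spP intro!: distr_cong)
  ultimately show ?thesis using mp' by (simp add: ergodic_joinings_def mp_map_def)
qed

lemma distr_distr_eq:
  assumes "f \<in> A \<rightarrow>\<^sub>M B" "g \<in> B \<rightarrow>\<^sub>M C"
  shows "distr (distr A B f) C g = distr A C (\<lambda>x. g (f x))"
  using distr_distr[OF assms(2,1)] by (simp add: o_def)

lemma distr_pair_snd:
  assumes "prob_space M" "sigma_finite_measure N"
  shows "distr (M \<Otimes>\<^sub>M N) N snd = N"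
proof (rule measure_eqI)
  interpret M: prob_space M by fact
  interpret N: sigma_finite_measure N by fact
  fix A assume "A \<in> sets (distr (M \<Otimes>\<^sub>M N) N snd)"
  then have A: "A \<in> sets N" by simp
  then have "snd -` A \<inter> space (M \<Otimes>\<^sub>M N) = space M \<times> A"
    by (auto simp: space_pair_measure dest: sets.sets_into_space)
  then have "emeasure (distr (M \<Otimes>\<^sub>M N) N snd) A = emeasure (M \<Otimes>\<^sub>M N) (space M \<times> A)"
    using A by (simp add: emeasure_distr)
  also have "\<dots> = emeasure N A"
    using A by (simp add: N.emeasure_pair_measure_Times M.emeasure_space_1)
  finally show "emeasure (distr (M \<Otimes>\<^sub>M N) N snd) A = emeasure N A" .
qed simp

context haar_group
begin

text \<open>The ergodicity assumptions are conditional on \<open>\<eta>\<close> being an ergodic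
  joining because this is itself part of the conclusion; \<open>\<eta>\<close> enters through its
  defining equation so that the assumptions can mention it.\<close>

lemma rokhlin_joining_product:
  fixes M :: "'x::second_countable_topology measure" and N :: "'y::second_countable_topology measure"
  assumes setsM: "sets M = sets borel" and prM: "prob_space M" and A: "mp_iso M A" and B: "mp_iso M B"
    and \<phi>[measurable]: "\<phi> \<in> borel_measurable M" and \<psi>[measurable]: "\<psi> \<in> borel_measurable M"
    and setsN: "sets N = sets borel" and prN: "prob_space N" and S: "mp_action N S" and ergS: "ergodic_action N S"
    and J: "\<kappa> \<in> ergodic_joinings (M \<Otimes>\<^sub>M N) (rokhlin_ext A \<phi> S) (rokhlin_ext B \<psi> S)"
    and \<eta>_def: "\<eta> = distr \<kappa> (M \<Otimes>\<^sub>M M) (\<lambda>q. (fst (fst q), fst (snd q)))"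
    and ext1: "\<eta> \<in> ergodic_joinings M A B \<Longrightarrow>
      ergodic_map (\<eta> \<Otimes>\<^sub>M L) (group_ext (\<lambda>(x, x'). (A x, B x')) (\<lambda>(x, x'). \<phi> x))"
    and ext2: "\<eta> \<in> ergodic_joinings M A B \<Longrightarrow>
      ergodic_map (\<eta> \<Otimes>\<^sub>M L) (group_ext (\<lambda>(x, x'). (A x, B x')) (\<lambda>(x, x'). \<psi> x'))"
    and wm: "\<eta> \<in> ergodic_joinings M A B \<Longrightarrow>
      mackey_weakly_mixing \<eta> (\<lambda>(x, x'). (A x, B x')) (L \<Otimes>\<^sub>M L) (\<lambda>(x, x'). (\<phi> x, \<psi> x'))"
  shows "\<eta> \<in> ergodic_joinings M A B"
    and "distr \<kappa> ((\<eta> \<Otimes>\<^sub>M N) \<Otimes>\<^sub>M N) (\<lambda>q. (((fst (fst q), fst (snd q)), snd (fst q)), snd (snd q))) = (\<eta> \<Otimes>\<^sub>M N) \<Otimes>\<^sub>M N"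
proof -
  interpret M: prob_space M by fact
  interpret N: prob_space N by fact
  interpret MN: pair_prob_space M N ..
  let ?F = "rokhlin_ext A \<phi> S" and ?G = "rokhlin_ext B \<psi> S"
  have spM: "space M = UNIV" and spN: "space N = UNIV"
    using sets_eq_imp_space_eq[OF setsM] sets_eq_imp_space_eq[OF setsN] by simp_all
  have spMM: "space (M \<Otimes>\<^sub>M M) = UNIV" "space (M \<Otimes>\<^sub>M N) = UNIV" by (simp_all add: space_pair_measure spM spN)
  have sets\<kappa>[measurable_cong]: "sets \<kappa> = sets ((M \<Otimes>\<^sub>M N) \<Otimes>\<^sub>M (M \<Otimes>\<^sub>M N))" and pr\<kappa>: "prob_space \<kappa>"
    and \<kappa>1: "distr \<kappa> (M \<Otimes>\<^sub>M N) fst = M \<Otimes>\<^sub>M N" and \<kappa>2: "distr \<kappa> (M \<Otimes>\<^sub>M N) snd = M \<Otimes>\<^sub>M N"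
    and mp: "distr \<kappa> \<kappa> (\<lambda>(p, q). (?F p, ?G q)) = \<kappa>"
    and FG[measurable]: "(\<lambda>(p, q). (?F p, ?G q)) \<in> \<kappa> \<rightarrow>\<^sub>M \<kappa>"
    and erg: "ergodic_map \<kappa> (\<lambda>(p, q). (?F p, ?G q))"
    using J by (auto simp: ergodic_joinings_def mp_map_def)
  interpret \<kappa>: prob_space \<kappa> by fact
  have sp\<kappa>: "space \<kappa> = UNIV" using sets_eq_imp_space_eq[OF sets\<kappa>] spMM by (simp add: space_pair_measure)
  note [measurable] = mp_isoD(2)[OF A] mp_isoD(2)[OF B]
  let ?R = "\<lambda>(x, x'). (A x, B x')"
  let ?e = "\<lambda>q. (fst (fst q), fst (snd q))"
  have R[measurable]: "?R \<in> M \<Otimes>\<^sub>M M \<rightarrow>\<^sub>M M \<Otimes>\<^sub>M M" by measurable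
  have e[measurable]: "?e \<in> \<kappa> \<rightarrow>\<^sub>M M \<Otimes>\<^sub>M M" by measurable
  have sets\<eta>[measurable_cong]: "sets \<eta> = sets (M \<Otimes>\<^sub>M M)" by (simp add: \<eta>_def)
  have sp\<eta>: "space \<eta> = UNIV" using sets_eq_imp_space_eq[OF sets\<eta>] spMM by simp
  have pr\<eta>: "prob_space \<eta>" unfolding \<eta>_def by (rule \<kappa>.prob_space_distr) measurable
  interpret \<eta>: prob_space \<eta> by fact
  have e_comm: "?e (case q of (p, q) \<Rightarrow> (?F p, ?G q)) = ?R (?e q)" for q
    by (simp add: rokhlin_ext_def split_beta)
  have sigma_finite_N: "sigma_finite_measure N" by unfold_locales
  have distrN: "distr (M \<Otimes>\<^sub>M N) M fst = M" "distr (M \<Otimes>\<^sub>M N) N snd = N"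
    using N.distr_pair_fst[of M] distr_pair_snd[OF prM sigma_finite_N] by simp_all
  have \<eta>1: "distr \<eta> M fst = M"
  proof -
    have "distr \<eta> M fst = distr \<kappa> M (\<lambda>q. fst (fst q))" unfolding \<eta>_def by (subst distr_distr_eq) auto
    also have "\<dots> = distr (distr \<kappa> (M \<Otimes>\<^sub>M N) fst) M fst" by (subst distr_distr_eq) auto
    finally show ?thesis by (simp add: \<kappa>1 distrN)
  qed
  have \<eta>2: "distr \<eta> M snd = M"
  proof -
    have "distr \<eta> M snd = distr \<kappa> M (\<lambda>q. fst (snd q))" unfolding \<eta>_def by (subst distr_distr_eq) auto
    also have "\<dots> = distr (distr \<kappa> (M \<Otimes>\<^sub>M N) snd) M fst" by (subst distr_distr_eq) auto
    finally show ?thesis by (simp add: \<kappa>2 distrN)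
  qed
  have R\<eta>: "?R \<in> \<eta> \<rightarrow>\<^sub>M \<eta>" using R by (simp cong: measurable_cong_sets)
  have distrR: "distr \<eta> \<eta> ?R = \<eta>"
  proof -
    have "distr \<eta> \<eta> ?R = distr \<eta> (M \<Otimes>\<^sub>M M) ?R" by (rule distr_cong) (auto simp: sets\<eta>)
    also have "\<dots> = distr \<kappa> (M \<Otimes>\<^sub>M M) (\<lambda>q. ?R (?e q))" unfolding \<eta>_def by (rule distr_distr_eq[OF e R])
    also have "\<dots> = distr \<kappa> (M \<Otimes>\<^sub>M M) (\<lambda>q. ?e (case q of (p, q) \<Rightarrow> (?F p, ?G q)))" by (simp only: e_comm)
    also have "\<dots> = distr (distr \<kappa> \<kappa> (\<lambda>(p, q). (?F p, ?G q))) (M \<Otimes>\<^sub>M M) ?e" by (rule distr_distr_eq[OF FG e, symmetric])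
    finally show ?thesis by (simp only: mp \<eta>_def)
  qed
  have erg\<eta>: "ergodic_map \<eta> ?R"
  proof (rule ergodic_map_factor[where e = ?e, OF erg sp\<kappa> sp\<eta> _ _ R\<eta> e_comm])
    show "?e \<in> \<kappa> \<rightarrow>\<^sub>M \<eta>" using e by (simp cong: measurable_cong_sets)
    have "distr \<kappa> \<eta> ?e = distr \<kappa> (M \<Otimes>\<^sub>M M) ?e" by (rule distr_cong) (auto simp: sets\<eta>)
    then show "distr \<kappa> \<eta> ?e = \<eta>" by (simp add: \<eta>_def)
  qed
  show J\<eta>: "\<eta> \<in> ergodic_joinings M A B"
    unfolding ergodic_joinings_def mp_map_def
    using sets\<eta> pr\<eta> \<eta>1 \<eta>2 R\<eta> distrR erg\<eta> by simp
  have isoR: "mp_iso \<eta> ?R"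
  proof -
    obtain A' where A': "A' \<in> M \<rightarrow>\<^sub>M M" "\<And>x. A' (A x) = x" "\<And>x. A (A' x) = x" using A by (auto simp: mp_iso_def)
    obtain B' where B': "B' \<in> M \<rightarrow>\<^sub>M M" "\<And>x. B' (B x) = x" "\<And>x. B (B' x) = x" using B by (auto simp: mp_iso_def)
    note [measurable] = A'(1) B'(1)
    have "(\<lambda>(x, x'). (A' x, B' x')) \<in> \<eta> \<rightarrow>\<^sub>M \<eta>" by measurable
    then show ?thesis
      unfolding mp_iso_def using sp\<eta> R\<eta> distrR A' B'
      by (auto intro!: bexI[of _ "\<lambda>(x, x'). (A' x, B' x')"])
  qed
  let ?p1 = "\<lambda>w. \<phi> (fst w)" and ?p2 = "\<lambda>w. \<psi> (snd w)"
  have p1[measurable]: "?p1 \<in> borel_measurable \<eta>" and p2[measurable]: "?p2 \<in> borel_measurable \<eta>" by measurable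
  have e1: "ergodic_map (\<eta> \<Otimes>\<^sub>M L) (group_ext ?R ?p1)" using ext1[OF J\<eta>] by (simp add: split_beta')
  have e2: "ergodic_map (\<eta> \<Otimes>\<^sub>M L) (group_ext ?R ?p2)" using ext2[OF J\<eta>] by (simp add: split_beta')
  have w: "mackey_weakly_mixing \<eta> ?R (L \<Otimes>\<^sub>M L) (\<lambda>w. (?p1 w, ?p2 w))" using wm[OF J\<eta>] by (simp add: split_beta')
  have FGm: "(\<lambda>q. (?F (fst q), ?G (snd q))) \<in> \<kappa> \<rightarrow>\<^sub>M \<kappa>" "distr \<kappa> \<kappa> (\<lambda>q. (?F (fst q), ?G (snd q))) = \<kappa>"
    using FG mp by (simp_all add: split_beta')

  let ?e1 = "\<lambda>q. (?e q, snd (fst q))"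
  have e1m[measurable]: "?e1 \<in> \<kappa> \<rightarrow>\<^sub>M \<eta> \<Otimes>\<^sub>M N" by measurable
  have k1: "distr \<kappa> (\<eta> \<Otimes>\<^sub>M N) ?e1 = \<eta> \<Otimes>\<^sub>M N"
  proof (rule rokhlin_joining_unique[OF pr\<eta> isoR p1 e1 prN setsN S])
    let ?\<kappa> = "distr \<kappa> (\<eta> \<Otimes>\<^sub>M N) ?e1"
    show "sets ?\<kappa> = sets (\<eta> \<Otimes>\<^sub>M N)" by simp
    have "distr ?\<kappa> \<eta> fst = distr \<kappa> \<eta> ?e" by (subst distr_distr_eq) auto
    also have "\<dots> = distr \<kappa> (M \<Otimes>\<^sub>M M) ?e" by (rule distr_cong) (auto simp: sets\<eta>)
    finally show "distr ?\<kappa> \<eta> fst = \<eta>" by (simp add: \<eta>_def)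
    have "distr ?\<kappa> N snd = distr \<kappa> N (\<lambda>q. snd (fst q))" by (subst distr_distr_eq) auto
    also have "\<dots> = distr (distr \<kappa> (M \<Otimes>\<^sub>M N) fst) N snd" by (subst distr_distr_eq) auto
    finally show "distr ?\<kappa> N snd = N" by (simp add: \<kappa>1 distrN)
    have Rm: "rokhlin_ext ?R ?p1 S \<in> \<eta> \<Otimes>\<^sub>M N \<rightarrow>\<^sub>M \<eta> \<Otimes>\<^sub>M N"
      by (rule mp_isoD(2)[OF mp_iso_rokhlin_ext[OF _ _ isoR p1 spN S]]) unfold_locales
    have "distr ?\<kappa> ?\<kappa> (rokhlin_ext ?R ?p1 S) = distr ?\<kappa> (\<eta> \<Otimes>\<^sub>M N) (rokhlin_ext ?R ?p1 S)"
      by (rule distr_cong) auto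
    also have "\<dots> = distr \<kappa> (\<eta> \<Otimes>\<^sub>M N) (\<lambda>q. rokhlin_ext ?R ?p1 S (?e1 q))" by (rule distr_distr_eq[OF e1m Rm])
    also have "(\<lambda>q. rokhlin_ext ?R ?p1 S (?e1 q)) = (\<lambda>q. ?e1 (?F (fst q), ?G (snd q)))"
      by (simp add: rokhlin_ext_def split_beta')
    also have "distr \<kappa> (\<eta> \<Otimes>\<^sub>M N) \<dots> = distr (distr \<kappa> \<kappa> (\<lambda>q. (?F (fst q), ?G (snd q)))) (\<eta> \<Otimes>\<^sub>M N) ?e1"
      by (rule distr_distr_eq[OF FGm(1) e1m, symmetric])
    finally show "distr ?\<kappa> ?\<kappa> (rokhlin_ext ?R ?p1 S) = ?\<kappa>" by (simp only: FGm(2))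
  qed
  interpret \<eta>N: pair_prob_space \<eta> N ..
  let ?R2 = "rokhlin_ext ?R ?p1 S" and ?p3 = "\<lambda>r. ?p2 (fst r)"
  have sf\<eta>: "sigma_finite_measure \<eta>" and sfN: "sigma_finite_measure N" by unfold_locales
  have isoR2: "mp_iso (\<eta> \<Otimes>\<^sub>M N) ?R2" by (rule mp_iso_rokhlin_ext[OF sf\<eta> sfN isoR p1 spN S])
  have p3[measurable]: "?p3 \<in> borel_measurable (\<eta> \<Otimes>\<^sub>M N)" by measurable
  \<comment> \<open>The criterion yields ergodicity with the group coordinate adjoined before the
    fibre; uniqueness over the base \<open>\<eta>\<close> times \<open>N\<close> needs the group
    coordinate outermost, hence the rearrangement that follows.\<close>
  have "ergodic_map ((\<eta> \<Otimes>\<^sub>M L) \<Otimes>\<^sub>M N) (rokhlin_ext (group_ext ?R ?p2) (\<lambda>p. ?p1 (fst p)) S)"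
    by (rule rokhlin_ext_ergodic_of_mackey[OF pr\<eta> isoR p1 p2 e2 w prN spN S ergS])
  then have e3: "ergodic_map ((\<eta> \<Otimes>\<^sub>M N) \<Otimes>\<^sub>M L) (group_ext ?R2 ?p3)"
    by (rule ergodic_map_rearrange[OF sf\<eta> sfN sp\<eta> spN R\<eta> p1 p2 S])
  let ?e2 = "\<lambda>q. (?e1 q, snd (snd q))"
  have e2m[measurable]: "?e2 \<in> \<kappa> \<rightarrow>\<^sub>M (\<eta> \<Otimes>\<^sub>M N) \<Otimes>\<^sub>M N" by measurable
  show "distr \<kappa> ((\<eta> \<Otimes>\<^sub>M N) \<Otimes>\<^sub>M N) ?e2 = (\<eta> \<Otimes>\<^sub>M N) \<Otimes>\<^sub>M N"
  proof (rule rokhlin_joining_unique[OF \<eta>N.prob_space_axioms isoR2 p3 e3 prN setsN S])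
    let ?\<kappa> = "distr \<kappa> ((\<eta> \<Otimes>\<^sub>M N) \<Otimes>\<^sub>M N) ?e2"
    show "sets ?\<kappa> = sets ((\<eta> \<Otimes>\<^sub>M N) \<Otimes>\<^sub>M N)" by simp
    have "distr ?\<kappa> (\<eta> \<Otimes>\<^sub>M N) fst = distr \<kappa> (\<eta> \<Otimes>\<^sub>M N) ?e1" by (subst distr_distr_eq) auto
    then show "distr ?\<kappa> (\<eta> \<Otimes>\<^sub>M N) fst = \<eta> \<Otimes>\<^sub>M N" by (simp only: k1)
    have "distr ?\<kappa> N snd = distr \<kappa> N (\<lambda>q. snd (snd q))" by (subst distr_distr_eq) auto
    also have "\<dots> = distr (distr \<kappa> (M \<Otimes>\<^sub>M N) snd) N snd" by (subst distr_distr_eq) auto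
    finally show "distr ?\<kappa> N snd = N" by (simp add: \<kappa>2 distrN)
    have Rm: "rokhlin_ext ?R2 ?p3 S \<in> (\<eta> \<Otimes>\<^sub>M N) \<Otimes>\<^sub>M N \<rightarrow>\<^sub>M (\<eta> \<Otimes>\<^sub>M N) \<Otimes>\<^sub>M N"
      by (rule mp_isoD(2)[OF mp_iso_rokhlin_ext[OF _ _ isoR2 p3 spN S]]) unfold_locales
    have "distr ?\<kappa> ?\<kappa> (rokhlin_ext ?R2 ?p3 S) = distr ?\<kappa> ((\<eta> \<Otimes>\<^sub>M N) \<Otimes>\<^sub>M N) (rokhlin_ext ?R2 ?p3 S)"
      by (rule distr_cong) auto
    also have "\<dots> = distr \<kappa> ((\<eta> \<Otimes>\<^sub>M N) \<Otimes>\<^sub>M N) (\<lambda>q. rokhlin_ext ?R2 ?p3 S (?e2 q))" by (rule distr_distr_eq[OF e2m Rm])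
    also have "(\<lambda>q. rokhlin_ext ?R2 ?p3 S (?e2 q)) = (\<lambda>q. ?e2 (?F (fst q), ?G (snd q)))"
      by (simp add: rokhlin_ext_def split_beta')
    also have "distr \<kappa> ((\<eta> \<Otimes>\<^sub>M N) \<Otimes>\<^sub>M N) \<dots> = distr (distr \<kappa> \<kappa> (\<lambda>q. (?F (fst q), ?G (snd q)))) ((\<eta> \<Otimes>\<^sub>M N) \<Otimes>\<^sub>M N) ?e2"
      by (rule distr_distr_eq[OF FGm(1) e2m, symmetric])
    finally show "distr ?\<kappa> ?\<kappa> (rokhlin_ext ?R2 ?p3 S) = ?\<kappa>" by (simp only: FGm(2))
  qed
qed

end

section \<open>Integrals over product joinings and the AOP property\<close>

text \<open>Fibrewise the square of the mean is at most the mean of the square, as the variance is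
  nonnegative; Fubini gives the rest.\<close>

lemma square_integrable_fiber_mean:
  fixes F :: "'x \<times> 'y \<Rightarrow> complex"
  assumes "prob_space M" "prob_space N" and F[measurable]: "F \<in> borel_measurable (M \<Otimes>\<^sub>M N)"
    and sq: "integrable (M \<Otimes>\<^sub>M N) (\<lambda>p. (cmod (F p))\<^sup>2)"
  defines "f \<equiv> \<lambda>x. \<integral>y. F (x, y) \<partial>N"
  shows "f \<in> borel_measurable M" "integrable M (\<lambda>x. (cmod (f x))\<^sup>2)" "integral\<^sup>L M f = integral\<^sup>L (M \<Otimes>\<^sub>M N) F"
proof -
  interpret M: prob_space M by fact
  interpret N: prob_space N by fact
  interpret MN: pair_prob_space M N ..
  show f[measurable]: "f \<in> borel_measurable M" unfolding f_def by measurable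
  have "integrable (M \<Otimes>\<^sub>M N) (\<lambda>p. cmod (F p))"
    by (rule MN.square_integrable_imp_integrable[OF _ sq]) measurable
  then have intF: "integrable (M \<Otimes>\<^sub>M N) F" by (simp add: integrable_norm_iff)
  show "integral\<^sup>L M f = integral\<^sup>L (M \<Otimes>\<^sub>M N) F"
    unfolding f_def by (rule MN.integral_fst'[OF intF])
  have i2: "integrable M (\<lambda>x. \<integral>y. (cmod (F (x, y)))\<^sup>2 \<partial>N)"
    using MN.integrable_fst'[OF sq] by simp
  show "integrable M (\<lambda>x. (cmod (f x))\<^sup>2)"
  proof (rule Bochner_Integration.integrable_bound[OF i2])
    show "AE x in M. norm ((cmod (f x))\<^sup>2) \<le> norm (\<integral>y. (cmod (F (x, y)))\<^sup>2 \<partial>N)"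
      using MN.AE_integrable_fst'[OF sq] AE_space
    proof eventually_elim
      case (elim x)
      have [measurable]: "(\<lambda>y. F (x, y)) \<in> borel_measurable N" using elim(2) by measurable
      have ii: "integrable N (\<lambda>y. cmod (F (x, y)))"
        by (rule N.square_integrable_imp_integrable[OF _ elim(1)]) measurable
      have "cmod (f x) \<le> (\<integral>y. cmod (F (x, y)) \<partial>N)" unfolding f_def by (rule integral_norm_bound)
      then have "(cmod (f x))\<^sup>2 \<le> (\<integral>y. cmod (F (x, y)) \<partial>N)\<^sup>2" by (intro power_mono) auto
      also have "\<dots> \<le> (\<integral>y. (cmod (F (x, y)))\<^sup>2 \<partial>N)"
        using N.variance_eq[OF ii elim(1)] N.variance_positive[of "\<lambda>y. cmod (F (x, y))"] by simp
      finally show ?case by simp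
    qed
  qed measurable
qed

text \<open>Given the base point the two fibre coordinates are independent, so each function is
  replaced by its fibre mean. The product is integrable because its modulus is at most half the sum
  of squares, which the marginals control.\<close>

lemma joining_product_integral:
  fixes F G :: "'x \<times> 'y \<Rightarrow> complex"
  assumes "prob_space M" and prN: "prob_space N" and sets\<eta>: "sets \<eta> = sets (M \<Otimes>\<^sub>M M)" and pr\<eta>: "prob_space \<eta>"
    and F[measurable]: "F \<in> borel_measurable (M \<Otimes>\<^sub>M N)" and G[measurable]: "G \<in> borel_measurable (M \<Otimes>\<^sub>M N)"
    and sqF: "integrable (M \<Otimes>\<^sub>M N) (\<lambda>p. (cmod (F p))\<^sup>2)" and sqG: "integrable (M \<Otimes>\<^sub>M N) (\<lambda>p. (cmod (G p))\<^sup>2)"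
    and sets\<kappa>: "sets \<kappa> = sets ((M \<Otimes>\<^sub>M N) \<Otimes>\<^sub>M (M \<Otimes>\<^sub>M N))"
    and \<kappa>1: "distr \<kappa> (M \<Otimes>\<^sub>M N) fst = M \<Otimes>\<^sub>M N" and \<kappa>2: "distr \<kappa> (M \<Otimes>\<^sub>M N) snd = M \<Otimes>\<^sub>M N"
    and prod: "distr \<kappa> ((\<eta> \<Otimes>\<^sub>M N) \<Otimes>\<^sub>M N) (\<lambda>q. (((fst (fst q), fst (snd q)), snd (fst q)), snd (snd q))) = (\<eta> \<Otimes>\<^sub>M N) \<Otimes>\<^sub>M N"
  shows "(\<integral>q. F (fst q) * G (snd q) \<partial>\<kappa>) = (\<integral>w. (\<integral>y. F (fst w, y) \<partial>N) * (\<integral>y. G (snd w, y) \<partial>N) \<partial>\<eta>)"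
proof -
  interpret \<eta>: prob_space \<eta> by fact
  interpret N: prob_space N by fact
  interpret \<eta>N: pair_prob_space \<eta> N ..
  interpret \<eta>NN: pair_prob_space "\<eta> \<Otimes>\<^sub>M N" N ..
  note [measurable_cong] = sets\<eta> sets\<kappa>
  let ?e = "\<lambda>q. (((fst (fst q), fst (snd q)), snd (fst q)), snd (snd q))"
  have e[measurable]: "?e \<in> \<kappa> \<rightarrow>\<^sub>M (\<eta> \<Otimes>\<^sub>M N) \<Otimes>\<^sub>M N" by measurable
  let ?H = "\<lambda>r. F (fst (fst (fst r)), snd (fst r)) * G (snd (fst (fst r)), snd r)"
  have H[measurable]: "?H \<in> borel_measurable ((\<eta> \<Otimes>\<^sub>M N) \<Otimes>\<^sub>M N)" by measurable
  have iF: "integrable \<kappa> (\<lambda>q. (cmod (F (fst q)))\<^sup>2)" and iG: "integrable \<kappa> (\<lambda>q. (cmod (G (snd q)))\<^sup>2)"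
  proof -
    have m: "fst \<in> \<kappa> \<rightarrow>\<^sub>M M \<Otimes>\<^sub>M N" "snd \<in> \<kappa> \<rightarrow>\<^sub>M M \<Otimes>\<^sub>M N" by measurable
    show "integrable \<kappa> (\<lambda>q. (cmod (F (fst q)))\<^sup>2)"
      by (rule integrable_distr[OF m(1)]) (simp only: \<kappa>1 sqF)
    show "integrable \<kappa> (\<lambda>q. (cmod (G (snd q)))\<^sup>2)"
      by (rule integrable_distr[OF m(2)]) (simp only: \<kappa>2 sqG)
  qed
  have int\<kappa>: "integrable \<kappa> (\<lambda>q. F (fst q) * G (snd q))"
  proof (rule Bochner_Integration.integrable_bound)
    show "integrable \<kappa> (\<lambda>q. ((cmod (F (fst q)))\<^sup>2 + (cmod (G (snd q)))\<^sup>2) / 2)" using iF iG by simp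
    have "cmod a * cmod b \<le> ((cmod a)\<^sup>2 + (cmod b)\<^sup>2) / 2" for a b
      using sum_squares_bound[of "cmod a" "cmod b"] by simp
    then show "AE q in \<kappa>. norm (F (fst q) * G (snd q)) \<le> norm (((cmod (F (fst q)))\<^sup>2 + (cmod (G (snd q)))\<^sup>2) / 2)"
      by (simp add: norm_mult)
  qed measurable
  have intH: "integrable ((\<eta> \<Otimes>\<^sub>M N) \<Otimes>\<^sub>M N) ?H"
  proof -
    have "integrable (distr \<kappa> ((\<eta> \<Otimes>\<^sub>M N) \<Otimes>\<^sub>M N) ?e) ?H"
      using int\<kappa> unfolding integrable_distr_eq[OF e H] by simp
    then show ?thesis by (simp only: prod)
  qed
  have "(\<integral>q. F (fst q) * G (snd q) \<partial>\<kappa>) = (\<integral>r. ?H r \<partial>distr \<kappa> ((\<eta> \<Otimes>\<^sub>M N) \<Otimes>\<^sub>M N) ?e)"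
    by (subst integral_distr) auto
  also have "\<dots> = (\<integral>r. ?H r \<partial>((\<eta> \<Otimes>\<^sub>M N) \<Otimes>\<^sub>M N))" by (simp only: prod)
  also have "\<dots> = (\<integral>p. \<integral>y. ?H (p, y) \<partial>N \<partial>(\<eta> \<Otimes>\<^sub>M N))" by (rule \<eta>NN.integral_fst'[OF intH, symmetric])
  also have "\<dots> = (\<integral>p. F (fst (fst p), snd p) * (\<integral>y. G (snd (fst p), y) \<partial>N) \<partial>(\<eta> \<Otimes>\<^sub>M N))" by simp
  also have "\<dots> = (\<integral>w. \<integral>y. F (fst w, y) * (\<integral>y. G (snd w, y) \<partial>N) \<partial>N \<partial>\<eta>)"
  proof -
    have "integrable (\<eta> \<Otimes>\<^sub>M N) (\<lambda>p. F (fst (fst p), snd p) * (\<integral>y. G (snd (fst p), y) \<partial>N))"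
      using \<eta>NN.integrable_fst'[OF intH] by simp
    from \<eta>N.integral_fst'[OF this] show ?thesis by simp
  qed
  finally show ?thesis by simp
qed

theorem theorem4p1:
  fixes M :: "'x::polish_space measure" and T :: "'x \<Rightarrow> 'x"
    and L :: "'g::{topological_ab_group_add, second_countable_topology, t2_space} measure"
    and \<phi> :: "'x \<Rightarrow> 'g"
  assumes std: "standard_prob_space M"
    and aut: "mp_automorphism M T"
    and aop: "AOP M T"
    and lc: "locally_compact_space (euclidean :: 'g topology)"
    and haar: "haar_measure L"
    and phi_meas: "\<phi> \<in> borel_measurable M"
    and phi_erg: "ergodic_cocycle M T L \<phi>"
    and E4: "\<And>r s \<eta>. prime r \<Longrightarrow> prime s \<Longrightarrow> r \<noteq> s \<Longrightarrow>
               \<eta> \<in> ergodic_joinings M (T ^^ r) (T ^^ s) \<Longrightarrow>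
               ergodic_map (\<eta> \<Otimes>\<^sub>M L)
                 (group_ext (\<lambda>(x, x'). ((T ^^ r) x, (T ^^ s) x'))
                            (\<lambda>(x, x'). cocycle_sum T \<phi> r x))"
    and E5: "\<And>r s \<eta>. prime r \<Longrightarrow> prime s \<Longrightarrow> r \<noteq> s \<Longrightarrow>
               \<eta> \<in> ergodic_joinings M (T ^^ r) (T ^^ s) \<Longrightarrow>
               mackey_weakly_mixing \<eta> (\<lambda>(x, x'). ((T ^^ r) x, (T ^^ s) x')) (L \<Otimes>\<^sub>M L)
                 (\<lambda>(x, x'). (cocycle_sum T \<phi> r x, cocycle_sum T \<phi> s x'))"
  shows "\<And>(N :: 'y::polish_space measure) (S :: 'g \<Rightarrow> 'y \<Rightarrow> 'y).
           standard_prob_space N \<Longrightarrow> mp_action N S \<Longrightarrow> ergodic_action N S \<Longrightarrow>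
           AOP (M \<Otimes>\<^sub>M N) (rokhlin_ext T \<phi> S)"
proof -
  fix N :: "'y measure" and S :: "'g \<Rightarrow> 'y \<Rightarrow> 'y"
  assume stdN: "standard_prob_space N" and S: "mp_action N S" and ergS: "ergodic_action N S"
  interpret haar_group L by unfold_locales (rule lc, rule haar)
  have setsM: "sets M = sets borel" and prM: "prob_space M" using std by (auto simp: standard_prob_space_def)
  have setsN: "sets N = sets borel" and prN: "prob_space N" using stdN by (auto simp: standard_prob_space_def)
  interpret M: prob_space M by fact
  interpret N: prob_space N by fact
  interpret L: sigma_finite_measure L by (rule sigma_finite_L)
  have spM: "space M = UNIV" and spN: "space N = UNIV"
    using sets_eq_imp_space_eq[OF setsM] sets_eq_imp_space_eq[OF setsN] by simp_all
  have T: "mp_iso M T" by (rule mp_iso_automorphism[OF aut])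
  have sfM: "sigma_finite_measure M" and sfN: "sigma_finite_measure N" by unfold_locales
  have Tn: "mp_iso M (T ^^ n)" for n by (rule mp_iso_funpow[OF T])
  have cs: "cocycle_sum T \<phi> n \<in> borel_measurable M" for n by (rule cocycle_sum_measurable[OF T phi_meas])
  \<comment> \<open>\<open>E4\<close> concerns the first coordinate but all ordered pairs of primes;
    applied to the swapped joining with \<open>r\<close> and \<open>s\<close> exchanged it gives the
    statement for the second coordinate.\<close>
  have E4': "ergodic_map (\<eta> \<Otimes>\<^sub>M L) (group_ext (\<lambda>(x, x'). ((T ^^ r) x, (T ^^ s) x')) (\<lambda>(x, x'). cocycle_sum T \<phi> s x'))"
    if rs: "prime r" "prime s" "r \<noteq> s" and \<eta>: "\<eta> \<in> ergodic_joinings M (T ^^ r) (T ^^ s)" for r s \<eta>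
  proof -
    let ?s = "\<lambda>p. (snd p, fst p)"
    define \<eta>' where "\<eta>' = distr \<eta> (M \<Otimes>\<^sub>M M) ?s"
    have \<eta>': "\<eta>' \<in> ergodic_joinings M (T ^^ s) (T ^^ r)"
      unfolding \<eta>'_def by (rule ergodic_joinings_swap[OF spM mp_isoD(2)[OF Tn] mp_isoD(2)[OF Tn] \<eta>])
    have sets\<eta>[measurable_cong]: "sets \<eta> = sets (M \<Otimes>\<^sub>M M)" and pr: "prob_space \<eta>"
      using \<eta> by (auto simp: ergodic_joinings_def)
    have sets\<eta>'[measurable_cong]: "sets \<eta>' = sets (M \<Otimes>\<^sub>M M)" by (simp add: \<eta>'_def)
    have sp: "space \<eta> = UNIV" "space \<eta>' = UNIV"
      using sets_eq_imp_space_eq[OF sets\<eta>] sets_eq_imp_space_eq[OF sets\<eta>'] spM by (simp_all add: space_pair_measure)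
    interpret \<eta>: prob_space \<eta> by fact
    note [measurable] = mp_isoD(2)[OF Tn] cs
    have unswap: "distr \<eta>' \<eta> ?s = \<eta>"
    proof -
      have "distr \<eta>' \<eta> ?s = distr \<eta> \<eta> (\<lambda>p. ?s (?s p))"
        unfolding \<eta>'_def by (rule distr_distr_eq) measurable
      then show ?thesis by (simp add: distr_id)
    qed
    show ?thesis
    proof (rule ergodic_map_factor[OF E4[OF rs(2,1) rs(3)[symmetric] \<eta>'], where e = "\<lambda>p. (?s (fst p), snd p)"])
      show "space (\<eta>' \<Otimes>\<^sub>M L) = UNIV" "space (\<eta> \<Otimes>\<^sub>M L) = UNIV" by (simp_all add: space_pair_measure sp)
      show "(\<lambda>p. (?s (fst p), snd p)) \<in> \<eta>' \<Otimes>\<^sub>M L \<rightarrow>\<^sub>M \<eta> \<Otimes>\<^sub>M L" by measurable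
      have "distr \<eta>' \<eta> ?s \<Otimes>\<^sub>M distr L L (\<lambda>x. x) = distr (\<eta>' \<Otimes>\<^sub>M L) (\<eta> \<Otimes>\<^sub>M L) (\<lambda>(x, y). (?s x, y))"
        by (rule pair_measure_distr) (auto simp: L.sigma_finite_measure_axioms)
      then show "distr (\<eta>' \<Otimes>\<^sub>M L) (\<eta> \<Otimes>\<^sub>M L) (\<lambda>p. (?s (fst p), snd p)) = \<eta> \<Otimes>\<^sub>M L"
        by (simp add: unswap split_beta')
      show "group_ext (\<lambda>(x, x'). ((T ^^ r) x, (T ^^ s) x')) (\<lambda>(x, x'). cocycle_sum T \<phi> s x') \<in> \<eta> \<Otimes>\<^sub>M L \<rightarrow>\<^sub>M \<eta> \<Otimes>\<^sub>M L"
        unfolding group_ext_def split_beta' by measurable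
    qed (simp add: group_ext_def split_beta)
  qed
  show "AOP (M \<Otimes>\<^sub>M N) (rokhlin_ext T \<phi> S)"
    unfolding AOP_def
  proof (intro conjI allI impI)
    show "ergodic_map (M \<Otimes>\<^sub>M N) (rokhlin_ext T \<phi> S)"
      using phi_erg mp_isoD(2)[OF T] unfolding ergodic_cocycle_def
      by (intro ergodic_rokhlin_ext[OF sfM spM sfN spN S ergS _ phi_meas])
  next
    fix F G :: "'x \<times> 'y \<Rightarrow> complex" and \<epsilon> :: real
    assume FG: "F \<in> borel_measurable (M \<Otimes>\<^sub>M N) \<and> integrable (M \<Otimes>\<^sub>M N) (\<lambda>x. (cmod (F x))\<^sup>2) \<and> integral\<^sup>L (M \<Otimes>\<^sub>M N) F = 0 \<and>
      G \<in> borel_measurable (M \<Otimes>\<^sub>M N) \<and> integrable (M \<Otimes>\<^sub>M N) (\<lambda>x. (cmod (G x))\<^sup>2) \<and> integral\<^sup>L (M \<Otimes>\<^sub>M N) G = 0"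
      and \<epsilon>: "0 < \<epsilon>"
    \<comment> \<open>The fibre means have integral zero over \<open>M\<close> and are square
      integrable, so the AOP property of \<open>T\<close> applies to them.\<close>
    define f where "f x = (\<integral>y. F (x, y) \<partial>N)" for x
    define g where "g x = (\<integral>y. G (x, y) \<partial>N)" for x
    have "f \<in> borel_measurable M \<and> integrable M (\<lambda>x. (cmod (f x))\<^sup>2) \<and> integral\<^sup>L M f = 0"
      using square_integrable_fiber_mean[OF prM prN, of F] FG by (simp add: f_def[abs_def])
    moreover have "g \<in> borel_measurable M \<and> integrable M (\<lambda>x. (cmod (g x))\<^sup>2) \<and> integral\<^sup>L M g = 0"
      using square_integrable_fiber_mean[OF prM prN, of G] FG by (simp add: g_def[abs_def])
    ultimately have "\<exists>n. \<forall>r s. prime r \<and> prime s \<and> r \<noteq> s \<and> n \<le> r \<and> n \<le> s \<longrightarrow>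
        (\<forall>\<eta>\<in>ergodic_joinings M (T ^^ r) (T ^^ s). cmod (\<integral>z. f (fst z) * g (snd z) \<partial>\<eta>) \<le> \<epsilon>)"
      using \<epsilon> by (intro aop[unfolded AOP_def, THEN conjunct2, THEN spec, THEN spec, THEN mp, THEN spec, THEN mp]) simp_all
    then obtain n where n: "\<forall>r s. prime r \<and> prime s \<and> r \<noteq> s \<and> n \<le> r \<and> n \<le> s \<longrightarrow>
        (\<forall>\<eta>\<in>ergodic_joinings M (T ^^ r) (T ^^ s). cmod (\<integral>z. f (fst z) * g (snd z) \<partial>\<eta>) \<le> \<epsilon>)" ..
    \<comment> \<open>The threshold found for \<open>f\<close> and \<open>g\<close> serves
      unchanged, since the integral over each joining \<open>\<kappa>\<close> equals the one over
      its projection \<open>\<eta>\<close>.\<close>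
    show "\<exists>n. \<forall>r s. prime r \<and> prime s \<and> r \<noteq> s \<and> n \<le> r \<and> n \<le> s \<longrightarrow>
      (\<forall>\<kappa>\<in>ergodic_joinings (M \<Otimes>\<^sub>M N) (rokhlin_ext T \<phi> S ^^ r) (rokhlin_ext T \<phi> S ^^ s).
        cmod (\<integral>z. F (fst z) * G (snd z) \<partial>\<kappa>) \<le> \<epsilon>)"
    proof (intro exI[of _ n] allI impI ballI)
      fix r s \<kappa>
      assume "prime r \<and> prime s \<and> r \<noteq> s \<and> n \<le> r \<and> n \<le> s"
      then have rs: "prime r" "prime s" "r \<noteq> s" "n \<le> r" "n \<le> s" by auto
      assume "\<kappa> \<in> ergodic_joinings (M \<Otimes>\<^sub>M N) (rokhlin_ext T \<phi> S ^^ r) (rokhlin_ext T \<phi> S ^^ s)"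
      then have J: "\<kappa> \<in> ergodic_joinings (M \<Otimes>\<^sub>M N) (rokhlin_ext (T ^^ r) (cocycle_sum T \<phi> r) S)
          (rokhlin_ext (T ^^ s) (cocycle_sum T \<phi> s) S)"
        by (simp only: rokhlin_ext_funpow[OF S])
      define \<eta> where "\<eta> = distr \<kappa> (M \<Otimes>\<^sub>M M) (\<lambda>q. (fst (fst q), fst (snd q)))"
      note prod = rokhlin_joining_product[OF setsM prM Tn Tn cs cs setsN prN S ergS J \<eta>_def
          E4[OF rs(1-3)] E4'[OF rs(1-3)] E5[OF rs(1-3)]]
      have \<eta>: "sets \<eta> = sets (M \<Otimes>\<^sub>M M)" "prob_space \<eta>" using prod(1) by (auto simp: ergodic_joinings_def)
      have "(\<integral>z. F (fst z) * G (snd z) \<partial>\<kappa>) = (\<integral>w. f (fst w) * g (snd w) \<partial>\<eta>)"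
        unfolding f_def g_def
        by (rule joining_product_integral[OF prM prN \<eta> _ _ _ _ _ _ _ prod(2)])
           (use FG J in \<open>auto simp: ergodic_joinings_def\<close>)
      then show "cmod (\<integral>z. F (fst z) * G (snd z) \<partial>\<kappa>) \<le> \<epsilon>" using n rs prod(1) by simp
    qed
  qed
qed

end
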